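(* Suppose $|\mathbb F|=q<\infty$. Let $X\in P=\operatorname{Reg}(\mathcal M_{mn}^J)$ and put $s=\operatorname{rank}(X)$. (i) $\widehat R_X$ is the union of $q^{s(m-r)}$ $\mathcal R^J$-classes of $P$. (ii) $\widehat L_X$ is the union of $q^{s(n-r)}$ $\mathcal L^J$-classes of $P$. (iii) $\widehat H_X$ is the union of $q^{s(m+n-2r)}$ $\mathcal H^J$-classes of $P$, each of which has size $|\mathcal G_s|=q^{\binom s2}(q-1)^s[s]_q!$. The map $\phi:P\to\mathcal M_r$ is injective when restricted to any $\mathcal H^J$-class of $P$. (iv) If $H_{\overline X}$ is a non-group $\mathcal H$-class of $\mathcal M_r$, then each $\mathcal H^J$-class of $P$ contained in $\widehat H_X$ is a non-group. (v) If $H_{\overline X}$ is a group $\mathcal H$-class of $\mathcal M_r$, then each $\mathcal H^J$-class of $P$ contained in $\widehat H_X$ is a group isomorphic to $\mathcal G_s$; further, $\widehat H_X$ is a $q^{s(m-r)}\times q^{s(n-r)}$ rectangular group with respect to $\mathcal G_s$. (vi) $\widehat{\mathcal D}=\mathcal D^J$, and $\widehat D_X=D_X^J=D_s^J=\{Y\in P:\operatorname{rank}(Y)=s\}$ is the union of: (a) $\begin{bmatrix}r\\ s\end{bmatrix}_q$ $\widehat{\mathcal R}$-classes (and the same number of $\widehat{\mathcal L}$-classes) of $P$; (b) $q^{s(m-r)}\begin{bmatrix}r\\ s\end{bmatrix}_q$ $\mathcal R^J$-classes of $P$; (c) $q^{s(n-r)}\begin{bmatrix}r\\ s\end{bmatrix}_q$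 $\mathcal L^J$-classes of $P$; (d) $\begin{bmatrix}r\\ s\end{bmatrix}_q^2$ $\widehat{\mathcal H}$-classes of $P$; (e) $q^{s(m+n-2r)}\begin{bmatrix}r\\ s\end{bmatrix}_q^2$ $\mathcal H^J$-classes of $P$.
   Context: Let $\mathbb F$ be a field, $m,n\geq1$ integers, and $0\leq r\leq\min(m,n)$. $\mathcal M_{kl}$ denotes the set of all $k\times l$ matrices over $\mathbb F$ (a single empty matrix if $k=0$ or $l=0$), $\mathcal M_k=\mathcal M_{kk}$, and $\mathcal G_k$ is the group of invertible matrices in $\mathcal M_k$ ($\mathcal G_0$ is trivial). Let $J=\begin{bmatrix}I_r&O\\O&O\end{bmatrix}\in\mathcal M_{nm}$ (an $n\times m$ matrix), and let $\mathcal M_{mn}^J$ be the semigroup with underlying set $\mathcal M_{mn}$ and operation $X\star Y=XJY$. $P=\operatorname{Reg}(\mathcal M_{mn}^J)$ is the subsemigroup of all regular elements (those $X$ with $X=X\star Y\star X$ for some $Y$). It consists exactly of the matrices $[M,A,N]=\begin{bmatrix}A&AN\\ MA&MAN\end{bmatrix}$ with $A\in\mathcal M_r$, $M\in\mathcal M_{m-r,r}$, $N\in\mathcal M_{r,n-r}$. The map $\phi:P\to\mathcal M_r$, $[M,A,N]\mapsto A$ (taking the top-left $r\times r$ block) is a surjective homomorphism onto $\mathcal M_r$ under ordinary multiplication; write $\overline X=\phi(X)$. $\mathcal R^J,\mathcal L^J,\mathcal H^J,\mathcal D^J$ denote Green's relations of the semigroup $P$ and $D_X^J$ the $\mathcal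 D^J$-class of $X$ in $P$; $\mathcal R,\mathcal L,\mathcal H,\mathcal D$ denote Green's relations of the monoid $\mathcal M_r$, and $H_A$ the $\mathcal H$-class of $A$ in $\mathcal M_r$. For $\mathcal K\in\{\mathcal R,\mathcal L,\mathcal H,\mathcal D\}$ define $\widehat{\mathcal K}$ on $P$ by $X\mathrel{\widehat{\mathcal K}}Y$ iff $\overline X\mathrel{\mathcal K}\overline Y$ in $\mathcal M_r$, and let $\widehat K_X=\{Y\in P:X\mathrel{\widehat{\mathcal K}}Y\}$ be the $\widehat{\mathcal K}$-class of $X$. A $k\times l$ rectangular band is a semigroup $S\times T$ with product $(s_1,t_1)(s_2,t_2)=(s_1,t_2)$, where $|S|=k$, $|T|=l$; a $k\times l$ rectangular group with respect to a group $G$ is (a semigroup isomorphic to) the direct product of a $k\times l$ rectangular band with $G$. $[s]_q!=\prod_{i=1}^s(1+q+\cdots+q^{i-1})$, and $\begin{bmatrix}k\\ s\end{bmatrix}_q=\frac{[k]_q!}{[s]_q!\,[k-s]_q!}$ is the $q$-binomial coefficient. *)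

theory Defs
  imports "HOL-Algebra.Group" "Jordan_Normal_Form.DL_Rank"
begin

text \<open>
  A semigroup is represented by a \<open>monoid\<close> record of which only the carrier and the multiplication
  are relevant; the field \<open>one\<close> is left \<open>undefined\<close> when there is no distinguished identity.
  A subsemigroup is obtained by restricting the carrier.
\<close>

definition regular_elements :: "('a, 'b) monoid_scheme \<Rightarrow> 'a set" where
  "regular_elements G =
     {x \<in> carrier G. \<exists>y \<in> carrier G. x = x \<otimes>\<^bsub>G\<^esub> y \<otimes>\<^bsub>G\<^esub> x}"

text \<open>\<open>xG\<^sup>1\<close> and \<open>G\<^sup>1x\<close>, where \<open>G\<^sup>1\<close> is \<open>G\<close> with an identity adjoined.\<close>

definition principal_right_ideal :: "('a, 'b) monoid_scheme \<Rightarrow> 'a \<Rightarrow> 'a set" where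
  "principal_right_ideal G x = insert x ((\<lambda>y. x \<otimes>\<^bsub>G\<^esub> y) ` carrier G)"

definition principal_left_ideal :: "('a, 'b) monoid_scheme \<Rightarrow> 'a \<Rightarrow> 'a set" where
  "principal_left_ideal G x = insert x ((\<lambda>y. y \<otimes>\<^bsub>G\<^esub> x) ` carrier G)"

definition green_R :: "('a, 'b) monoid_scheme \<Rightarrow> 'a rel" where
  "green_R G = {(x, y) \<in> carrier G \<times> carrier G.
     principal_right_ideal G x = principal_right_ideal G y}"

definition green_L :: "('a, 'b) monoid_scheme \<Rightarrow> 'a rel" where
  "green_L G = {(x, y) \<in> carrier G \<times> carrier G.
     principal_left_ideal G x = principal_left_ideal G y}"

definition green_H :: "('a, 'b) monoid_scheme \<Rightarrow> 'a rel" where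
  "green_H G = green_R G \<inter> green_L G"

text \<open>
  The join of the two equivalences: the union is already reflexive on the carrier and symmetric,
  so its transitive closure is the least equivalence containing both.
\<close>

definition green_D :: "('a, 'b) monoid_scheme \<Rightarrow> 'a rel" where
  "green_D G = (green_R G \<union> green_L G)\<^sup>+"

definition is_subgroup_of_semigroup :: "('a, 'b) monoid_scheme \<Rightarrow> 'a set \<Rightarrow> bool" where
  "is_subgroup_of_semigroup G H \<longleftrightarrow> (\<exists>e. Group.group (G\<lparr>carrier := H, one := e\<rparr>))"

definition rectangular_band :: "'s set \<Rightarrow> 't set \<Rightarrow> ('s \<times> 't) monoid" where
  "rectangular_band S T =
     \<lparr>carrier = S \<times> T, mult = (\<lambda>(s1, t1) (s2, t2). (s1, t2)), one = undefined\<rparr>"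

text \<open>
  Index sets of natural numbers suffice, since only finite \<open>k\<close> and \<open>l\<close> are considered and
  the notion is invariant under isomorphism.
\<close>

definition is_rectangular_group ::
  "nat \<Rightarrow> nat \<Rightarrow> ('g, 'c) monoid_scheme \<Rightarrow> ('a, 'b) monoid_scheme \<Rightarrow> bool" where
  "is_rectangular_group k l G B \<longleftrightarrow>
     (\<exists>(S :: nat set) (T :: nat set). finite S \<and> card S = k \<and> finite T \<and> card T = l \<and>
        rectangular_band S T \<times>\<times> G \<cong> B)"

text \<open>\<open>A\<close> is the union of exactly \<open>k\<close> of the (pairwise disjoint) classes in \<open>\<C>\<close>.\<close>

definition is_union_of_classes :: "'a set \<Rightarrow> nat \<Rightarrow> 'a set set \<Rightarrow> bool" where
  "is_union_of_classes A k \<C> \<longleftrightarrow> (\<exists>\<K> \<subseteq> \<C>. finite \<K> \<and> card \<K> = k \<and> A = \<Union>\<K>)"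


definition J_mat :: "nat \<Rightarrow> nat \<Rightarrow> nat \<Rightarrow> 'a :: field mat" where
  "J_mat m n r =
     four_block_mat (1\<^sub>m r) (0\<^sub>m r (m - r)) (0\<^sub>m (n - r) r) (0\<^sub>m (n - r) (m - r))"

definition sandwich_semigroup :: "nat \<Rightarrow> nat \<Rightarrow> nat \<Rightarrow> 'a :: field mat monoid" where
  "sandwich_semigroup m n r =
     \<lparr>carrier = carrier_mat m n, mult = (\<lambda>X Y. X * J_mat m n r * Y), one = undefined\<rparr>"

definition reg_sandwich :: "nat \<Rightarrow> nat \<Rightarrow> nat \<Rightarrow> 'a :: field mat monoid" where
  "reg_sandwich m n r =
     (sandwich_semigroup m n r)\<lparr>carrier := regular_elements (sandwich_semigroup m n r)\<rparr>"

definition top_left_block :: "nat \<Rightarrow> 'a mat \<Rightarrow> 'a mat" where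
  "top_left_block r X = mat r r (\<lambda>(i, j). X $$ (i, j))"

abbreviation full_mat_monoid :: "'a :: field itself \<Rightarrow> nat \<Rightarrow> 'a mat ring" where
  "full_mat_monoid ty k \<equiv> ring_mat ty k ()"

abbreviation general_linear_group :: "'a :: field itself \<Rightarrow> nat \<Rightarrow> 'a mat monoid" where
  "general_linear_group ty k \<equiv> units_of (full_mat_monoid ty k)"

text \<open>The pullback along \<open>\<phi>\<close> of a relation \<open>K\<close> to the set \<open>A\<close>.\<close>

definition hat_rel :: "'a set \<Rightarrow> ('a \<Rightarrow> 'b) \<Rightarrow> 'b rel \<Rightarrow> 'a rel" where
  "hat_rel A \<phi> K = {(x, y) \<in> A \<times> A. (\<phi> x, \<phi> y) \<in> K}"


definition q_factorial :: "nat \<Rightarrow> nat \<Rightarrow> nat" where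
  "q_factorial q s = (\<Prod>i = 1..s. \<Sum>j<i. q ^ j)"

text \<open>The division is exact whenever \<open>s \<le> k\<close>, see \<open>q_binomial_exact\<close> below.\<close>

definition q_binomial :: "nat \<Rightarrow> nat \<Rightarrow> nat \<Rightarrow> nat" where
  "q_binomial q k s = q_factorial q k div (q_factorial q s * q_factorial q (k - s))"

lemma q_factorial_dvd:
  "s \<le> k \<Longrightarrow> q_factorial q s * q_factorial q (k - s) dvd q_factorial q k"
proof (induction k arbitrary: s)
  case 0
  then show ?case by (simp add: q_factorial_def)
next
  case (Suc k)
  define b where "b i = (\<Sum>j<i. q ^ j)" for i
  have fS: "q_factorial q (Suc i) = q_factorial q i * b (Suc i)" for i
    by (simp add: q_factorial_def b_def)
  consider "s = 0" | "s = Suc k" | t where "s = Suc t" "s \<le> k"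
    using Suc.prems by (cases s) (auto simp: le_Suc_eq)
  then show ?case
  proof cases
    case 3
    have ks: "Suc k - s = Suc (k - s)" "k - t = Suc (k - s)" using 3 by auto
    have b_add: "b (i + l) = b i + q ^ i * b l" for i l
      by (induction l) (auto simp: b_def algebra_simps power_add)
    have split: "b (Suc k) = b s + q ^ s * b (Suc (k - s))"
      using b_add[of s "Suc (k - s)"] 3 by simp
    have "q_factorial q t * q_factorial q (k - t) dvd q_factorial q k"
      using Suc.IH[of t] 3 by simp
    then have "q_factorial q t * q_factorial q (k - t) * b s dvd q_factorial q k * b s"
      by (rule mult_dvd_mono) simp
    then have 1: "q_factorial q s * q_factorial q (Suc k - s) dvd q_factorial q k * b s"
      using 3 by (simp add: ks fS mult_ac)
    have "q_factorial q s * q_factorial q (k - s) * b (Suc (k - s))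
            dvd q_factorial q k * b (Suc (k - s))"
      using Suc.IH[of s] 3 by (intro mult_dvd_mono) auto
    then have 2: "q_factorial q s * q_factorial q (Suc k - s)
            dvd q_factorial q k * b (Suc (k - s)) * q ^ s"
      unfolding ks fS mult.assoc[symmetric] by (rule dvd_mult2)
    have "q_factorial q (Suc k) = q_factorial q k * b s + q_factorial q k * b (Suc (k - s)) * q ^ s"
      unfolding fS split by (simp add: algebra_simps)
    with 1 2 show ?thesis by (metis dvd_add)
  qed (simp_all add: q_factorial_def)
qed

lemma q_binomial_exact:
  "s \<le> k \<Longrightarrow>
     q_binomial q k s * (q_factorial q s * q_factorial q (k - s)) = q_factorial q k"
  by (simp add: q_binomial_def q_factorial_dvd)

end

theory Submission
  imports Defs
begin

text \<open>
  An element of \<open>P\<close> of rank \<open>s\<close> is a product \<open>U V\<close>, where \<open>U\<close> is an \<open>m \<times> s\<close> matrix whose top \<open>r \<times> s\<close> block is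
  left invertible and \<open>V\<close> is an \<open>s \<times> n\<close> matrix whose left \<open>s \<times> r\<close> block is right invertible; the factors
  are unique up to replacing \<open>(U, V)\<close> by \<open>(U g, g\<^sup>-\<^sup>1 V)\<close> with \<open>g\<close> in \<open>GL\<^sub>s\<close>. Within a fixed rank, \<open>\<R>\<^sup>J\<close>-classes are the
  orbits of \<open>U\<close> under \<open>GL\<^sub>s\<close>, \<open>\<L>\<^sup>J\<close>-classes those of \<open>V\<close>, and the \<open>\<H>\<^sup>J\<close>-class of \<open>U V\<close> is \<open>{U g V | g \<in> GL\<^sub>s}\<close>. The hat
  relations are given by the orbits of the blocks alone, because \<open>\<M>\<^sub>r\<close> is the case \<open>m = n = r\<close>. Since
  \<open>GL\<^sub>s\<close> acts freely, all the numbers follow from counting left invertible \<open>r \<times> s\<close> matrices column by column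
  and from the \<open>q\<^bsup>s(m - r)\<^esup>\<close> ways to complete a top block. Finally \<open>U g V \<star> U' h V' = U g (V J U') h V'\<close>, so the \<open>\<H>\<^sup>J\<close>-class of
  \<open>U V\<close> is a group iff \<open>V J U\<close> is invertible, a condition on the blocks only.
\<close>

text \<open>The condition on the blocks is what regularity says about a rank factorization. With
  \<open>J = b a\<close>, where \<open>a\<close> cuts out rows and \<open>b\<close> columns,
  cancelling the outer factors of \<open>U V = U V J Y J U V\<close> leaves
  \<open>V b a Y b a U = 1\<close>, so \<open>a U\<close> has a left and \<open>V b\<close> a right
  inverse. The obstacle is that Green's relations of \<open>P\<close> admit only multipliers from
  \<open>P\<close>, whereas solving for a multiplier naturally yields an arbitrary matrix. Arbitrary
  matrices suffice to derive the orbit conditions; for the converse, multipliers in \<open>P\<close>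
  are built by padding a one-sided inverse of a block with zeros. Every count is a power of
  \<open>q\<close> times the size of a set of block representatives: a single block for a hat class,
  and one block per \<open>s\<close>-dimensional subspace of the \<open>r\<close>-dimensional column
  space for a whole D-class, whence the q-binomial. The group structure needs a twist. Inside one
  H-class multiplication sends \<open>g\<close> and \<open>h\<close> to \<open>g W h\<close> with
  \<open>W = V b a U\<close>, and only after inserting the inverse of \<open>W\<close> into the
  parametrization does it become multiplication in \<open>GL s\<close>.\<close>

section \<open>Rank factorization\<close>

text \<open>
  The library's associativity rules have dimension premises with free variables, on which the simplifier
  diverges; \<open>mat_assoc\<close> below states the premises through \<open>dim_row\<close> and \<open>dim_col\<close> instead.
\<close>

declare assoc_mult_mat [simp del] assoc_mult_mat_vec [simp del]

lemma mat_assoc: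
  fixes A B C :: "'a :: semiring_0 mat"
  assumes "dim_col A = dim_row B" and "dim_col B = dim_row C"
  shows "A * B * C = A * (B * C)"
  by (rule assoc_mult_mat[of A "dim_row A" "dim_col A" B "dim_col B" C "dim_col C"])
    (use assms in \<open>auto intro: carrier_matI\<close>)

lemma one_mult_mat: "dim_row A = k \<Longrightarrow> 1\<^sub>m k * A = (A :: 'a :: semiring_1 mat)"
  by auto

lemma mult_one_mat: "dim_col A = k \<Longrightarrow> A * 1\<^sub>m k = (A :: 'a :: semiring_1 mat)"
  by auto

section \<open>One-sided inverses and rank\<close>

lemma left_cancel_mat:
  fixes U W W' K :: "'a :: semiring_1 mat"
  assumes "K * U = 1\<^sub>m k" "K \<in> carrier_mat k l" "U \<in> carrier_mat l k"
    and "W \<in> carrier_mat k j" "W' \<in> carrier_mat k j" "U * W = U * W'"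
  shows "W = W'"
proof -
  have "K * U * W = K * U * W'" using assms(2-) by (simp add: mat_assoc)
  thus ?thesis unfolding assms(1) using assms(4,5) by simp
qed

text \<open>If \<open>s < t\<close>, zero columns for \<open>K\<close> and zero rows for
  \<open>B\<close> make both square without changing \<open>K * B\<close>. A square left inverse is
  also a right inverse, but row \<open>s\<close> of \<open>B0 * K0\<close> vanishes. All rank
  inequalities below are reduced to this one.\<close>

lemma left_inverse_mat_le:
  fixes K B :: "'a :: field mat"
  assumes K: "K \<in> carrier_mat t s" and B: "B \<in> carrier_mat s t" and KB: "K * B = 1\<^sub>m t"
  shows "t \<le> s"
proof (rule ccontr)
  assume "\<not> t \<le> s"
  hence st: "s < t" by simp
  define K0 where "K0 = mat t t (\<lambda>(i, j). if j < s then K $$ (i, j) else 0)"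
  define B0 where "B0 = mat t t (\<lambda>(i, j). if i < s then B $$ (i, j) else 0)"
  have c: "K0 \<in> carrier_mat t t" "B0 \<in> carrier_mat t t" by (auto simp: K0_def B0_def)
  have "K0 * B0 = K * B"
  proof (rule eq_matI)
    fix i j assume "i < dim_row (K * B)" "j < dim_col (K * B)"
    hence ij: "i < t" "j < t" using K B by auto
    have "(K0 * B0) $$ (i, j) = (\<Sum>k\<in>{0..<t}. K0 $$ (i, k) * B0 $$ (k, j))"
      using ij c by (simp add: scalar_prod_def)
    also have "\<dots> = (\<Sum>k\<in>{0..<s}. K $$ (i, k) * B $$ (k, j))"
      using ij st by (intro sum.mono_neutral_cong_right) (auto simp: K0_def B0_def)
    also have "\<dots> = (K * B) $$ (i, j)" using ij K B by (simp add: scalar_prod_def)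
    finally show "(K0 * B0) $$ (i, j) = (K * B) $$ (i, j)" .
  qed (use c K B in auto)
  hence "B0 * K0 = 1\<^sub>m t" using mat_mult_left_right_inverse[OF c] KB by simp
  moreover have "(B0 * K0) $$ (s, s) = 0"
    using st by (auto simp: B0_def K0_def scalar_prod_def intro!: sum.neutral)
  ultimately show False using st by simp
qed

text \<open>A trivial kernel forces a pivot in every column of the Gauss-Jordan form
  \<open>C = Q * B\<close>. The pivot rows of \<open>C\<close> then form an identity matrix, and
  selecting them inverts \<open>B\<close> from the left.\<close>

lemma injective_imp_left_inverse_mat:
  fixes B :: "'a :: field mat"
  assumes B: "B \<in> carrier_mat r s"
    and inj: "\<And>v. v \<in> carrier_vec s \<Longrightarrow> B *\<^sub>v v = 0\<^sub>v r \<Longrightarrow> v = 0\<^sub>v s"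
  obtains K where "K \<in> carrier_mat s r" "K * B = 1\<^sub>m s"
proof -
  define C where "C = gauss_jordan_single B"
  note gj = gauss_jordan_single[OF B C_def[symmetric]]
  from gj(4) obtain Q where Q: "Q \<in> carrier_mat r r" "C = Q * B" by auto
  have C: "C \<in> carrier_mat r s" by (rule gj(2))
  \<comment> \<open>A column without pivot would yield a nonzero vector in the kernel of
    \<open>C\<close>, which is also the kernel of \<open>B\<close>.\<close>
  have piv: "snd ` set (pivot_positions C) = {0..<s}"
  proof (rule ccontr)
    assume *: "snd ` set (pivot_positions C) \<noteq> {0..<s}"
    from find_base_vector[OF gj(3) gj(2) *] gj(1) inj show False by blast
  qed
  from gj(3) obtain f where f: "pivot_fun C f s" using C by (auto simp: row_echelon_form_def)
  have dC: "dim_row C = r" using C by simp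
  have "\<exists>i. i < r \<and> f i = j" if "j < s" for j
  proof -
    from that piv have "j \<in> snd ` set (pivot_positions C)" by simp
    with pivot_positions(1)[OF C f] show ?thesis by auto
  qed
  then obtain h where h: "\<And>j. j < s \<Longrightarrow> h j < r \<and> f (h j) = j" by metis
  \<comment> \<open>Selects the pivot rows: row \<open>j\<close> of \<open>E * C\<close> is the row
    of \<open>C\<close> whose pivot is in column \<open>j\<close>.\<close>
  define E where "E = mat s r (\<lambda>(i, j). if j = h i then 1 else (0 :: 'a))"
  have E: "E \<in> carrier_mat s r" by (simp add: E_def)
  have "E * C = 1\<^sub>m s"
  proof (rule eq_matI)
    fix i j assume "i < dim_row (1\<^sub>m s)" "j < dim_col (1\<^sub>m s)"
    hence ij: "i < s" "j < s" by auto
    have "(E * C) $$ (i, j) = (\<Sum>k\<in>{0..<r}. (if k = h i then 1 else 0) * C $$ (k, j))"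
      using ij E C by (simp add: scalar_prod_def) (simp add: E_def)
    also have "\<dots> = C $$ (h i, j)" using h[OF ij(1)] by (simp add: sum.delta if_distrib if_distribR cong: if_cong)
    also have "\<dots> = 1\<^sub>m s $$ (i, j)"
      using h[OF ij(1)] h[OF ij(2)] pivot_funD(4)[OF dC f, of "h i"] pivot_funD(5)[OF dC f, of "h j" "h i"] ij
      by (cases "i = j") (simp, metis index_one_mat(1))
    finally show "(E * C) $$ (i, j) = 1\<^sub>m s $$ (i, j)" .
  qed (use E C in auto)
  hence "(E * Q) * B = 1\<^sub>m s" using Q E B by (simp add: mat_assoc)
  thus ?thesis using that[of "E * Q"] E Q by auto
qed

lemma left_inverse_imp_injective_mat:
  fixes B :: "'a :: field mat"
  assumes "K \<in> carrier_mat s r" "B \<in> carrier_mat r s" "K * B = 1\<^sub>m s"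
    and "v \<in> carrier_vec s" "B *\<^sub>v v = 0\<^sub>v r"
  shows "v = 0\<^sub>v s"
proof -
  have "K *\<^sub>v 0\<^sub>v r = (K * B) *\<^sub>v v"
    using assoc_mult_mat_vec[OF assms(1,2,4)] assms(5) by simp
  moreover have "K *\<^sub>v 0\<^sub>v r = 0\<^sub>v s" using assms(1) by auto
  ultimately show ?thesis using assms(3,4) by simp
qed

text \<open>\<open>U\<close> consists of a maximal independent set of columns of \<open>X\<close>,
  and \<open>V\<close> holds the coordinates of all columns of \<open>X\<close> in this basis. The
  basis columns occur in \<open>X\<close> themselves, so \<open>V\<close> contains the unit vectors
  among its columns and is right invertible.\<close>

lemma rank_factorization:
  fixes X :: "'a :: field mat"
  assumes X: "X \<in> carrier_mat m n" and s: "s = vec_space.rank m X"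
  obtains U V K L where "U \<in> carrier_mat m s" "V \<in> carrier_mat s n" "X = U * V"
    "K \<in> carrier_mat s m" "K * U = 1\<^sub>m s" "L \<in> carrier_mat n s" "V * L = 1\<^sub>m s"
proof -
  interpret vec_space "TYPE('a)" m .
  obtain S where mx: "maximal S (\<lambda>T. T \<subseteq> set (cols X) \<and> lin_indpt T)"
    using maximal_exists_superset[of "set (cols X)" "\<lambda>T. T \<subseteq> set (cols X) \<and> lin_indpt T" "{}"]
      finite_lin_indpt2[of "{}"] by auto
  have S: "S \<subseteq> set (cols X)" "lin_indpt S" using mx by (auto simp: maximal_def)
  have Sc: "S \<subseteq> carrier_vec m" using S(1) cols_dim X by blast
  have cs: "card S = s" using rank_card_indpt[OF X mx] s by simp
  have finS: "finite S" using S(1) by (rule finite_subset) simp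
  obtain xs where xs: "set xs = S" "distinct xs" using finite_distinct_list[OF finS] by auto
  have lxs: "length xs = s" using xs cs distinct_card by fastforce
  define U where "U = mat_of_cols m xs"
  have U: "U \<in> carrier_mat m s" by (rule carrier_matI) (simp_all add: U_def lxs)
  have cU: "cols U = xs" unfolding U_def by (rule cols_mat_of_cols) (use xs Sc in auto)
  have injU: "v = 0\<^sub>v s" if "v \<in> carrier_vec s" "U *\<^sub>v v = 0\<^sub>v m" for v
    using lin_depI[OF U that(1) _ that(2)] cU xs S(2) by auto
  obtain K where K: "K \<in> carrier_mat s m" "K * U = 1\<^sub>m s"
    using injective_imp_left_inverse_mat[OF U injU] by auto
  \<comment> \<open>Maximality of \<open>S\<close> puts every column of \<open>X\<close> into its
    span; the coefficients of the linear combination become \<open>w\<close>.\<close>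
  have "\<exists>w. w \<in> carrier_vec s \<and> col X j = U *\<^sub>v w" if j: "j < n" for j
  proof -
    have cj: "col X j \<in> set (cols X)" using j X by (metis carrier_matD(2) cols_length cols_nth nth_mem)
    have cjc: "col X j \<in> carrier_vec m" using X by auto
    have sp: "col X j \<in> span S"
    proof (cases "col X j \<in> S")
      case True
      thus ?thesis using in_own_span[of S] Sc by auto
    next
      case False
      have "lin_dep (insert (col X j) S)"
      proof (rule ccontr)
        assume "\<not> ?thesis"
        hence "insert (col X j) S \<subseteq> set (cols X) \<and> lin_indpt (insert (col X j) S)"
          using S cj by auto
        with mx have "S = insert (col X j) S" unfolding maximal_def by blast
        with False show False by blast
      qed
      thus ?thesis using lin_dep_iff_in_span[OF Sc S(2) cjc False] by simp
    qed
    obtain a where "col X j = lincomb a S"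
      using finite_in_span[OF finS _ sp] Sc by (auto dest: sym)
    hence "col X j = U *\<^sub>v vec s (\<lambda>i. a (col U i))"
      using mat_mult_eq_lincomb[OF U, of a] cU xs by auto
    thus ?thesis by (intro exI[of _ "vec s (\<lambda>i. a (col U i))"]) simp
  qed
  then obtain w where w: "\<And>j. j < n \<Longrightarrow> w j \<in> carrier_vec s \<and> col X j = U *\<^sub>v w j" by metis
  define V where "V = mat_of_cols s (map w [0..<n])"
  have V: "V \<in> carrier_mat s n" by (rule carrier_matI) (simp_all add: V_def)
  have colV: "col V j = w j" if "j < n" for j
    unfolding V_def by (subst col_mat_of_cols) (use that w in auto)
  have XUV: "X = U * V"
  proof (rule mat_col_eqI)
    fix j assume "j < dim_col (U * V)"
    hence j: "j < n" using V by simp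
    have "col (U * V) j = U *\<^sub>v w j" unfolding col_mult2[OF U V j] colV[OF j] ..
    thus "col X j = col (U * V) j" using w[OF j] by simp
  qed (use X U V in auto)
  have "\<exists>h. h < n \<and> col X h = col U i" if i: "i < s" for i
  proof -
    have "col U i = xs ! i" using i U cU by (metis carrier_matD(2) cols_nth)
    hence "col U i \<in> set (cols X)" using i lxs xs S(1) by auto
    thus ?thesis using X by (metis carrier_matD(2) cols_length cols_nth in_set_conv_nth)
  qed
  then obtain h where h: "\<And>i. i < s \<Longrightarrow> h i < n \<and> col X (h i) = col U i" by metis
  \<comment> \<open>Coordinates were only chosen to exist; the left inverse \<open>K\<close> makes
    them unique, so a basis column has a unit vector as coordinates.\<close>
  have colVh: "w (h i) = unit_vec s i" if i: "i < s" for i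
  proof -
    have "U *\<^sub>v w (h i) = U *\<^sub>v unit_vec s i"
    proof -
      have "U *\<^sub>v unit_vec s i = col U i" using U i by (intro eq_vecI) auto
      thus ?thesis using h[OF i] w[of "h i"] by simp
    qed
    hence "K *\<^sub>v (U *\<^sub>v w (h i)) = K *\<^sub>v (U *\<^sub>v unit_vec s i)" by simp
    moreover have "w (h i) \<in> carrier_vec s" using w h[OF i] by simp
    ultimately have "(K * U) *\<^sub>v w (h i) = (K * U) *\<^sub>v unit_vec s i"
      using assoc_mult_mat_vec[OF K(1) U] by simp
    thus ?thesis unfolding K(2) using \<open>w (h i) \<in> carrier_vec s\<close> by simp
  qed
  \<comment> \<open>Selects the columns \<open>h j\<close> of \<open>V\<close>, which are the unit
    vectors.\<close>
  define L where "L = mat n s (\<lambda>(i, j). if i = h j then 1 else (0 :: 'a))"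
  have L: "L \<in> carrier_mat n s" by (simp add: L_def)
  have "V * L = 1\<^sub>m s"
  proof (rule eq_matI)
    fix i j assume "i < dim_row (1\<^sub>m s)" "j < dim_col (1\<^sub>m s)"
    hence ij: "i < s" "j < s" by auto
    have "(V * L) $$ (i, j) = (\<Sum>k\<in>{0..<n}. V $$ (i, k) * (if k = h j then 1 else 0))"
      using ij V L by (simp add: scalar_prod_def) (simp add: L_def)
    also have "\<dots> = V $$ (i, h j)" using h[OF ij(2)] by (simp add: sum.delta if_distrib cong: if_cong)
    also have "\<dots> = col V (h j) $ i" using ij V h[OF ij(2)] by simp
    also have "\<dots> = 1\<^sub>m s $$ (i, j)" using ij colV[of "h j"] h[OF ij(2)] colVh[OF ij(2)] by auto
    finally show "(V * L) $$ (i, j) = 1\<^sub>m s $$ (i, j)" .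
  qed (use V L in auto)
  with that[OF U V XUV K L] show ?thesis .
qed

text \<open>A rank factorization of \<open>U * V\<close> of size \<open>t\<close> is a second
  factorization with one-sided inverses. Each of the two identity matrices factors through the size
  of the other, which gives \<open>s \<le> t\<close> and \<open>t \<le> s\<close>.\<close>

lemma rank_mult_full_rank:
  fixes U V :: "'a :: field mat"
  assumes U: "U \<in> carrier_mat m s" and V: "V \<in> carrier_mat s n"
    and K: "K \<in> carrier_mat s m" "K * U = 1\<^sub>m s" and L: "L \<in> carrier_mat n s" "V * L = 1\<^sub>m s"
  shows "vec_space.rank m (U * V) = s"
proof -
  define t where "t = vec_space.rank m (U * V)"
  have UV: "U * V \<in> carrier_mat m n" using U V by simp
  obtain U' V' K' L' where f: "U' \<in> carrier_mat m t" "V' \<in> carrier_mat t n" "U * V = U' * V'"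
    "K' \<in> carrier_mat t m" "K' * U' = 1\<^sub>m t" "L' \<in> carrier_mat n t" "V' * L' = 1\<^sub>m t"
    using rank_factorization[OF UV t_def] by blast
  have "(K * U') * (V' * L) = K * (U' * V') * L" using f(1,2,4,6) U V K(1) L(1) by (simp add: mat_assoc)
  also have "\<dots> = (K * U) * (V * L)" unfolding f(3)[symmetric] using U V K(1) L(1) by (simp add: mat_assoc)
  also have "\<dots> = 1\<^sub>m s" using K L by simp
  finally have 1: "(K * U') * (V' * L) = 1\<^sub>m s" .
  have "(K' * U) * (V * L') = K' * (U * V) * L'" using f(1,2,4,6) U V K(1) L(1) by (simp add: mat_assoc)
  also have "\<dots> = (K' * U') * (V' * L')" unfolding f(3) using f(1,2,4,6) by (simp add: mat_assoc)
  also have "\<dots> = 1\<^sub>m t" using f by simp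
  finally have 2: "(K' * U) * (V * L') = 1\<^sub>m t" .
  have "s \<le> t" by (rule left_inverse_mat_le[OF _ _ 1]) (use f U V K L in auto)
  moreover have "t \<le> s" by (rule left_inverse_mat_le[OF _ _ 2]) (use f U V K L in auto)
  ultimately show ?thesis by (simp add: t_def)
qed

text \<open>Stripping a rank factorization of \<open>A * B\<close> leaves an identity of size
  \<open>t\<close>. Replacing \<open>A\<close>, respectively \<open>B\<close>, by its own rank
  factorization shows that this identity factors through the rank of that matrix.\<close>

lemma rank_mult_le:
  fixes A B :: "'a :: field mat"
  assumes A: "A \<in> carrier_mat m k" and B: "B \<in> carrier_mat k n"
  shows "vec_space.rank m (A * B) \<le> vec_space.rank m A"
    and "vec_space.rank m (A * B) \<le> vec_space.rank k B"
proof -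
  define t where "t = vec_space.rank m (A * B)"
  have AB: "A * B \<in> carrier_mat m n" using A B by simp
  obtain U V K L where f: "U \<in> carrier_mat m t" "V \<in> carrier_mat t n" "A * B = U * V"
    "K \<in> carrier_mat t m" "K * U = 1\<^sub>m t" "L \<in> carrier_mat n t" "V * L = 1\<^sub>m t"
    using rank_factorization[OF AB t_def] by blast
  have id: "K * (A * B) * L = 1\<^sub>m t"
  proof -
    have "K * (A * B) * L = (K * U) * (V * L)"
      unfolding f(3) using f(1,2,4,6) by (simp add: mat_assoc)
    thus ?thesis using f by simp
  qed
  obtain U1 V1 where 1: "U1 \<in> carrier_mat m (vec_space.rank m A)" "V1 \<in> carrier_mat (vec_space.rank m A) k"
    "A = U1 * V1" using rank_factorization[OF A refl] by metis
  have "(K * U1) * (V1 * B * L) = 1\<^sub>m t"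
    using id f(4,6) 1(1,2) B unfolding 1(3) by (simp add: mat_assoc)
  thus "vec_space.rank m (A * B) \<le> vec_space.rank m A" unfolding t_def[symmetric]
    by (rule left_inverse_mat_le[rotated 2]) (use f 1(1,2) B in auto)
  obtain U2 V2 where 2: "U2 \<in> carrier_mat k (vec_space.rank k B)" "V2 \<in> carrier_mat (vec_space.rank k B) n"
    "B = U2 * V2" using rank_factorization[OF B refl] by metis
  have "(K * A * U2) * (V2 * L) = 1\<^sub>m t"
    using id f(4,6) 2(1,2) A unfolding 2(3) by (simp add: mat_assoc)
  thus "vec_space.rank m (A * B) \<le> vec_space.rank k B" unfolding t_def[symmetric]
    by (rule left_inverse_mat_le[rotated 2]) (use f 2(1,2) A in auto)
qed

section \<open>Counting left invertible matrices\<close>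

lemma finite_carrier_mat_and_card:
  assumes "finite (UNIV :: 'a set)"
  shows "finite (carrier_mat m n :: 'a mat set)"
    and "card (carrier_mat m n :: 'a mat set) = card (UNIV :: 'a set) ^ (m * n)"
proof -
  let ?I = "{..<m} \<times> {..<n}"
  have "bij_betw (\<lambda>A. restrict (\<lambda>ij. A $$ ij) ?I) (carrier_mat m n) (?I \<rightarrow>\<^sub>E (UNIV :: 'a set))"
    by (rule bij_betwI[where g = "mat m n"])
      (auto simp: extensional_def fun_eq_iff PiE_def)
  moreover have "finite (?I \<rightarrow>\<^sub>E (UNIV :: 'a set))" using assms by (intro finite_PiE) auto
  moreover have "card (?I \<rightarrow>\<^sub>E (UNIV :: 'a set)) = card (UNIV :: 'a set) ^ (m * n)"
    by (simp add: card_PiE)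
  ultimately show "finite (carrier_mat m n :: 'a mat set)"
    "card (carrier_mat m n :: 'a mat set) = card (UNIV :: 'a set) ^ (m * n)"
    by (simp_all add: bij_betw_finite bij_betw_same_card)
qed

lemma finite_carrier_vec_and_card:
  assumes "finite (UNIV :: 'a set)"
  shows "finite (carrier_vec n :: 'a vec set)"
    and "card (carrier_vec n :: 'a vec set) = card (UNIV :: 'a set) ^ n"
proof -
  have "bij_betw (\<lambda>v. restrict (\<lambda>i. v $ i) {..<n}) (carrier_vec n) ({..<n} \<rightarrow>\<^sub>E (UNIV :: 'a set))"
    by (rule bij_betwI[where g = "vec n"])
      (auto simp: extensional_def fun_eq_iff PiE_def)
  moreover have "finite ({..<n} \<rightarrow>\<^sub>E (UNIV :: 'a set))" using assms by (intro finite_PiE) auto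
  moreover have "card ({..<n} \<rightarrow>\<^sub>E (UNIV :: 'a set)) = card (UNIV :: 'a set) ^ n"
    by (simp add: card_PiE)
  ultimately show "finite (carrier_vec n :: 'a vec set)"
    "card (carrier_vec n :: 'a vec set) = card (UNIV :: 'a set) ^ n"
    by (simp_all add: bij_betw_finite bij_betw_same_card)
qed

text \<open>These are the possible blocks. A left inverse, rather than a rank condition, is what the
  algebraic arguments consume; the square case gives \<open>GL\<close>.\<close>

definition left_invertible_mats :: "nat \<Rightarrow> nat \<Rightarrow> 'a :: field mat set" where
  "left_invertible_mats r s = {B \<in> carrier_mat r s. \<exists>K \<in> carrier_mat s r. K * B = 1\<^sub>m s}"

abbreviation GL :: "nat \<Rightarrow> 'a :: field mat set" where
  "GL s \<equiv> left_invertible_mats s s"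

lemma left_invertible_matsD: "B \<in> left_invertible_mats r s \<Longrightarrow> B \<in> carrier_mat r s"
  by (simp add: left_invertible_mats_def)

lemma left_invertible_matsE:
  assumes "B \<in> left_invertible_mats r s"
  obtains K where "K \<in> carrier_mat s r" "K * B = 1\<^sub>m s"
  using assms by (auto simp: left_invertible_mats_def)

lemma left_invertible_matsI:
  "B \<in> carrier_mat r s \<Longrightarrow> K \<in> carrier_mat s r \<Longrightarrow> K * B = 1\<^sub>m s \<Longrightarrow> B \<in> left_invertible_mats r s"
  by (auto simp: left_invertible_mats_def)

text \<open>The bridge to the counting argument, where columns are added one at a time and
  independence is easier to follow than an inverse.\<close>

lemma left_invertible_mats_iff_injective:
  "B \<in> left_invertible_mats r s \<longleftrightarrow>
     B \<in> carrier_mat r s \<and> (\<forall>v \<in> carrier_vec s. B *\<^sub>v v = 0\<^sub>v r \<longrightarrow> v = 0\<^sub>v s)"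
  by (meson left_inverse_imp_injective_mat injective_imp_left_inverse_mat left_invertible_matsD
      left_invertible_matsE left_invertible_matsI)

lemma left_invertible_mats_mult:
  assumes "A \<in> left_invertible_mats r s" "B \<in> left_invertible_mats s t"
  shows "A * B \<in> left_invertible_mats r t"
proof -
  obtain K L where K: "K \<in> carrier_mat s r" "K * A = 1\<^sub>m s" and L: "L \<in> carrier_mat t s" "L * B = 1\<^sub>m t"
    using assms by (metis left_invertible_matsE)
  note AB = assms[THEN left_invertible_matsD]
  have "(L * K) * (A * B) = L * ((K * A) * B)" using K(1) L(1) AB by (simp add: mat_assoc)
  also have "\<dots> = 1\<^sub>m t" using K L AB by simp
  finally show ?thesis using K L AB by (intro left_invertible_matsI[of _ _ _ "L * K"]) auto
qed

lemma GL_inverse: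
  assumes "g \<in> GL s"
  obtains h where "h \<in> GL s" "h \<in> carrier_mat s s" "g * h = 1\<^sub>m s" "h * g = 1\<^sub>m s"
proof -
  obtain h where h: "h \<in> carrier_mat s s" "h * g = 1\<^sub>m s" using assms by (rule left_invertible_matsE)
  have g: "g \<in> carrier_mat s s" using assms by (rule left_invertible_matsD)
  have gh: "g * h = 1\<^sub>m s" by (rule mat_mult_left_right_inverse[OF h(1) g h(2)])
  show ?thesis by (rule that[OF left_invertible_matsI[OF h(1) g gh] h(1) gh h(2)])
qed

lemma one_in_GL: "1\<^sub>m s \<in> GL s"
  by (rule left_invertible_matsI[of _ _ _ "1\<^sub>m s"]) auto

lemma GL_transpose:
  assumes "g \<in> GL s"
  shows "transpose_mat g \<in> GL s"
proof -
  obtain h where h: "h \<in> carrier_mat s s" "g * h = 1\<^sub>m s" using GL_inverse[OF assms] by metis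
  have g: "g \<in> carrier_mat s s" using assms by (rule left_invertible_matsD)
  have "transpose_mat h * transpose_mat g = 1\<^sub>m s"
    using h g by (simp flip: transpose_mult)
  thus ?thesis using g h by (intro left_invertible_matsI[of _ _ _ "transpose_mat h"]) auto
qed

lemma carrier_general_linear_group:
  "carrier (general_linear_group TYPE('a :: field) s) = GL s"
proof -
  have "g \<in> GL s \<longleftrightarrow> g \<in> carrier_mat s s \<and> (\<exists>h \<in> carrier_mat s s. h * g = 1\<^sub>m s \<and> g * h = 1\<^sub>m s)" for g :: "'a mat"
    by (meson GL_inverse left_invertible_matsD left_invertible_matsI)
  thus ?thesis by (auto simp: units_of_def Units_def ring_mat_simps)
qed

definition append_col :: "nat \<Rightarrow> nat \<Rightarrow> 'a mat \<Rightarrow> 'a vec \<Rightarrow> 'a mat" where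
  "append_col r s B v = mat r (Suc s) (\<lambda>(i, j). if j < s then B $$ (i, j) else v $ i)"

lemma append_col_mult_vec:
  fixes B :: "'a :: field mat"
  assumes B: "B \<in> carrier_mat r s" and v: "v \<in> carrier_vec r" and w: "w \<in> carrier_vec (Suc s)"
  shows "append_col r s B v *\<^sub>v w = B *\<^sub>v vec s (\<lambda>j. w $ j) + (w $ s) \<cdot>\<^sub>v v"
proof (rule eq_vecI)
  fix i assume "i < dim_vec (B *\<^sub>v vec s (\<lambda>j. w $ j) + (w $ s) \<cdot>\<^sub>v v)"
  hence i: "i < r" using v by simp
  have "(append_col r s B v *\<^sub>v w) $ i = (\<Sum>j\<in>{0..<Suc s}. (if j < s then B $$ (i, j) else v $ i) * w $ j)"
    using i w by (simp add: append_col_def scalar_prod_def del: sum.op_ivl_Suc)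
  also have "\<dots> = (\<Sum>j\<in>{0..<s}. B $$ (i, j) * w $ j) + v $ i * w $ s" by simp
  also have "\<dots> = (B *\<^sub>v vec s (\<lambda>j. w $ j) + (w $ s) \<cdot>\<^sub>v v) $ i"
    using i B v by (simp add: scalar_prod_def mult.commute)
  finally show "(append_col r s B v *\<^sub>v w) $ i = (B *\<^sub>v vec s (\<lambda>j. w $ j) + (w $ s) \<cdot>\<^sub>v v) $ i" .
qed (use v in \<open>simp add: append_col_def\<close>)

text \<open>A kernel vector of the extended matrix is a relation between the new column and the old
  ones. If its last coordinate is nonzero, the new column lies in the old column space; otherwise it
  is a kernel vector of \<open>B\<close>.\<close>

lemma append_col_left_invertible_iff:
  fixes B :: "'a :: field mat"
  assumes B: "B \<in> carrier_mat r s" and v: "v \<in> carrier_vec r"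
  shows "append_col r s B v \<in> left_invertible_mats r (Suc s) \<longleftrightarrow>
    B \<in> left_invertible_mats r s \<and> v \<notin> (\<lambda>w. B *\<^sub>v w) ` carrier_vec s"
    (is "?C \<in> _ \<longleftrightarrow> ?R")
proof
  assume "?C \<in> left_invertible_mats r (Suc s)"
  hence inj: "w = 0\<^sub>v (Suc s)" if "w \<in> carrier_vec (Suc s)" "?C *\<^sub>v w = 0\<^sub>v r" for w
    using that by (auto simp: left_invertible_mats_iff_injective)
  define ext where "ext w c = vec (Suc s) (\<lambda>j. if j < s then w $ j else c)" for w :: "'a vec" and c
  have ext: "?C *\<^sub>v ext w c = B *\<^sub>v w + c \<cdot>\<^sub>v v" if "w \<in> carrier_vec s" for w c
  proof -
    have "vec s (\<lambda>j. ext w c $ j) = w" using that by (auto simp: ext_def)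
    thus ?thesis using append_col_mult_vec[OF B v, of "ext w c"] by (simp add: ext_def)
  qed
  show ?R
  proof
    have "w = 0\<^sub>v s" if w: "w \<in> carrier_vec s" "B *\<^sub>v w = 0\<^sub>v r" for w
    proof -
      have "?C *\<^sub>v ext w 0 = 0\<^sub>v r" using ext[OF w(1), of 0] w(2) v by auto
      hence "ext w 0 = 0\<^sub>v (Suc s)" by (intro inj) (simp_all add: ext_def)
      hence "ext w 0 $ j = 0" if "j < s" for j using that by simp
      thus ?thesis using w(1) by (intro eq_vecI) (auto simp: ext_def)
    qed
    thus "B \<in> left_invertible_mats r s" using B by (simp add: left_invertible_mats_iff_injective)
    show "v \<notin> (\<lambda>w. B *\<^sub>v w) ` carrier_vec s"
    proof
      assume "v \<in> (\<lambda>w. B *\<^sub>v w) ` carrier_vec s"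
      then obtain w where w: "w \<in> carrier_vec s" "v = B *\<^sub>v w" by auto
      \<comment> \<open>The coefficient -1 at the new column cancels
        \<open>v = B *\<^sub>v w\<close> and produces a kernel vector that is visibly
        nonzero.\<close>
      have "?C *\<^sub>v ext w (-1) = v + (-1) \<cdot>\<^sub>v v" using ext[OF w(1), of "-1"] w(2) by simp
      also have "\<dots> = 0\<^sub>v r" using v by (intro eq_vecI) auto
      finally have "ext w (-1) = 0\<^sub>v (Suc s)" by (intro inj) (simp_all add: ext_def)
      hence "ext w (-1) $ s = 0" by simp
      thus False by (simp add: ext_def)
    qed
  qed
next
  assume R: ?R
  have C: "?C \<in> carrier_mat r (Suc s)" by (simp add: append_col_def)
  have "w = 0\<^sub>v (Suc s)" if w: "w \<in> carrier_vec (Suc s)" and z: "?C *\<^sub>v w = 0\<^sub>v r" for w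
  proof -
    define w' where "w' = vec s (\<lambda>j. w $ j)"
    have w': "w' \<in> carrier_vec s" by (simp add: w'_def)
    have eq: "B *\<^sub>v w' + (w $ s) \<cdot>\<^sub>v v = 0\<^sub>v r"
      using append_col_mult_vec[OF B v w] z by (simp add: w'_def)
    have ws: "w $ s = 0"
    proof (rule ccontr)
      assume nz: "w $ s \<noteq> 0"
      have "v = (- 1 / w $ s) \<cdot>\<^sub>v (B *\<^sub>v w')"
      proof (rule eq_vecI)
        fix i assume "i < dim_vec ((- 1 / w $ s) \<cdot>\<^sub>v (B *\<^sub>v w'))"
        hence i: "i < r" using B by simp
        have "(B *\<^sub>v w' + (w $ s) \<cdot>\<^sub>v v) $ i = 0" using eq i by simp
        hence "(B *\<^sub>v w') $ i + w $ s * v $ i = 0" using i B v by simp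
        thus "v $ i = ((- 1 / w $ s) \<cdot>\<^sub>v (B *\<^sub>v w')) $ i"
          using nz i B by (simp add: field_simps eq_neg_iff_add_eq_0 del: index_mult_mat_vec)
      qed (use v B in auto)
      also have "\<dots> = B *\<^sub>v ((- 1 / w $ s) \<cdot>\<^sub>v w')" using mult_mat_vec[OF B w'] by simp
      finally have "v \<in> (\<lambda>w. B *\<^sub>v w) ` carrier_vec s" by (rule image_eqI) (use w' in simp)
      with R show False by simp
    qed
    have "B *\<^sub>v w' = B *\<^sub>v w' + (w $ s) \<cdot>\<^sub>v v" using ws v B by (intro eq_vecI) auto
    hence "B *\<^sub>v w' = 0\<^sub>v r" using eq by simp
    hence "w' = 0\<^sub>v s" using R w' by (auto simp: left_invertible_mats_iff_injective)
    hence "w $ j = 0" if "j < s" for j using that by (metis index_vec index_zero_vec(1) w'_def)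
    thus ?thesis using w ws by (intro eq_vecI) (auto simp: less_Suc_eq)
  qed
  thus "?C \<in> left_invertible_mats r (Suc s)" using C by (simp add: left_invertible_mats_iff_injective)
qed

text \<open>Given the first \<open>i\<close> columns, the next one avoids their span, which has
  \<open>q ^ i\<close> elements by injectivity. For \<open>s > r\<close> the factor at
  \<open>i = r\<close> vanishes, in agreement with the absence of such matrices.\<close>

lemma card_left_invertible_mats:
  assumes fin: "finite (UNIV :: 'a :: field set)"
  shows "card (left_invertible_mats r s :: 'a mat set) = (\<Prod>i<s. card (UNIV :: 'a set) ^ r - card (UNIV :: 'a set) ^ i)"
proof (induction s)
  case 0
  have "left_invertible_mats r 0 = (carrier_mat r 0 :: 'a mat set)"
    by (auto simp: left_invertible_mats_def intro!: bexI[of _ "0\<^sub>m 0 r"])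
  thus ?case by (simp add: finite_carrier_mat_and_card(2)[OF fin])
next
  case (Suc s)
  let ?q = "card (UNIV :: 'a set)"
  \<comment> \<open>The admissible last columns depend on \<open>B\<close>, so the pairs form a
    dependent sum; all its fibres turn out to have the same size.\<close>
  let ?S = "SIGMA B : (left_invertible_mats r s :: 'a mat set). carrier_vec r - (\<lambda>w. B *\<^sub>v w) ` carrier_vec s"
  have "bij_betw (\<lambda>(B, v). append_col r s B v) ?S (left_invertible_mats r (Suc s) :: 'a mat set)"
  proof (rule bij_betwI')
    fix x y assume "x \<in> ?S" "y \<in> ?S"
    then obtain B B' :: "'a mat" and v v' where x: "x = (B, v)" "B \<in> carrier_mat r s" "v \<in> carrier_vec r"
      and y: "y = (B', v')" "B' \<in> carrier_mat r s" "v' \<in> carrier_vec r"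
      by (auto dest!: left_invertible_matsD)
    have "B = B' \<and> v = v'" if eq: "append_col r s B v = append_col r s B' v'"
    proof
      have e: "append_col r s B v $$ (i, j) = append_col r s B' v' $$ (i, j)" for i j using eq by simp
      have e1: "B $$ (i, j) = B' $$ (i, j)" if "i < r" "j < s" for i j
        using e[of i j] that by (simp add: append_col_def)
      show "B = B'" by (rule eq_matI) (use x y e1 in simp_all)
      have e2: "v $ i = v' $ i" if "i < r" for i
        using e[of i s] that by (simp add: append_col_def)
      show "v = v'" by (rule eq_vecI) (use x y e2 in simp_all)
    qed
    thus "((case x of (B, v) \<Rightarrow> append_col r s B v) = (case y of (B, v) \<Rightarrow> append_col r s B v)) = (x = y)"
      unfolding x(1) y(1) by auto
  next
    fix x assume "x \<in> ?S"
    moreover obtain B v where "x = (B, v)" by (cases x)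
    ultimately have x: "x = (B, v)" "B \<in> left_invertible_mats r s"
      "v \<in> carrier_vec r" "v \<notin> (\<lambda>w. B *\<^sub>v w) ` carrier_vec s"
      by simp_all
    thus "(case x of (B, v) \<Rightarrow> append_col r s B v) \<in> left_invertible_mats r (Suc s)"
      using append_col_left_invertible_iff[OF left_invertible_matsD[OF x(2)] x(3)] by simp
  next
    fix C :: "'a mat" assume C: "C \<in> left_invertible_mats r (Suc s)"
    hence Cc: "C \<in> carrier_mat r (Suc s)" by (rule left_invertible_matsD)
    define B where "B = mat r s (\<lambda>ij. C $$ ij)"
    define v where "v = vec r (\<lambda>i. C $$ (i, s))"
    have Bv: "B \<in> carrier_mat r s" "v \<in> carrier_vec r" by (auto simp: B_def v_def)
    have CBv: "C = append_col r s B v"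
      using Cc by (intro eq_matI) (auto simp: append_col_def B_def v_def less_Suc_eq)
    with C append_col_left_invertible_iff[OF Bv] Bv(2) have "(B, v) \<in> ?S" by simp
    with CBv show "\<exists>x \<in> ?S. C = (case x of (B, v) \<Rightarrow> append_col r s B v)" by (intro bexI[of _ "(B, v)"]) auto
  qed
  hence "card (left_invertible_mats r (Suc s) :: 'a mat set) = card ?S" by (simp add: bij_betw_same_card)
  also have "\<dots> = (\<Sum>B\<in>(left_invertible_mats r s :: 'a mat set). card (carrier_vec r - (\<lambda>w. B *\<^sub>v w) ` carrier_vec s))"
  proof (rule card_SigmaI)
    show "finite (left_invertible_mats r s :: 'a mat set)"
      by (rule finite_subset[OF _ finite_carrier_mat_and_card(1)[OF fin]]) (auto dest: left_invertible_matsD)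
  qed (use finite_carrier_vec_and_card(1)[OF fin] in blast)
  also have "\<dots> = (\<Sum>B\<in>(left_invertible_mats r s :: 'a mat set). ?q ^ r - ?q ^ s)"
  proof (rule sum.cong[OF refl])
    fix B :: "'a mat" assume B: "B \<in> left_invertible_mats r s"
    then obtain K where K: "K \<in> carrier_mat s r" "K * B = 1\<^sub>m s" by (rule left_invertible_matsE)
    have Bc: "B \<in> carrier_mat r s" using B by (rule left_invertible_matsD)
    have "inj_on (\<lambda>w. B *\<^sub>v w) (carrier_vec s)"
    proof (rule inj_on_inverseI)
      fix w :: "'a vec" assume w: "w \<in> carrier_vec s"
      show "K *\<^sub>v (B *\<^sub>v w) = w" using assoc_mult_mat_vec[OF K(1) Bc w] K(2) w by simp
    qed
    hence "card ((\<lambda>w. B *\<^sub>v w) ` carrier_vec s) = ?q ^ s"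
      by (simp add: card_image finite_carrier_vec_and_card(2)[OF fin])
    moreover have "(\<lambda>w. B *\<^sub>v w) ` carrier_vec s \<subseteq> carrier_vec r" using Bc by auto
    ultimately show "card (carrier_vec r - (\<lambda>w. B *\<^sub>v w) ` carrier_vec s) = ?q ^ r - ?q ^ s"
      using finite_carrier_vec_and_card[OF fin] by (subst card_Diff_subset) (auto intro: finite_subset)
  qed
  finally show ?case using Suc.IH by (simp add: mult.commute)
qed

section \<open>Arithmetic of q-factorials and q-binomials\<close>

lemma q_power_diff: "k \<le> r \<Longrightarrow> q ^ r - q ^ k = q ^ k * (q - 1) * (\<Sum>j<r - k. q ^ j)" for q :: nat
proof -
  assume "k \<le> r"
  have "q ^ r - q ^ k = q ^ k * (q ^ (r - k) - 1)"
    using \<open>k \<le> r\<close> by (simp add: diff_mult_distrib2 flip: power_add)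
  also have "q ^ (r - k) - 1 = (q - 1) * (\<Sum>j<r - k. q ^ j)"
  proof (cases "q = 0")
    case False
    \<comment> \<open>The geometric sum formula is used over the integers, away from truncated
      subtraction; \<open>q > 0\<close> makes both differences genuine.\<close>
    have "int (q ^ (r - k) - 1) = int ((q - 1) * (\<Sum>j<r - k. q ^ j))"
      using False power_diff_1_eq[of "int q" "r - k"] by (simp add: of_nat_diff)
    thus ?thesis by linarith
  qed (simp add: power_0_left)
  finally show ?thesis by (simp add: mult.assoc)
qed

text \<open>Multiplying by \<open>q_factorial q (r - s)\<close> keeps the identity free of division.
  The factor at \<open>i = s\<close> equals \<open>q ^ s * (q - 1)\<close> times a geometric sum
  that completes the smaller q-factorial to the larger one, and the exponents of \<open>q\<close>
  add up to \<open>s choose 2\<close>. The case \<open>r = s\<close> is the order of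
  \<open>GL s\<close>.\<close>

lemma prod_q_power_diff:
  "s \<le> r \<Longrightarrow> (\<Prod>i<s. q ^ r - q ^ i) * q_factorial q (r - s) = q ^ (s choose 2) * (q - 1) ^ s * q_factorial q r"
proof (induction s)
  case 0
  then show ?case by (simp add: binomial_eq_0)
next
  case (Suc s)
  have "q_factorial q (r - s) = q_factorial q (r - Suc s) * (\<Sum>j<r - s. q ^ j)"
    using Suc.prems by (simp add: q_factorial_def Suc_diff_Suc[symmetric])
  hence "(\<Prod>i<Suc s. q ^ r - q ^ i) * q_factorial q (r - Suc s)
      = q ^ s * (q - 1) * ((\<Prod>i<s. q ^ r - q ^ i) * q_factorial q (r - s))"
    using q_power_diff[of s r q] Suc.prems by simp
  also have "\<dots> = q ^ (Suc s choose 2) * (q - 1) ^ Suc s * q_factorial q r"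
    using Suc by (simp add: numeral_2_eq_2 power_add mult_ac)
  finally show ?case .
qed

lemma q_factorial_pos: "q_factorial q s > 0"
  by (auto simp: q_factorial_def intro!: prod_pos sum_pos2[of _ 0])

text \<open>Evaluating both products by \<open>prod_q_power_diff\<close> leaves the common factor
  \<open>q_factorial q (r - s)\<close>, which is positive. In the application this reads: number of
  orbits times the order of \<open>GL s\<close> is the number of left invertible matrices.\<close>

lemma q_binomial_mult:
  assumes "s \<le> r"
  shows "q_binomial q r s * (\<Prod>i<s. q ^ s - q ^ i) = (\<Prod>i<s. q ^ r - q ^ i)"
proof -
  have "(\<Prod>i<s. q ^ r - q ^ i) * q_factorial q (r - s)
      = q_binomial q r s * (\<Prod>i<s. q ^ s - q ^ i) * q_factorial q (r - s)"
    using prod_q_power_diff[OF assms, of q] prod_q_power_diff[of s s q] q_binomial_exact[OF assms, of q]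
    by (simp add: q_factorial_def[of q 0] mult_ac)
  thus ?thesis using q_factorial_pos[of q "r - s"] by simp
qed

section \<open>Green's relations of the regular sandwich semigroup\<close>

definition trunc_mat :: "nat \<Rightarrow> nat \<Rightarrow> 'a :: field mat" where
  "trunc_mat r m = mat r m (\<lambda>(i, j). if i = j then 1 else 0)"

lemma trunc_mat_carrier [simp]: "trunc_mat r m \<in> carrier_mat r m"
  by (simp add: trunc_mat_def)

lemma dim_trunc_mat [simp]: "dim_row (trunc_mat r m) = r" "dim_col (trunc_mat r m) = m"
  by (simp_all add: trunc_mat_def)

lemma trunc_mat_self [simp]: "trunc_mat r r = 1\<^sub>m r"
  by (rule eq_matI) (simp_all add: trunc_mat_def)

lemma trunc_mat_mult:
  fixes U :: "'a :: field mat"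
  assumes U: "U \<in> carrier_mat m s" and rm: "r \<le> m"
  shows "trunc_mat r m * U = mat r s (\<lambda>ij. U $$ ij)"
proof (rule eq_matI)
  fix i j assume "i < dim_row (mat r s (\<lambda>ij. U $$ ij))" "j < dim_col (mat r s (\<lambda>ij. U $$ ij))"
  hence ij: "i < r" "j < s" by auto
  have "(trunc_mat r m * U) $$ (i, j) = (\<Sum>k\<in>{0..<m}. (if i = k then 1 else 0) * U $$ (k, j))"
    using ij U by (simp add: scalar_prod_def) (simp add: trunc_mat_def)
  also have "\<dots> = (\<Sum>k\<in>{0..<m}. if i = k then U $$ (k, j) else 0)"
    by (rule sum.cong) simp_all
  also have "\<dots> = U $$ (i, j)" using ij rm by (simp add: sum.delta)
  finally show "(trunc_mat r m * U) $$ (i, j) = mat r s (\<lambda>ij. U $$ ij) $$ (i, j)" using ij by simp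
qed (use U in simp_all)

lemma trunc_mat_mult_transpose:
  "r \<le> m \<Longrightarrow> trunc_mat r m * transpose_mat (trunc_mat r m) = 1\<^sub>m r"
  by (subst trunc_mat_mult[of _ m r]) (auto intro!: eq_matI simp: trunc_mat_def)

lemma mult_transpose_trunc_mat:
  fixes X :: "'a :: field mat"
  assumes X: "X \<in> carrier_mat k n" and rn: "r \<le> n"
  shows "X * transpose_mat (trunc_mat r n) = mat k r (\<lambda>ij. X $$ ij)"
proof -
  have "X * transpose_mat (trunc_mat r n) = transpose_mat (trunc_mat r n * transpose_mat X)"
    using X by (subst transpose_mult[of _ r n _ k]) auto
  also have "\<dots> = mat k r (\<lambda>ij. X $$ ij)"
    using X rn by (subst trunc_mat_mult[of _ n k]) (auto intro!: eq_matI)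
  finally show ?thesis .
qed

lemma top_left_block_eq:
  assumes X: "X \<in> carrier_mat m n" and "r \<le> m" "r \<le> n"
  shows "top_left_block r X = trunc_mat r m * X * transpose_mat (trunc_mat r n)"
  using assms by (subst trunc_mat_mult[OF X]) (auto simp: mult_transpose_trunc_mat[of _ r] top_left_block_def)

text \<open>Splitting the sandwich matrix in two lets its halves be absorbed by the neighbouring
  factors: in \<open>X * J * Y\<close> only the first \<open>r\<close> columns of \<open>X\<close>
  meet the first \<open>r\<close> rows of \<open>Y\<close>.\<close>

lemma J_mat_eq:
  assumes "r \<le> m" "r \<le> n"
  shows "J_mat m n r = transpose_mat (trunc_mat r n) * trunc_mat r m"
proof -
  have "(transpose_mat (trunc_mat r n) * trunc_mat r m :: 'a mat) $$ (i, j) =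
      (if i = j \<and> i < r then 1 else 0)" if "i < n" "j < m" for i j
  proof -
    have "(transpose_mat (trunc_mat r n) * trunc_mat r m :: 'a mat) $$ (i, j)
        = (\<Sum>k\<in>{0..<r}. (if k = i then 1 else 0) * (if k = j then 1 else 0))"
      using that by (simp add: scalar_prod_def) (simp add: trunc_mat_def)
    also have "\<dots> = (\<Sum>k\<in>{0..<r}. if k = i then (if i = j then 1 else 0) else 0)"
      by (rule sum.cong) auto
    also have "\<dots> = (if i = j \<and> i < r then 1 else 0)" by (simp add: sum.delta)
    finally show ?thesis .
  qed
  thus ?thesis using assms
    by (intro eq_matI) (auto simp: J_mat_def)
qed

text \<open>A matrix \<open>U\<close> corresponds to its first \<open>r\<close> rows, constrained by
  \<open>Z\<close>, together with its other \<open>m - r\<close> rows, which are free;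
  \<open>f\<close> stacks the two pieces and \<open>g\<close> separates them.\<close>

lemma card_truncated_mats:
  fixes Z :: "'a :: field mat set"
  assumes fin: "finite (UNIV :: 'a set)" and rm: "r \<le> m" and Z: "Z \<subseteq> carrier_mat r s"
  shows "finite {U \<in> carrier_mat m s. trunc_mat r m * U \<in> Z}"
    and "card {U \<in> carrier_mat m s. trunc_mat r m * U \<in> Z} = card (UNIV :: 'a set) ^ (s * (m - r)) * card Z"
proof -
  let ?S = "{U \<in> carrier_mat m s. trunc_mat r m * U \<in> Z}"
  show "finite ?S" by (rule finite_subset[OF _ finite_carrier_mat_and_card(1)[OF fin, of m s]]) auto
  define f where "f TE = mat m s (\<lambda>(i, j). if i < r then fst TE $$ (i, j) else snd TE $$ (i - r, j))"
    for TE :: "'a mat \<times> 'a mat"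
  define g where "g U = (trunc_mat r m * U, mat (m - r) s (\<lambda>(i, j). U $$ (i + r, j)))" for U :: "'a mat"
  have tf: "trunc_mat r m * f TE = fst TE" if "fst TE \<in> carrier_mat r s" for TE :: "'a mat \<times> 'a mat"
    using that rm by (subst trunc_mat_mult[of _ m s]) (auto simp: f_def intro!: eq_matI)
  have "bij_betw f (Z \<times> carrier_mat (m - r) s) ?S"
  proof (rule bij_betw_byWitness[where f' = g])
    show "\<forall>TE\<in>Z \<times> carrier_mat (m - r) s. g (f TE) = TE"
    proof
      fix TE :: "'a mat \<times> 'a mat" assume TE: "TE \<in> Z \<times> carrier_mat (m - r) s"
      hence c: "fst TE \<in> carrier_mat r s" "snd TE \<in> carrier_mat (m - r) s" using Z by auto
      have "mat (m - r) s (\<lambda>(i, j). f TE $$ (i + r, j)) = snd TE"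
        by (rule eq_matI) (use c rm in \<open>simp_all add: f_def\<close>)
      thus "g (f TE) = TE" using tf[OF c(1)] by (simp add: g_def)
    qed
    show "\<forall>U\<in>?S. f (g U) = U"
    proof
      fix U assume "U \<in> ?S"
      hence U: "U \<in> carrier_mat m s" by simp
      show "f (g U) = U"
        by (rule eq_matI) (use U rm in \<open>simp_all add: f_def g_def trunc_mat_mult[OF U rm]\<close>)
    qed
    show "f ` (Z \<times> carrier_mat (m - r) s) \<subseteq> ?S"
    proof
      fix U :: "'a mat" assume "U \<in> f ` (Z \<times> carrier_mat (m - r) s)"
      then obtain T E where U: "U = f (T, E)" "T \<in> Z" by auto
      have "trunc_mat r m * U = T" using tf[of "(T, E)"] U Z by auto
      thus "U \<in> ?S" using U by (simp add: f_def)
    qed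
    show "g ` ?S \<subseteq> Z \<times> carrier_mat (m - r) s" by (auto simp: g_def)
  qed
  hence "card ?S = card (Z \<times> (carrier_mat (m - r) s :: 'a mat set))" by (simp add: bij_betw_same_card)
  thus "card ?S = card (UNIV :: 'a set) ^ (s * (m - r)) * card Z"
    by (simp add: card_cartesian_product finite_carrier_mat_and_card(2)[OF fin] mult.commute)
qed

section \<open>Principal ideals in a semigroup without identity\<close>

lemma principal_right_ideal_subset:
  assumes closed: "\<And>x y. x \<in> carrier G \<Longrightarrow> y \<in> carrier G \<Longrightarrow> x \<otimes>\<^bsub>G\<^esub> y \<in> carrier G"
    and assoc: "\<And>x y z. x \<in> carrier G \<Longrightarrow> y \<in> carrier G \<Longrightarrow> z \<in> carrier G \<Longrightarrow>
      x \<otimes>\<^bsub>G\<^esub> y \<otimes>\<^bsub>G\<^esub> z = x \<otimes>\<^bsub>G\<^esub> (y \<otimes>\<^bsub>G\<^esub> z)"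
    and "x \<in> carrier G" "y \<in> principal_right_ideal G x"
  shows "principal_right_ideal G y \<subseteq> principal_right_ideal G x"
  using assms(3,4) closed assoc unfolding principal_right_ideal_def by (auto simp: image_iff)

lemma principal_left_ideal_subset:
  assumes closed: "\<And>x y. x \<in> carrier G \<Longrightarrow> y \<in> carrier G \<Longrightarrow> x \<otimes>\<^bsub>G\<^esub> y \<in> carrier G"
    and assoc: "\<And>x y z. x \<in> carrier G \<Longrightarrow> y \<in> carrier G \<Longrightarrow> z \<in> carrier G \<Longrightarrow>
      x \<otimes>\<^bsub>G\<^esub> y \<otimes>\<^bsub>G\<^esub> z = x \<otimes>\<^bsub>G\<^esub> (y \<otimes>\<^bsub>G\<^esub> z)"
    and "x \<in> carrier G" "y \<in> principal_left_ideal G x"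
  shows "principal_left_ideal G y \<subseteq> principal_left_ideal G x"
  using assms(3,4) closed assoc unfolding principal_left_ideal_def by (auto simp: image_iff) metis+

text \<open>Each relation compares the values of a function on the carrier, so being an equivalence
  is independent of the algebraic laws of \<open>G\<close>.\<close>

lemma equiv_green:
  "equiv (carrier G) (green_R G)" "equiv (carrier G) (green_L G)" "equiv (carrier G) (green_H G)"
  by (auto simp: green_R_def green_L_def green_H_def intro!: equivI refl_onI symI transI)

section \<open>Factors of the elements of the regular sandwich semigroup\<close>

locale sandwich =
  fixes m n r :: nat and P :: "'a :: field mat monoid"
  assumes r_le: "r \<le> m" "r \<le> n" and P_def: "P = reg_sandwich m n r"
begin

text \<open>\<open>J = b a\<close> and \<open>\<phi>(X) = a X b\<close>: multiplication by \<open>a\<close> keeps the first \<open>r\<close> rows, by \<open>b\<close> the first \<open>r\<close> columns.\<close>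

definition a :: "'a mat" where "a = trunc_mat r m"
definition b :: "'a mat" where "b = transpose_mat (trunc_mat r n)"

lemma a_carrier [simp]: "a \<in> carrier_mat r m" and b_carrier [simp]: "b \<in> carrier_mat n r"
  by (simp_all add: a_def b_def)

lemma dims [simp]: "dim_row a = r" "dim_col a = m" "dim_row b = n" "dim_col b = r"
  by (simp_all add: a_def b_def)

lemma a_right_inverse: "a * transpose_mat a = 1\<^sub>m r"
  unfolding a_def by (rule trunc_mat_mult_transpose[OF r_le(1)])

lemma b_left_inverse: "transpose_mat b * b = 1\<^sub>m r"
  unfolding b_def using trunc_mat_mult_transpose[OF r_le(2)] by simp

definition lefts :: "nat \<Rightarrow> 'a mat set" where
  "lefts s = {U \<in> carrier_mat m s. a * U \<in> left_invertible_mats r s}"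

text \<open>Right invertibility of \<open>V * b\<close> is expressed through the transpose, so that
  blocks on both sides are elements of the same set.\<close>

definition rights :: "nat \<Rightarrow> 'a mat set" where
  "rights s = {V \<in> carrier_mat s n. transpose_mat (V * b) \<in> left_invertible_mats r s}"

lemma leftsD: "U \<in> lefts s \<Longrightarrow> U \<in> carrier_mat m s"
  by (simp add: lefts_def)

lemma rightsD: "V \<in> rights s \<Longrightarrow> V \<in> carrier_mat s n"
  by (simp add: rights_def)

lemma leftsE:
  assumes "U \<in> lefts s"
  obtains K where "K \<in> carrier_mat s r" "K * (a * U) = 1\<^sub>m s"
  using assms unfolding lefts_def mem_Collect_eq by (metis left_invertible_matsE)

lemma leftsI: "U \<in> carrier_mat m s \<Longrightarrow> K \<in> carrier_mat s r \<Longrightarrow> K * (a * U) = 1\<^sub>m s \<Longrightarrow> U \<in> lefts s"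
  unfolding lefts_def mem_Collect_eq
  by (intro conjI left_invertible_matsI[of _ r s K] carrier_matI) simp_all

lemma rightsE:
  assumes "V \<in> rights s"
  obtains L where "L \<in> carrier_mat r s" "V * b * L = 1\<^sub>m s"
proof -
  have V: "V \<in> carrier_mat s n" using assms by (rule rightsD)
  have "transpose_mat (V * b) \<in> left_invertible_mats r s" using assms by (simp add: rights_def)
  then obtain K where K: "K \<in> carrier_mat s r" "K * transpose_mat (V * b) = 1\<^sub>m s"
    by (rule left_invertible_matsE)
  have "V * b * transpose_mat K = transpose_mat (K * transpose_mat (V * b))"
    using K V by (subst transpose_mult[of _ s r _ s]) auto
  hence "V * b * transpose_mat K = 1\<^sub>m s" unfolding K(2) by simp
  with K(1) show ?thesis using that[of "transpose_mat K"] by simp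
qed

lemma rightsI:
  assumes V: "V \<in> carrier_mat s n" and L: "L \<in> carrier_mat r s" "V * b * L = 1\<^sub>m s"
  shows "V \<in> rights s"
proof -
  have "transpose_mat L * transpose_mat (V * b) = transpose_mat (V * b * L)"
    using V L(1) by (subst transpose_mult[of _ s r _ s]) auto
  hence "transpose_mat L * transpose_mat (V * b) = 1\<^sub>m s" unfolding L(2) by simp
  hence "transpose_mat (V * b) \<in> left_invertible_mats r s"
    by (rule left_invertible_matsI[rotated 2]) (use V L in simp_all)
  thus ?thesis using V by (simp add: rights_def)
qed

lemma mult_P: "X \<otimes>\<^bsub>P\<^esub> Y = X * (b * a) * Y"
  by (simp add: P_def reg_sandwich_def sandwich_semigroup_def J_mat_eq[OF r_le] a_def b_def)

lemma carrier_P: "X \<in> carrier P \<longleftrightarrow>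
    X \<in> carrier_mat m n \<and> (\<exists>Y \<in> carrier_mat m n. X = X * (b * a) * Y * (b * a) * X)"
  by (simp add: P_def reg_sandwich_def regular_elements_def sandwich_semigroup_def J_mat_eq[OF r_le] a_def b_def)

lemma mult_factors:
  assumes "U \<in> carrier_mat m s" "V \<in> carrier_mat s n" "U' \<in> carrier_mat m t" "V' \<in> carrier_mat t n"
  shows "(U * V) \<otimes>\<^bsub>P\<^esub> (U' * V') = U * (V * b * (a * U')) * V'"
  using assms by (simp add: mult_P mat_assoc)

text \<open>With one-sided inverses \<open>K\<close> of \<open>a * U\<close> and \<open>L\<close> of
  \<open>V * b\<close>, a partner \<open>Y\<close> is wanted for which
  \<open>a * Y * b = L * K\<close>; then \<open>U * V\<close> reproduces itself. The rank follows
  because \<open>K * a\<close> and \<open>b * L\<close> are one-sided inverses of \<open>U\<close>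
  and \<open>V\<close>.\<close>

lemma factors_in_P:
  assumes "U \<in> lefts s" "V \<in> rights s"
  shows "U * V \<in> carrier P" and "vec_space.rank m (U * V) = s"
proof -
  obtain K where K: "K \<in> carrier_mat s r" "K * (a * U) = 1\<^sub>m s" using assms(1) by (rule leftsE)
  obtain L where L: "L \<in> carrier_mat r s" "V * b * L = 1\<^sub>m s" using assms(2) by (rule rightsE)
  have U: "U \<in> carrier_mat m s" using assms(1) by (rule leftsD)
  have V: "V \<in> carrier_mat s n" using assms(2) by (rule rightsD)
  show "vec_space.rank m (U * V) = s"
  proof (rule rank_mult_full_rank[OF U V])
    show "K * a \<in> carrier_mat s m" "b * L \<in> carrier_mat n s" using K(1) L(1) by (auto intro: mult_carrier_mat[OF _ a_carrier] mult_carrier_mat[OF b_carrier])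
    show "K * a * U = 1\<^sub>m s" using K U by (simp add: mat_assoc)
    show "V * (b * L) = 1\<^sub>m s" using L V by (simp add: mat_assoc)
  qed
  \<comment> \<open>The block \<open>L * K\<close> padded with zeros: \<open>a\<close> and
    \<open>b\<close> undo the padding.\<close>
  let ?Y = "transpose_mat a * L * (K * transpose_mat b)"
  have Y: "?Y \<in> carrier_mat m n"
    using K(1) L(1) by (intro mult_carrier_mat[of _ m s] mult_carrier_mat[of _ m r] mult_carrier_mat[of _ s r]) simp_all
  have "U * V * (b * a) * ?Y * (b * a) * (U * V)
      = U * (V * b * ((a * transpose_mat a) * L)) * (K * ((transpose_mat b * b) * (a * U))) * V"
    using U V K(1) L(1) by (simp add: mat_assoc)
  also have "\<dots> = U * (V * b * L) * (K * (a * U)) * V"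
    unfolding a_right_inverse b_left_inverse using U V K(1) L(1) by (simp add: one_mult_mat)
  also have "\<dots> = U * V" unfolding K(2) L(2) using U V by simp
  finally show "U * V \<in> carrier P" using U V Y unfolding carrier_P by (metis mult_carrier_mat)
qed

text \<open>Any rank factorization of a regular element already has invertible blocks. Cancelling
  \<open>U\<close> and \<open>V\<close> on the outside of the regularity equation leaves an identity
  matrix, which is bracketed in two ways to exhibit the inverses of both blocks.\<close>

lemma factorize:
  assumes "X \<in> carrier P"
  obtains U V where "U \<in> lefts (vec_space.rank m X)" "V \<in> rights (vec_space.rank m X)" "X = U * V"
proof -
  define s where "s = vec_space.rank m X"
  obtain Y where X: "X \<in> carrier_mat m n" and Y: "Y \<in> carrier_mat m n" "X = X * (b * a) * Y * (b * a) * X"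
    using assms by (auto simp: carrier_P)
  obtain U V K L where f: "U \<in> carrier_mat m s" "V \<in> carrier_mat s n" "X = U * V"
    "K \<in> carrier_mat s m" "K * U = 1\<^sub>m s" "L \<in> carrier_mat n s" "V * L = 1\<^sub>m s"
    by (rule rank_factorization[OF X s_def])
  note c = f(1,2,4,6) Y(1)
  have "K * (U * V) * L = K * (U * V * (b * a) * Y * (b * a) * (U * V)) * L"
    using Y(2) unfolding f(3) by simp
  hence "(K * U) * (V * L) = (K * U) * (V * (b * (a * (Y * (b * (a * U)))))) * (V * L)"
    using c by (simp add: mat_assoc)
  hence id: "V * (b * (a * (Y * (b * (a * U))))) = 1\<^sub>m s"
    unfolding f(5,7) using c by simp
  have "U \<in> lefts s"
  proof (rule leftsI[OF f(1)])
    show "V * b * a * Y * b \<in> carrier_mat s r" by (rule carrier_matI) (use c in simp_all)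
    show "V * b * a * Y * b * (a * U) = 1\<^sub>m s" using id c by (simp add: mat_assoc)
  qed
  moreover have "V \<in> rights s"
  proof (rule rightsI[OF f(2)])
    show "a * Y * b * a * U \<in> carrier_mat r s" by (rule carrier_matI) (use c in simp_all)
    show "V * b * (a * Y * b * a * U) = 1\<^sub>m s" using id c by (simp add: mat_assoc)
  qed
  ultimately show ?thesis using that f(3) by (simp add: s_def)
qed

lemma carrier_P_D: "X \<in> carrier P \<Longrightarrow> X \<in> carrier_mat m n"
  by (simp add: carrier_P)

lemma lefts_mult_left_invertible:
  assumes "U \<in> lefts s" "B \<in> left_invertible_mats s t"
  shows "U * B \<in> lefts t"
proof -
  have U: "U \<in> carrier_mat m s" "a * U \<in> left_invertible_mats r s" using assms(1) by (auto simp: lefts_def)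
  have B: "B \<in> carrier_mat s t" using assms(2) by (rule left_invertible_matsD)
  have "a * (U * B) = a * U * B" using U(1) B by (simp add: mat_assoc)
  thus ?thesis using left_invertible_mats_mult[OF U(2) assms(2)] U(1) B by (simp add: lefts_def)
qed

lemma rights_mult_right_invertible:
  assumes "V \<in> rights s" "C \<in> carrier_mat t s" "L \<in> carrier_mat s t" "C * L = 1\<^sub>m t"
  shows "C * V \<in> rights t"
proof -
  obtain L' where L': "L' \<in> carrier_mat r s" "V * b * L' = 1\<^sub>m s" using assms(1) by (rule rightsE)
  have V: "V \<in> carrier_mat s n" using assms(1) by (rule rightsD)
  have "C * V * b * (L' * L) = C * ((V * b * L') * L)" using V L'(1) assms(2,3) by (simp add: mat_assoc)
  also have "\<dots> = 1\<^sub>m t" unfolding L'(2) using assms(3,4) by simp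
  finally show ?thesis
    by (rule rightsI[rotated 2]) (use V L'(1) assms(2,3) in \<open>auto intro: mult_carrier_mat\<close>)
qed

lemma GL_mult_rights: "g \<in> GL s \<Longrightarrow> V \<in> rights s \<Longrightarrow> g * V \<in> rights s"
  by (metis GL_inverse left_invertible_matsD rights_mult_right_invertible)

text \<open>The product of \<open>U * V\<close> and \<open>U' * V'\<close> is
  \<open>U * W * V'\<close>, where \<open>W\<close> can have smaller rank than both elements. A rank
  factorization \<open>B * C\<close> of \<open>W\<close> is distributed to the two sides, and
  \<open>U * B\<close> and \<open>C * V'\<close> are again admissible factors.\<close>

lemma closed_P:
  assumes "X \<in> carrier P" "Y \<in> carrier P"
  shows "X \<otimes>\<^bsub>P\<^esub> Y \<in> carrier P"
proof -
  define s t where "s = vec_space.rank m X" and "t = vec_space.rank m Y"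
  obtain U V where X: "U \<in> lefts s" "V \<in> rights s" "X = U * V"
    unfolding s_def by (rule factorize[OF assms(1)])
  obtain U' V' where Y: "U' \<in> lefts t" "V' \<in> rights t" "Y = U' * V'"
    unfolding t_def by (rule factorize[OF assms(2)])
  note c = leftsD[OF X(1)] rightsD[OF X(2)] leftsD[OF Y(1)] rightsD[OF Y(2)]
  define W where "W = V * b * (a * U')"
  have W: "W \<in> carrier_mat s t" unfolding W_def by (rule carrier_matI) (use c in simp_all)
  define k where "k = vec_space.rank s W"
  obtain B C K L where f: "B \<in> carrier_mat s k" "C \<in> carrier_mat k t" "W = B * C"
    "K \<in> carrier_mat k s" "K * B = 1\<^sub>m k" "L \<in> carrier_mat t k" "C * L = 1\<^sub>m k"
    by (rule rank_factorization[OF W k_def])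
  have "X \<otimes>\<^bsub>P\<^esub> Y = U * W * V'" unfolding X(3) Y(3) W_def by (rule mult_factors) (fact c)+
  also have "\<dots> = (U * B) * (C * V')" unfolding f(3) using c f(1,2) by (simp add: mat_assoc)
  finally show ?thesis
    using factors_in_P(1)[OF lefts_mult_left_invertible[OF X(1) left_invertible_matsI[OF f(1,4,5)]]
      rights_mult_right_invertible[OF Y(2) f(2,6,7)]] by simp
qed

lemma assoc_P:
  "X \<in> carrier P \<Longrightarrow> Y \<in> carrier P \<Longrightarrow> Z \<in> carrier P \<Longrightarrow>
    X \<otimes>\<^bsub>P\<^esub> Y \<otimes>\<^bsub>P\<^esub> Z = X \<otimes>\<^bsub>P\<^esub> (Y \<otimes>\<^bsub>P\<^esub> Z)"
  by (drule carrier_P_D)+ (simp add: mult_P mat_assoc)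

section \<open>Green's relations in terms of the factors\<close>

lemma principal_right_ideal_factor:
  assumes "X \<in> carrier P" "Y \<in> principal_right_ideal P X"
  obtains T where "T \<in> carrier_mat n n" "Y = X * T"
proof -
  note X = carrier_P_D[OF assms(1)]
  from assms(2) consider "Y = X" | Z where "Z \<in> carrier P" "Y = X \<otimes>\<^bsub>P\<^esub> Z"
    by (auto simp: principal_right_ideal_def)
  thus ?thesis
  proof cases
    case 1
    thus ?thesis using that[of "1\<^sub>m n"] X by simp
  next
    case 2
    note Z = carrier_P_D[OF 2(1)]
    have "b * a * Z \<in> carrier_mat n n" by (rule carrier_matI) (use Z in simp_all)
    moreover have "Y = X * (b * a * Z)" using 2(2) X Z by (simp add: mult_P mat_assoc)
    ultimately show ?thesis by (rule that)
  qed
qed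

lemma principal_left_ideal_factor:
  assumes "X \<in> carrier P" "Y \<in> principal_left_ideal P X"
  obtains T where "T \<in> carrier_mat m m" "Y = T * X"
proof -
  note X = carrier_P_D[OF assms(1)]
  from assms(2) consider "Y = X" | Z where "Z \<in> carrier P" "Y = Z \<otimes>\<^bsub>P\<^esub> X"
    by (auto simp: principal_left_ideal_def)
  thus ?thesis
  proof cases
    case 1
    thus ?thesis using that[of "1\<^sub>m m"] X by simp
  next
    case 2
    note Z = carrier_P_D[OF 2(1)]
    have "Z * (b * a) \<in> carrier_mat m m" by (rule carrier_matI) (use Z in simp_all)
    moreover have "Y = Z * (b * a) * X" using 2(2) X Z by (simp add: mult_P mat_assoc)
    ultimately show ?thesis by (rule that)
  qed
qed

text \<open>Equality of the principal ideals reduces to mutual membership of the generators, because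
  \<open>P\<close> is closed and associative.\<close>

lemma green_R_iff_mem:
  "(X, Y) \<in> green_R P \<longleftrightarrow> X \<in> carrier P \<and> Y \<in> carrier P \<and>
     X \<in> principal_right_ideal P Y \<and> Y \<in> principal_right_ideal P X"
proof -
  have "X \<in> principal_right_ideal P X" for X by (simp add: principal_right_ideal_def)
  thus ?thesis
    using principal_right_ideal_subset[of P, OF closed_P assoc_P]
    unfolding green_R_def by blast
qed

lemma green_L_iff_mem:
  "(X, Y) \<in> green_L P \<longleftrightarrow> X \<in> carrier P \<and> Y \<in> carrier P \<and>
     X \<in> principal_left_ideal P Y \<and> Y \<in> principal_left_ideal P X"
proof -
  have "X \<in> principal_left_ideal P X" for X by (simp add: principal_left_ideal_def)
  thus ?thesis
    using principal_left_ideal_subset[of P, OF closed_P assoc_P]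
    unfolding green_L_def by blast
qed

lemma green_R_rank: assumes "(X, Y) \<in> green_R P" shows "vec_space.rank m X = vec_space.rank m Y"
proof -
  have *: "vec_space.rank m Y \<le> vec_space.rank m X"
    if "X \<in> carrier P" "Y \<in> principal_right_ideal P X" for X Y
    using principal_right_ideal_factor[OF that] rank_mult_le(1)[OF carrier_P_D[OF that(1)]] by metis
  from assms show ?thesis by (intro order.antisym) (auto simp: green_R_iff_mem intro: *)
qed

lemma green_L_rank: assumes "(X, Y) \<in> green_L P" shows "vec_space.rank m X = vec_space.rank m Y"
proof -
  have *: "vec_space.rank m Y \<le> vec_space.rank m X"
    if "X \<in> carrier P" "Y \<in> principal_left_ideal P X" for X Y
    using principal_left_ideal_factor[OF that] rank_mult_le(2)[OF _ carrier_P_D[OF that(1)]] by metis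
  from assms show ?thesis by (intro order.antisym) (auto simp: green_L_iff_mem intro: *)
qed

text \<open>The multiplier is \<open>U' * V'\<close> for a \<open>U'\<close> solving
  \<open>V * b * (a * U') = g\<close>. It has to lie in \<open>P\<close>, hence the block of
  \<open>U'\<close> must be shown left invertible.\<close>

lemma right_ideal_same_left_factor:
  assumes "U \<in> lefts s" "V \<in> rights s" "g \<in> GL s" "V' \<in> rights s"
  shows "U * g * V' \<in> principal_right_ideal P (U * V)"
proof -
  obtain L where L: "L \<in> carrier_mat r s" "V * b * L = 1\<^sub>m s" using assms(2) by (rule rightsE)
  obtain h where h: "h \<in> carrier_mat s s" "h * g = 1\<^sub>m s" using GL_inverse[OF assms(3)] by metis
  note c = leftsD[OF assms(1)] rightsD[OF assms(2)] left_invertible_matsD[OF assms(3)] rightsD[OF assms(4)]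
  \<comment> \<open>The block \<open>L * g\<close> padded with zero rows: \<open>V * b\<close> sends
    it to \<open>g\<close>, so \<open>h * (V * b)\<close> is a left inverse of it.\<close>
  define U' where "U' = transpose_mat a * (L * g)"
  have U'c: "U' \<in> carrier_mat m s" unfolding U'_def by (rule carrier_matI) (use L c in simp_all)
  have aU': "a * U' = L * g"
  proof -
    have "a * U' = (a * transpose_mat a) * (L * g)" unfolding U'_def using L(1) c by (simp add: mat_assoc)
    thus ?thesis unfolding a_right_inverse using L(1) c by (simp add: one_mult_mat)
  qed
  have Vb: "V * b * (L * g) = g"
  proof -
    have "V * b * (L * g) = (V * b * L) * g" using L(1) c by (simp add: mat_assoc)
    thus ?thesis unfolding L(2) using c by simp
  qed
  have "U' \<in> lefts s"
  proof (rule leftsI[OF U'c])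
    show "h * (V * b) \<in> carrier_mat s r" by (rule carrier_matI) (use h c in simp_all)
    have "h * (V * b) * (L * g) = h * (V * b * (L * g))" using L(1) c h(1) by (simp add: mat_assoc)
    thus "h * (V * b) * (a * U') = 1\<^sub>m s" unfolding aU' Vb h(2) .
  qed
  hence "U' * V' \<in> carrier P" using assms(4) by (rule factors_in_P)
  moreover have "(U * V) \<otimes>\<^bsub>P\<^esub> (U' * V') = U * g * V'"
    using mult_factors[OF c(1,2) U'c c(4)] unfolding aU' Vb .
  ultimately show ?thesis unfolding principal_right_ideal_def by (metis image_eqI insertCI)
qed

lemma left_ideal_same_right_factor:
  assumes "U \<in> lefts s" "V \<in> rights s" "g \<in> GL s" "U' \<in> lefts s"
  shows "U' * g * V \<in> principal_left_ideal P (U * V)"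
proof -
  obtain K where K: "K \<in> carrier_mat s r" "K * (a * U) = 1\<^sub>m s" using assms(1) by (rule leftsE)
  obtain h where h: "h \<in> carrier_mat s s" "g * h = 1\<^sub>m s" using GL_inverse[OF assms(3)] by metis
  note c = leftsD[OF assms(1)] rightsD[OF assms(2)] left_invertible_matsD[OF assms(3)] leftsD[OF assms(4)]
  \<comment> \<open>The mirror image: the block \<open>g * K\<close> padded with zero columns solves
    \<open>V' * b * (a * U) = g\<close>.\<close>
  define V' where "V' = g * K * transpose_mat b"
  have V'c: "V' \<in> carrier_mat s n" unfolding V'_def by (rule carrier_matI) (use K c in simp_all)
  have V'b: "V' * b = g * K"
  proof -
    have "V' * b = g * K * (transpose_mat b * b)" unfolding V'_def using K(1) c by (simp add: mat_assoc)
    thus ?thesis unfolding b_left_inverse using K(1) c by (simp add: mult_one_mat)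
  qed
  have aU: "g * K * (a * U) = g"
  proof -
    have "g * K * (a * U) = g * (K * (a * U))" using K(1) c by (simp add: mat_assoc)
    thus ?thesis unfolding K(2) using c by simp
  qed
  have "V' \<in> rights s"
  proof (rule rightsI[OF V'c])
    show "a * U * h \<in> carrier_mat r s" by (rule carrier_matI) (use h c in simp_all)
    have "g * K * (a * U * h) = g * K * (a * U) * h" using K(1) c h(1) by (simp add: mat_assoc)
    thus "V' * b * (a * U * h) = 1\<^sub>m s" unfolding V'b aU h(2) .
  qed
  with assms(4) have "U' * V' \<in> carrier P" by (rule factors_in_P)
  moreover have "(U' * V') \<otimes>\<^bsub>P\<^esub> (U * V) = U' * g * V"
    using mult_factors[OF c(4) V'c c(1,2)] unfolding V'b aU .
  ultimately show ?thesis unfolding principal_left_ideal_def by (metis image_eqI insertCI)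
qed

lemma green_R_iff:
  assumes U: "U \<in> lefts s" and V: "V \<in> rights s" and U': "U' \<in> lefts s" and V': "V' \<in> rights s"
  shows "(U * V, U' * V') \<in> green_R P \<longleftrightarrow> (\<exists>g \<in> GL s. U' = U * g)"
proof
  note c = leftsD[OF U] rightsD[OF V] leftsD[OF U'] rightsD[OF V']
  assume "(U * V, U' * V') \<in> green_R P"
  hence "U' * V' \<in> principal_right_ideal P (U * V)" by (simp add: green_R_iff_mem)
  then obtain T where T: "T \<in> carrier_mat n n" "U' * V' = U * V * T"
    using principal_right_ideal_factor factors_in_P(1)[OF U V] by metis
  obtain L where L: "L \<in> carrier_mat r s" "V' * b * L = 1\<^sub>m s" using V' by (rule rightsE)
  \<comment> \<open>Multiplying \<open>U' * V' = U * V * T\<close> on the right by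
    \<open>b * L\<close>, a right inverse of \<open>V'\<close>, turns it into
    \<open>U' = U * g\<close>.\<close>
  define g where "g = V * T * (b * L)"
  have g: "g \<in> carrier_mat s s" unfolding g_def by (rule carrier_matI) (use c L in simp_all)
  have "U' = U' * (V' * b * L)" unfolding L(2) using c by simp
  also have "\<dots> = U' * V' * (b * L)" using c L(1) by (simp add: mat_assoc)
  also have "\<dots> = U * g" unfolding T(2) g_def using c L(1) T(1) by (simp add: mat_assoc)
  finally have Ug: "U' = U * g" .
  obtain K where K: "K \<in> carrier_mat s r" "K * (a * U') = 1\<^sub>m s" using U' by (rule leftsE)
  \<comment> \<open>The left inverse of the block of \<open>U' = U * g\<close> regroups to a left
    inverse of \<open>g\<close>.\<close>
  have "(K * (a * U)) * g = 1\<^sub>m s" using K c g unfolding Ug by (simp add: mat_assoc)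
  hence "g \<in> GL s" by (rule left_invertible_matsI[OF g, rotated]) (use K c in \<open>auto intro: carrier_matI\<close>)
  thus "\<exists>g \<in> GL s. U' = U * g" using Ug by blast
next
  assume "\<exists>g \<in> GL s. U' = U * g"
  then obtain g where g: "g \<in> GL s" "U' = U * g" by blast
  obtain h where h: "h \<in> GL s" "h \<in> carrier_mat s s" "g * h = 1\<^sub>m s" using GL_inverse[OF g(1)] by metis
  have "U = U' * h"
    using g h leftsD[OF U] left_invertible_matsD[OF g(1)] by (simp add: mat_assoc)
  thus "(U * V, U' * V') \<in> green_R P"
    using right_ideal_same_left_factor[OF U V g(1) V'] right_ideal_same_left_factor[OF U' V' h(1) V]
      factors_in_P(1)[OF U V] factors_in_P(1)[OF U' V'] g(2)
    by (simp add: green_R_iff_mem)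
qed

lemma green_L_iff:
  assumes U: "U \<in> lefts s" and V: "V \<in> rights s" and U': "U' \<in> lefts s" and V': "V' \<in> rights s"
  shows "(U * V, U' * V') \<in> green_L P \<longleftrightarrow> (\<exists>g \<in> GL s. V' = g * V)"
proof
  note c = leftsD[OF U] rightsD[OF V] leftsD[OF U'] rightsD[OF V']
  assume "(U * V, U' * V') \<in> green_L P"
  hence "U' * V' \<in> principal_left_ideal P (U * V)" by (simp add: green_L_iff_mem)
  then obtain T where T: "T \<in> carrier_mat m m" "U' * V' = T * (U * V)"
    using principal_left_ideal_factor factors_in_P(1)[OF U V] by metis
  obtain K where K: "K \<in> carrier_mat s r" "K * (a * U') = 1\<^sub>m s" using U' by (rule leftsE)
  define g where "g = K * a * (T * U)"
  have g: "g \<in> carrier_mat s s" unfolding g_def by (rule carrier_matI) (use c K in simp_all)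
  have "V' = (K * (a * U')) * V'" unfolding K(2) using c by simp
  also have "\<dots> = K * a * (U' * V')" using c K(1) by (simp add: mat_assoc)
  also have "\<dots> = g * V" unfolding T(2) g_def using c K(1) T(1) by (simp add: mat_assoc)
  finally have gV: "V' = g * V" .
  obtain L where L: "L \<in> carrier_mat r s" "V' * b * L = 1\<^sub>m s" using V' by (rule rightsE)
  \<comment> \<open>Here the block of \<open>V' = g * V\<close> provides an inverse of
    \<open>g\<close> on the right, which is moved to the left because the matrices are
    square.\<close>
  have "g * (V * b * L) = 1\<^sub>m s" using L c g unfolding gV by (simp add: mat_assoc)
  moreover have VbL: "V * b * L \<in> carrier_mat s s" by (rule carrier_matI) (use L c in simp_all)
  ultimately have "V * b * L * g = 1\<^sub>m s" by (intro mat_mult_left_right_inverse[OF g])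
  hence "g \<in> GL s" by (rule left_invertible_matsI[OF g VbL])
  thus "\<exists>g \<in> GL s. V' = g * V" using gV by blast
next
  assume "\<exists>g \<in> GL s. V' = g * V"
  then obtain g where g: "g \<in> GL s" "V' = g * V" by blast
  obtain h where h: "h \<in> GL s" "h \<in> carrier_mat s s" "h * g = 1\<^sub>m s" using GL_inverse[OF g(1)] by metis
  note gc = left_invertible_matsD[OF g(1)]
  have "V = h * V'"
  proof -
    have "h * V' = (h * g) * V" using g(2) h(2) gc rightsD[OF V] by (simp add: mat_assoc)
    thus ?thesis unfolding h(3) using rightsD[OF V] by simp
  qed
  moreover have "U' * g * V = U' * (g * V)" "U * h * V' = U * (h * V')"
    using leftsD[OF U'] leftsD[OF U] gc h(2) rightsD[OF V] rightsD[OF V'] by (simp_all add: mat_assoc)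
  ultimately show "(U * V, U' * V') \<in> green_L P"
    using left_ideal_same_right_factor[OF U V g(1) U'] left_ideal_same_right_factor[OF U' V' h(1) U]
      factors_in_P(1)[OF U V] factors_in_P(1)[OF U' V'] g(2)
    by (simp add: green_L_iff_mem)
qed

text \<open>Rank is constant along every R- and L-step. Conversely, two elements of equal rank are
  joined in two steps through the mixed product \<open>U * V'\<close>.\<close>

lemma green_D_eq:
  "green_D P = {(X, Y) \<in> carrier P \<times> carrier P. vec_space.rank m X = vec_space.rank m Y}"
proof (intro equalityI subrelI)
  fix X Y assume "(X, Y) \<in> green_D P"
  hence "(X, Y) \<in> (green_R P \<union> green_L P)\<^sup>+" by (simp add: green_D_def)
  thus "(X, Y) \<in> {(X, Y) \<in> carrier P \<times> carrier P. vec_space.rank m X = vec_space.rank m Y}"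
  proof (induction rule: trancl_induct)
    case (base Y)
    thus ?case using green_R_rank green_L_rank green_R_iff_mem green_L_iff_mem by auto
  next
    case (step Y Z)
    from step.hyps(2) have "Z \<in> carrier P \<and> vec_space.rank m Y = vec_space.rank m Z"
      using green_R_rank green_L_rank green_R_iff_mem green_L_iff_mem by auto
    with step.IH show ?case by simp
  qed
next
  fix X Y assume "(X, Y) \<in> {(X, Y) \<in> carrier P \<times> carrier P. vec_space.rank m X = vec_space.rank m Y}"
  hence XY: "X \<in> carrier P" "Y \<in> carrier P" "vec_space.rank m Y = vec_space.rank m X" by auto
  define s where "s = vec_space.rank m X"
  obtain U V where X: "U \<in> lefts s" "V \<in> rights s" "X = U * V"
    unfolding s_def by (rule factorize[OF XY(1)])
  obtain U' V' where Y: "U' \<in> lefts s" "V' \<in> rights s" "Y = U' * V'"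
    unfolding s_def XY(3)[symmetric] by (rule factorize[OF XY(2)])
  have "U = U * 1\<^sub>m s" "V' = 1\<^sub>m s * V'" using leftsD[OF X(1)] rightsD[OF Y(2)] by simp_all
  hence "(U * V, U * V') \<in> green_R P" "(U * V', U' * V') \<in> green_L P"
    using green_R_iff[OF X(1,2) X(1) Y(2)] green_L_iff[OF X(1) Y(2) Y(1,2)] one_in_GL by blast+
  thus "(X, Y) \<in> green_D P" unfolding green_D_def X(3) Y(3)
    by (meson UnI1 UnI2 trancl.simps)
qed

lemma GL_between:
  assumes "U \<in> lefts s" "V \<in> rights s" "g \<in> carrier_mat s s" "g' \<in> carrier_mat s s" "U * g * V = U * g' * V"
  shows "g = g'"
proof -
  obtain K where K: "K \<in> carrier_mat s r" "K * (a * U) = 1\<^sub>m s" using assms(1) by (rule leftsE)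
  obtain L where L: "L \<in> carrier_mat r s" "V * b * L = 1\<^sub>m s" using assms(2) by (rule rightsE)
  note c = leftsD[OF assms(1)] rightsD[OF assms(2)] assms(3,4)
  have *: "K * a * (U * g * V) * (b * L) = g" if "g \<in> carrier_mat s s" for g
  proof -
    have "K * a * (U * g * V) * (b * L) = (K * (a * U)) * g * (V * b * L)"
      using c K(1) L(1) that by (simp add: mat_assoc)
    thus ?thesis unfolding K(2) L(2) using that by simp
  qed
  show ?thesis by (rule trans[OF sym[OF *[OF assms(3)]]]) (simp only: assms(5) *[OF assms(4)])
qed

lemma green_H_class:
  assumes U: "U \<in> lefts s" and V: "V \<in> rights s"
  shows "green_H P `` {U * V} = (\<lambda>g. U * g * V) ` GL s"
proof (intro equalityI subsetI)
  fix Y assume "Y \<in> green_H P `` {U * V}"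
  hence RL: "(U * V, Y) \<in> green_R P" "(U * V, Y) \<in> green_L P" by (auto simp: green_H_def)
  hence Y: "Y \<in> carrier P" "vec_space.rank m Y = s"
    using green_R_rank factors_in_P(2)[OF U V] by (auto simp: green_R_iff_mem)
  obtain U' V' where f: "U' \<in> lefts s" "V' \<in> rights s" "Y = U' * V'"
    unfolding Y(2)[symmetric] by (rule factorize[OF Y(1)])
  obtain g where g: "g \<in> GL s" "U' = U * g" using RL(1) green_R_iff[OF U V f(1,2)] f(3) by blast
  obtain h where h: "h \<in> GL s" "V' = h * V" using RL(2) green_L_iff[OF U V f(1,2)] f(3) by blast
  have "Y = U * (g * h) * V"
    unfolding f(3) g(2) h(2) using leftsD[OF U] rightsD[OF V] left_invertible_matsD[OF g(1)] left_invertible_matsD[OF h(1)]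
    by (simp add: mat_assoc)
  thus "Y \<in> (\<lambda>g. U * g * V) ` GL s" using left_invertible_mats_mult[OF g(1) h(1)] by blast
next
  fix Y assume "Y \<in> (\<lambda>g. U * g * V) ` GL s"
  then obtain g where g: "g \<in> GL s" "Y = U * g * V" by blast
  have Ug: "U * g \<in> lefts s" by (rule lefts_mult_left_invertible[OF U g(1)])
  have gV: "g * V \<in> rights s" by (rule GL_mult_rights[OF g(1) V])
  have "U * g * V = U * (g * V)"
    using leftsD[OF U] rightsD[OF V] left_invertible_matsD[OF g(1)] by (simp add: mat_assoc)
  hence "(U * V, Y) \<in> green_R P" "(U * V, Y) \<in> green_L P"
    using green_R_iff[OF U V Ug V] green_L_iff[OF U V U gV] g by auto
  thus "Y \<in> green_H P `` {U * V}" by (simp add: green_H_def)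
qed

end

section \<open>Counting classes\<close>

text \<open>Every class count below is obtained from an explicit family of representatives: the
  class of \<open>f i\<close>, for \<open>i\<close> in \<open>I\<close>, runs through the classes
  inside \<open>A\<close> without repetition.\<close>

lemma is_union_of_classesI:
  assumes E: "equiv C E" and A: "A \<subseteq> C" and closed: "\<And>x y. x \<in> A \<Longrightarrow> (x, y) \<in> E \<Longrightarrow> y \<in> A"
    and I: "finite I" "card I = k"
    and rep: "\<And>i. i \<in> I \<Longrightarrow> f i \<in> A"
    and inj: "\<And>i j. i \<in> I \<Longrightarrow> j \<in> I \<Longrightarrow> (f i, f j) \<in> E \<Longrightarrow> i = j"
    and cover: "\<And>x. x \<in> A \<Longrightarrow> \<exists>i \<in> I. (f i, x) \<in> E"
  shows "is_union_of_classes A k (C // E)"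
proof -
  let ?K = "(\<lambda>i. E `` {f i}) ` I"
  have "inj_on (\<lambda>i. E `` {f i}) I"
    using inj eq_equiv_class[OF _ E] rep A by (intro inj_onI) (metis subsetD)
  hence "card ?K = k" using I by (simp add: card_image)
  moreover have "?K \<subseteq> C // E" using rep A by (auto intro!: quotientI)
  moreover have "A = \<Union> ?K"
    using cover closed rep by (auto simp: Image_iff)
  ultimately show ?thesis using I(1) unfolding is_union_of_classes_def by blast
qed

lemma hat_rel_equiv:
  assumes "equiv C K" "\<phi> ` A \<subseteq> C"
  shows "equiv A (hat_rel A \<phi> K)"
proof (rule equivI)
  show "refl_on A (hat_rel A \<phi> K)"
    using assms by (auto simp: hat_rel_def refl_on_def equiv_def)
  show "sym (hat_rel A \<phi> K)"
    using assms by (auto simp: hat_rel_def equiv_def intro!: symI dest: symD)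
  show "trans (hat_rel A \<phi> K)"
    using assms by (auto simp: hat_rel_def equiv_def intro!: transI dest: transD)
qed (auto simp: hat_rel_def)

text \<open>\<open>Z\<close> represents the orbits of the (free) right action of \<open>GL s\<close> on \<open>Y\<close>.\<close>

definition GL_transversal :: "nat \<Rightarrow> nat \<Rightarrow> 'a :: field mat set \<Rightarrow> 'a mat set \<Rightarrow> bool" where
  "GL_transversal r s Z Y \<longleftrightarrow> Z \<subseteq> Y \<and> Y \<subseteq> left_invertible_mats r s \<and> (\<forall>y \<in> Y. \<forall>g \<in> GL s. y * g \<in> Y)
     \<and> (\<forall>z \<in> Z. \<forall>g \<in> GL s. z * g \<in> Z \<longrightarrow> g = 1\<^sub>m s)
     \<and> (\<forall>y \<in> Y. \<exists>z \<in> Z. \<exists>g \<in> GL s. y = z * g)"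

lemma GL_transversalD:
  assumes "GL_transversal r s Z Y"
  shows "Z \<subseteq> Y" "Y \<subseteq> left_invertible_mats r s" "Z \<subseteq> left_invertible_mats r s"
    and "y \<in> Y \<Longrightarrow> g \<in> GL s \<Longrightarrow> y * g \<in> Y"
    and "z \<in> Z \<Longrightarrow> g \<in> GL s \<Longrightarrow> z * g \<in> Z \<Longrightarrow> g = 1\<^sub>m s"
  using assms unfolding GL_transversal_def by blast+

lemma left_invertible_mats_mult_eq_self:
  assumes "B \<in> left_invertible_mats r s" "g \<in> carrier_mat s s" "B * g = B"
  shows "g = 1\<^sub>m s"
proof -
  obtain K where K: "K \<in> carrier_mat s r" "K * B = 1\<^sub>m s" using assms(1) by (rule left_invertible_matsE)
  note B = left_invertible_matsD[OF assms(1)]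
  show ?thesis
    by (rule left_cancel_mat[OF K(2,1) B assms(2)]) (use B assms(3) in simp_all)
qed

text \<open>The case of a single orbit, used for the hat class of one element; freeness is left
  cancellation by an inverse of \<open>T\<close>.\<close>

lemma GL_transversal_single:
  fixes T :: "'a :: field mat"
  assumes T: "T \<in> left_invertible_mats r s"
  shows "GL_transversal r s {T} ((\<lambda>g. T * g) ` GL s)"
  unfolding GL_transversal_def
proof (intro conjI ballI impI)
  note Tc = left_invertible_matsD[OF T]
  have "T = T * 1\<^sub>m s" using Tc by simp
  thus "{T} \<subseteq> (\<lambda>g. T * g) ` GL s" using one_in_GL by blast
  show "(\<lambda>g. T * g) ` GL s \<subseteq> left_invertible_mats r s" using left_invertible_mats_mult[OF T] by blast
  fix y g :: "'a mat" assume y: "y \<in> (\<lambda>g. T * g) ` GL s" and g: "g \<in> GL s"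
  from y obtain h where h: "h \<in> GL s" "y = T * h" by blast
  have "y * g = T * (h * g)"
    using h Tc left_invertible_matsD[OF g] left_invertible_matsD[OF h(1)] by (simp add: mat_assoc)
  thus "y * g \<in> (\<lambda>g. T * g) ` GL s" using left_invertible_mats_mult[OF h(1) g] by blast
next
  fix z g :: "'a mat" assume "z \<in> {T}" "g \<in> GL s" "z * g \<in> {T}"
  thus "g = 1\<^sub>m s" using left_invertible_mats_mult_eq_self[OF T left_invertible_matsD] by simp
next
  fix y assume "y \<in> (\<lambda>g. T * g) ` GL s"
  thus "\<exists>z \<in> {T}. \<exists>g \<in> GL s. y = z * g" by blast
qed

lemma finite_left_invertible_mats:
  "finite (UNIV :: 'a :: field set) \<Longrightarrow> finite (left_invertible_mats r s :: 'a mat set)"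
  by (rule finite_subset[OF _ finite_carrier_mat_and_card(1)]) (auto dest: left_invertible_matsD)

text \<open>The orbits correspond to the column spaces, that is, to the \<open>s\<close>-dimensional
  subspaces. Left cancellation gives each orbit the size of \<open>GL s\<close>, so the number of
  orbits is a quotient of two known products, and one element is chosen from each.\<close>

lemma obtain_GL_transversal:
  assumes fin: "finite (UNIV :: 'a :: field set)" and sr: "s \<le> r"
  obtains Z :: "'a :: field mat set" where "GL_transversal r s Z (left_invertible_mats r s)"
    "card Z = q_binomial (card (UNIV :: 'a set)) r s"
proof -
  let ?q = "card (UNIV :: 'a set)"
  let ?Y = "left_invertible_mats r s :: 'a mat set"
  define E where "E = {(B, C). B \<in> ?Y \<and> (\<exists>g \<in> GL s. C = B * g)}"
  have E_class: "E `` {B} = (\<lambda>g. B * g) ` GL s" if "B \<in> ?Y" for B using that by (auto simp: E_def)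
  have E: "equiv ?Y E"
  proof (rule equivI)
    show "E \<subseteq> ?Y \<times> ?Y" using left_invertible_mats_mult by (auto simp: E_def)
    show "refl_on ?Y E"
    proof (rule refl_onI)
      fix B assume B: "B \<in> ?Y"
      have "B = B * 1\<^sub>m s" using left_invertible_matsD[OF B] by simp
      thus "(B, B) \<in> E" using B one_in_GL[of s] unfolding E_def by blast
    qed
    show "sym E"
    proof (rule symI)
      fix B C assume "(B, C) \<in> E"
      then obtain g where g: "B \<in> ?Y" "g \<in> GL s" "C = B * g" by (auto simp: E_def)
      obtain h where h: "h \<in> GL s" "h \<in> carrier_mat s s" "g * h = 1\<^sub>m s" using GL_inverse[OF g(2)] by metis
      have "C * h = B * (g * h)"
        using g(3) h(2) left_invertible_matsD[OF g(1)] left_invertible_matsD[OF g(2)] by (simp add: mat_assoc)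
      hence "B = C * h" unfolding h(3) using left_invertible_matsD[OF g(1)] by simp
      moreover have "C \<in> ?Y" unfolding g(3) by (rule left_invertible_mats_mult[OF g(1,2)])
      ultimately show "(C, B) \<in> E" using h(1) unfolding E_def by blast
    qed
    show "trans E"
    proof (rule transI)
      fix B C D assume "(B, C) \<in> E" "(C, D) \<in> E"
      then obtain g h where g: "B \<in> ?Y" "g \<in> GL s" "C = B * g" and h: "h \<in> GL s" "D = C * h"
        by (auto simp: E_def)
      have "D = B * (g * h)"
        using g(3) h(2) left_invertible_matsD[OF g(1)] left_invertible_matsD[OF g(2)] left_invertible_matsD[OF h(1)]
        by (simp add: mat_assoc)
      thus "(B, D) \<in> E" using g(1) left_invertible_mats_mult[OF g(2) h(1)] unfolding E_def by blast
    qed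
  qed
  have cc: "card c = card (GL s :: 'a mat set)" if "c \<in> ?Y // E" for c
  proof -
    obtain B where B: "B \<in> ?Y" "c = E `` {B}" using \<open>c \<in> ?Y // E\<close> by (rule quotientE)
    obtain K where K: "K \<in> carrier_mat s r" "K * B = 1\<^sub>m s" using B(1) by (rule left_invertible_matsE)
    have "inj_on (\<lambda>g. B * g) (GL s)"
      by (rule inj_onI)
        (erule (2) left_cancel_mat[OF K(2,1) left_invertible_matsD[OF B(1)] left_invertible_matsD left_invertible_matsD])
    thus ?thesis unfolding B(2) E_class[OF B(1)] by (rule card_image)
  qed
  have "card (GL s :: 'a mat set) * card (?Y // E) = card (\<Union> (?Y // E))"
  proof (rule card_partition)
    show "finite (?Y // E)" using E finite_left_invertible_mats[OF fin] by (simp add: finite_quotient equiv_type)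
    show "finite (\<Union> (?Y // E))" unfolding Union_quotient[OF E] by (rule finite_left_invertible_mats[OF fin])
  qed (use cc quotient_disj[OF E] in blast)+
  hence "card (?Y // E) * (\<Prod>i<s. ?q ^ s - ?q ^ i) = q_binomial ?q r s * (\<Prod>i<s. ?q ^ s - ?q ^ i)"
    by (simp add: Union_quotient[OF E] card_left_invertible_mats[OF fin] q_binomial_mult[OF sr] mult.commute)
  \<comment> \<open>This product is the order of \<open>GL s\<close>, which contains the identity,
    so it can be cancelled.\<close>
  moreover have "(\<Prod>i<s. ?q ^ s - ?q ^ i) \<noteq> 0"
    using one_in_GL[of s] finite_left_invertible_mats[OF fin, of s s]
    unfolding card_left_invertible_mats[OF fin, symmetric] by auto
  ultimately have card: "card (?Y // E) = q_binomial ?q r s" by simp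
  define f where "f c = (SOME B. B \<in> c)" for c :: "'a mat set"
  have f: "f c \<in> c" if "c \<in> ?Y // E" for c
    unfolding f_def using in_quotient_imp_non_empty[OF E that] by (auto intro: someI)
  have fY: "f c \<in> ?Y" if "c \<in> ?Y // E" for c
    using f[OF that] in_quotient_imp_subset[OF E that] by blast
  have fc: "E `` {f c} = c" if "c \<in> ?Y // E" for c
  proof -
    obtain B where B: "B \<in> ?Y" "c = E `` {B}" using \<open>c \<in> ?Y // E\<close> by (rule quotientE)
    thus ?thesis using f[OF \<open>c \<in> ?Y // E\<close>] equiv_class_eq[OF E, of B "f c"] by auto
  qed
  have "GL_transversal r s (f ` (?Y // E)) ?Y"
    unfolding GL_transversal_def
  proof (intro conjI ballI impI)
    show "f ` (?Y // E) \<subseteq> ?Y" using fY by blast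
    show "?Y \<subseteq> ?Y" by simp
    fix y g :: "'a mat" assume "y \<in> ?Y" "g \<in> GL s" thus "y * g \<in> ?Y" by (rule left_invertible_mats_mult)
  next
    fix z g :: "'a mat" assume z: "z \<in> f ` (?Y // E)" and g: "g \<in> GL s" and zg: "z * g \<in> f ` (?Y // E)"
    from z obtain c where c: "c \<in> ?Y // E" "z = f c" by blast
    from zg obtain d where d: "d \<in> ?Y // E" "z * g = f d" by blast
    have "(f c, f d) \<in> E" using g d(2) fY[OF c(1)] unfolding E_def c(2) d(2)[symmetric] by blast
    hence "c = d" using equiv_class_eq[OF E] fc c(1) d(1) by metis
    hence "z * g = z" using c(2) d(2) by simp
    thus "g = 1\<^sub>m s" using left_invertible_mats_mult_eq_self[OF fY[OF c(1)] left_invertible_matsD[OF g]] c(2) by simp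
  next
    fix y assume y: "y \<in> ?Y"
    let ?c = "E `` {y}"
    have c: "?c \<in> ?Y // E" using y by (rule quotientI)
    have "y \<in> E `` {f ?c}" unfolding fc[OF c] using y by (rule equiv_class_self[OF E])
    hence "(f ?c, y) \<in> E" by blast
    thus "\<exists>z \<in> f ` (?Y // E). \<exists>g \<in> GL s. y = z * g" using c unfolding E_def by blast
  qed
  moreover have "inj_on f (?Y // E)" using fc by (metis inj_onI)
  hence "card (f ` (?Y // E)) = q_binomial ?q r s" using card by (simp add: card_image)
  ultimately show ?thesis by (rule that)
qed

section \<open>Transfer between records with the same multiplication\<close>

lemma green_cong:
  assumes "carrier G = carrier H"
    and "\<And>x y. x \<in> carrier G \<Longrightarrow> y \<in> carrier G \<Longrightarrow> x \<otimes>\<^bsub>G\<^esub> y = x \<otimes>\<^bsub>H\<^esub> y"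
  shows "green_R G = green_R H" "green_L G = green_L H" "green_H G = green_H H" "green_D G = green_D H"
proof -
  have "principal_right_ideal G x = principal_right_ideal H x"
    "principal_left_ideal G x = principal_left_ideal H x" if "x \<in> carrier G" for x
    using assms that by (auto simp: principal_right_ideal_def principal_left_ideal_def)
  thus "green_R G = green_R H" "green_L G = green_L H"
    using assms(1) by (auto simp: green_R_def green_L_def)
  thus "green_H G = green_H H" "green_D G = green_D H"
    by (simp_all add: green_H_def green_D_def)
qed

text \<open>The required identity is the image of the identity of \<open>G\<close>, whatever the
  field \<open>one\<close> of \<open>S\<close> contains.\<close>

lemma iso_imp_is_subgroup_of_semigroup:
  assumes "Group.group G" "f \<in> iso G (S\<lparr>carrier := K\<rparr>)"
  shows "is_subgroup_of_semigroup S K"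
  using group.iso_imp_img_group[OF assms] by (auto simp: is_subgroup_of_semigroup_def)

lemma is_subgroup_of_semigroup_cong:
  assumes "\<And>x y. x \<in> K \<Longrightarrow> y \<in> K \<Longrightarrow> x \<otimes>\<^bsub>G\<^esub> y = x \<otimes>\<^bsub>H\<^esub> y"
  shows "is_subgroup_of_semigroup G K \<longleftrightarrow> is_subgroup_of_semigroup H K"
proof -
  have *: "is_subgroup_of_semigroup H K"
    if eq: "\<And>x y. x \<in> K \<Longrightarrow> y \<in> K \<Longrightarrow> x \<otimes>\<^bsub>G\<^esub> y = x \<otimes>\<^bsub>H\<^esub> y"
      and sub: "is_subgroup_of_semigroup G K" for G :: "('a, 'x) monoid_scheme" and H :: "('a, 'y) monoid_scheme"
  proof -
    obtain e where "Group.group (G\<lparr>carrier := K, one := e\<rparr>)"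
      using sub by (auto simp: is_subgroup_of_semigroup_def)
    moreover have "id \<in> iso (G\<lparr>carrier := K, one := e\<rparr>) (H\<lparr>carrier := K\<rparr>)"
      using eq by (auto simp: iso_def hom_def)
    ultimately show ?thesis by (rule iso_imp_is_subgroup_of_semigroup)
  qed
  show ?thesis using *[of G H] *[of H G] assms by auto
qed

lemma group_general_linear_group: "Group.group (general_linear_group TYPE('a :: field) s)"
proof -
  interpret R: ring "full_mat_monoid TYPE('a) s" by (rule ring_mat)
  show ?thesis by (rule R.units_group)
qed

lemma mult_general_linear_group:
  "g \<otimes>\<^bsub>general_linear_group TYPE('a :: field) s\<^esub> h = g * h"
  by (simp add: units_of_def ring_mat_simps)

context sandwich
begin

section \<open>Factors over a prescribed set of blocks\<close>

definition lefts_over :: "nat \<Rightarrow> 'a mat set \<Rightarrow> 'a mat set" where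
  "lefts_over s Z = {U \<in> carrier_mat m s. a * U \<in> Z}"

definition rights_over :: "nat \<Rightarrow> 'a mat set \<Rightarrow> 'a mat set" where
  "rights_over s Z = {V \<in> carrier_mat s n. transpose_mat (V * b) \<in> Z}"

lemma lefts_over_eq: "lefts s = lefts_over s (left_invertible_mats r s)"
  and rights_over_eq: "rights s = rights_over s (left_invertible_mats r s)"
  by (simp_all add: lefts_def lefts_over_def rights_def rights_over_def)

lemma lefts_over_mono: "Z \<subseteq> Y \<Longrightarrow> lefts_over s Z \<subseteq> lefts_over s Y"
  and rights_over_mono: "Z \<subseteq> Y \<Longrightarrow> rights_over s Z \<subseteq> rights_over s Y"
  by (auto simp: lefts_over_def rights_over_def)

lemma card_lefts_over:
  assumes "finite (UNIV :: 'a set)" "Z \<subseteq> left_invertible_mats r s"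
  shows "finite (lefts_over s Z)" "card (lefts_over s Z) = card (UNIV :: 'a set) ^ (s * (m - r)) * card Z"
proof -
  have "Z \<subseteq> carrier_mat r s" using assms(2) by (auto dest: left_invertible_matsD)
  from card_truncated_mats[OF assms(1) r_le(1) this]
  show "finite (lefts_over s Z)" "card (lefts_over s Z) = card (UNIV :: 'a set) ^ (s * (m - r)) * card Z"
    by (simp_all add: lefts_over_def a_def)
qed

lemma card_rights_over:
  assumes "finite (UNIV :: 'a set)" "Z \<subseteq> left_invertible_mats r s"
  shows "finite (rights_over s Z)" "card (rights_over s Z) = card (UNIV :: 'a set) ^ (s * (n - r)) * card Z"
proof -
  have Z: "Z \<subseteq> carrier_mat r s" using assms(2) by (auto dest: left_invertible_matsD)
  let ?S = "{U \<in> carrier_mat n s. trunc_mat r n * U \<in> Z}"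
  have tr: "transpose_mat (V * b) = trunc_mat r n * transpose_mat V" if "V \<in> carrier_mat s n" for V
    using that by (subst transpose_mult[OF _ b_carrier]) (auto simp: b_def)
  have "bij_betw transpose_mat ?S (rights_over s Z)"
    by (rule bij_betw_byWitness[where f' = transpose_mat]) (auto simp: rights_over_def tr)
  with card_truncated_mats[OF assms(1) r_le(2) Z]
  show "finite (rights_over s Z)" "card (rights_over s Z) = card (UNIV :: 'a set) ^ (s * (n - r)) * card Z"
    by (simp_all add: bij_betw_finite bij_betw_same_card[symmetric])
qed

lemma transpose_GL_mult_b:
  assumes "g \<in> carrier_mat s s" "V \<in> carrier_mat s n"
  shows "transpose_mat (g * V * b) = transpose_mat (V * b) * transpose_mat g"
proof -
  have "g * V * b = g * (V * b)" using assms by (simp add: mat_assoc)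
  thus ?thesis using assms by (simp add: transpose_mult[of g s s "V * b" r] mult_carrier_mat[OF _ b_carrier])
qed

lemma lefts_over_GL:
  assumes tv: "GL_transversal r s Z Y" and U: "U \<in> lefts_over s Y" and g: "g \<in> GL s"
  shows "U * g \<in> lefts_over s Y"
proof -
  have Uc: "U \<in> carrier_mat m s" using U by (simp add: lefts_over_def)
  have "a * (U * g) = a * U * g" using Uc left_invertible_matsD[OF g] by (simp add: mat_assoc)
  moreover have "a * U * g \<in> Y" using GL_transversalD(4)[OF tv _ g] U by (simp add: lefts_over_def)
  moreover have "U * g \<in> carrier_mat m s" by (rule mult_carrier_mat[OF Uc left_invertible_matsD[OF g]])
  ultimately show ?thesis by (simp add: lefts_over_def)
qed

lemma rights_over_GL:
  assumes tv: "GL_transversal r s Z Y" and V: "V \<in> rights_over s Y" and g: "g \<in> GL s"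
  shows "g * V \<in> rights_over s Y"
proof -
  have Vc: "V \<in> carrier_mat s n" using V by (simp add: rights_over_def)
  have "transpose_mat (g * V * b) = transpose_mat (V * b) * transpose_mat g"
    by (rule transpose_GL_mult_b[OF left_invertible_matsD[OF g] Vc])
  moreover have "transpose_mat (V * b) * transpose_mat g \<in> Y"
    using GL_transversalD(4)[OF tv _ GL_transpose[OF g]] V by (simp add: rights_over_def)
  moreover have "g * V \<in> carrier_mat s n" by (rule mult_carrier_mat[OF left_invertible_matsD[OF g] Vc])
  ultimately show ?thesis by (simp add: rights_over_def)
qed

text \<open>Since \<open>a * (U * g) = a * U * g\<close>, the action on factors lies over the action
  on blocks. If \<open>a * U = z * g\<close>, then multiplying \<open>U\<close> by the inverse of
  \<open>g\<close> moves it over \<open>z\<close>; thus all completions of the chosen blocks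
  together represent the orbits of the full factors.\<close>

lemma lefts_over_transversal:
  assumes tv: "GL_transversal r s Z Y"
  shows "\<And>U g. U \<in> lefts_over s Z \<Longrightarrow> g \<in> GL s \<Longrightarrow> U * g \<in> lefts_over s Z \<Longrightarrow> g = 1\<^sub>m s"
    and "\<And>U. U \<in> lefts_over s Y \<Longrightarrow> \<exists>u \<in> lefts_over s Z. \<exists>g \<in> GL s. U = u * g"
proof -
  fix U g assume U: "U \<in> lefts_over s Z" "g \<in> GL s" "U * g \<in> lefts_over s Z"
  have Uc: "U \<in> carrier_mat m s" using U(1) by (simp add: lefts_over_def)
  have "a * (U * g) = a * U * g" using Uc left_invertible_matsD[OF U(2)] by (simp add: mat_assoc)
  thus "g = 1\<^sub>m s" using GL_transversalD(5)[OF tv _ U(2), of "a * U"] U by (simp add: lefts_over_def)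
next
  fix U assume U: "U \<in> lefts_over s Y"
  then obtain z g where zg: "z \<in> Z" "g \<in> GL s" "a * U = z * g"
    using tv unfolding lefts_over_def GL_transversal_def by blast
  note gc = left_invertible_matsD[OF zg(2)]
  have Uc: "U \<in> carrier_mat m s" using U by (simp add: lefts_over_def)
  obtain h where h: "h \<in> carrier_mat s s" "g * h = 1\<^sub>m s" "h * g = 1\<^sub>m s" using GL_inverse[OF zg(2)] by metis
  have z: "z \<in> carrier_mat r s" using zg(1) tv by (auto simp: GL_transversal_def intro: left_invertible_matsD)
  have "a * (U * h) = a * U * h" using Uc h(1) by (simp add: mat_assoc)
  also have "\<dots> = z * (g * h)" unfolding zg(3) using h(1) gc z by (simp add: mat_assoc)
  also have "\<dots> = z" unfolding h(2) using z by simp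
  finally have "U * h \<in> lefts_over s Z" using zg(1) Uc h(1) by (simp add: lefts_over_def)
  moreover have "U = U * h * g" using Uc h gc by (simp add: mat_assoc)
  ultimately show "\<exists>u \<in> lefts_over s Z. \<exists>g \<in> GL s. U = u * g" using zg(2) by blast
qed

text \<open>Multiplication of \<open>V\<close> by \<open>g\<close> on the left acts on the
  transposed block by \<open>transpose_mat g\<close> on the right, which is why the same transversal
  of blocks applies.\<close>

lemma rights_over_transversal:
  assumes tv: "GL_transversal r s Z Y"
  shows "\<And>V g. V \<in> rights_over s Z \<Longrightarrow> g \<in> GL s \<Longrightarrow> g * V \<in> rights_over s Z \<Longrightarrow> g = 1\<^sub>m s"
    and "\<And>V. V \<in> rights_over s Y \<Longrightarrow> \<exists>v \<in> rights_over s Z. \<exists>g \<in> GL s. V = g * v"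
proof -
  fix V g assume V: "V \<in> rights_over s Z" "g \<in> GL s" "g * V \<in> rights_over s Z"
  have Vc: "V \<in> carrier_mat s n" using V(1) by (simp add: rights_over_def)
  have "transpose_mat g = 1\<^sub>m s"
    using GL_transversalD(5)[OF tv _ GL_transpose[OF V(2)], of "transpose_mat (V * b)"]
      V transpose_GL_mult_b[OF left_invertible_matsD[OF V(2)] Vc]
    by (simp add: rights_over_def)
  thus "g = 1\<^sub>m s" by (metis transpose_one transpose_transpose)
next
  fix V assume V: "V \<in> rights_over s Y"
  then obtain z g where zg: "z \<in> Z" "g \<in> GL s" "transpose_mat (V * b) = z * g"
    using tv unfolding rights_over_def GL_transversal_def by blast
  note gc = left_invertible_matsD[OF zg(2)]
  have Vc: "V \<in> carrier_mat s n" using V by (simp add: rights_over_def)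
  obtain h where h: "h \<in> carrier_mat s s" "g * h = 1\<^sub>m s" "h * g = 1\<^sub>m s" using GL_inverse[OF zg(2)] by metis
  have z: "z \<in> carrier_mat r s" using zg(1) tv by (auto simp: GL_transversal_def intro: left_invertible_matsD)
  have "transpose_mat (transpose_mat h * V * b) = transpose_mat (V * b) * h"
    using transpose_GL_mult_b[of "transpose_mat h" s V] h(1) Vc by simp
  also have "\<dots> = z * (g * h)" unfolding zg(3) using h(1) gc z by (simp add: mat_assoc)
  also have "\<dots> = z" unfolding h(2) using z by simp
  finally have "transpose_mat h * V \<in> rights_over s Z" using zg(1) Vc h(1) by (simp add: rights_over_def)
  moreover have "V = transpose_mat g * (transpose_mat h * V)"
  proof -
    have "transpose_mat g * transpose_mat h = transpose_mat (h * g)"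
      by (rule transpose_mult[OF h(1) gc, symmetric])
    hence "transpose_mat g * transpose_mat h * V = V" unfolding h(3) using Vc by simp
    thus ?thesis using gc h(1) Vc by (simp add: mat_assoc)
  qed
  ultimately show "\<exists>v \<in> rights_over s Z. \<exists>g \<in> GL s. V = g * v" using GL_transpose[OF zg(2)] by blast
qed

text \<open>
  All unions of classes in the theorem have this shape. \<open>Y'\<close> constrains the transposed left block of the
  right factor, so that the same transversals serve both sides.
\<close>

definition products :: "nat \<Rightarrow> 'a mat set \<Rightarrow> 'a mat set \<Rightarrow> 'a mat set" where
  "products s Y Y' = {U * V | U V. U \<in> lefts_over s Y \<and> V \<in> rights_over s Y'}"

lemma productsI: "U \<in> lefts_over s Y \<Longrightarrow> V \<in> rights_over s Y' \<Longrightarrow> U * V \<in> products s Y Y'"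
  unfolding products_def by blast

lemma productsE:
  assumes "X \<in> products s Y Y'"
  obtains U V where "U \<in> lefts_over s Y" "V \<in> rights_over s Y'" "X = U * V"
  using assms unfolding products_def by blast

abbreviation all_blocks :: "nat \<Rightarrow> 'a mat set" where
  "all_blocks s \<equiv> left_invertible_mats r s"

lemma lefts_over_D: "Y \<subseteq> all_blocks s \<Longrightarrow> U \<in> lefts_over s Y \<Longrightarrow> U \<in> lefts s"
  unfolding lefts_over_eq using lefts_over_mono by blast

lemma rights_over_D: "Y \<subseteq> all_blocks s \<Longrightarrow> V \<in> rights_over s Y \<Longrightarrow> V \<in> rights s"
  unfolding rights_over_eq using rights_over_mono by blast

lemma products_subset:
  assumes "Y \<subseteq> all_blocks s" "Y' \<subseteq> all_blocks s"
  shows "products s Y Y' \<subseteq> carrier P"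
proof
  fix X assume "X \<in> products s Y Y'"
  then obtain U V where "U \<in> lefts_over s Y" "V \<in> rights_over s Y'" "X = U * V" by (rule productsE)
  thus "X \<in> carrier P" using factors_in_P(1)[OF lefts_over_D[OF assms(1)] rights_over_D[OF assms(2)]] by simp
qed

lemma obtain_factors:
  assumes "X \<in> carrier P" "vec_space.rank m X = s"
  obtains U V where "U \<in> lefts s" "V \<in> rights s" "X = U * V"
  using factorize[OF assms(1)] unfolding assms(2) by blast

text \<open>This puts a whole D-class into the shape covered by the counting lemmas, with the blocks
  on both sides unrestricted.\<close>

lemma rank_eq_products:
  "{X \<in> carrier P. vec_space.rank m X = s} = products s (all_blocks s) (all_blocks s)"
  unfolding products_def lefts_over_eq[symmetric] rights_over_eq[symmetric]
  by (auto elim!: obtain_factors simp: factors_in_P)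

section \<open>Counting Green classes by representatives\<close>

lemma green_R_related_factors:
  assumes "U \<in> lefts s" "V \<in> rights s" "(U * V, X) \<in> green_R P"
  obtains g V' where "g \<in> GL s" "V' \<in> rights s" "X = U * g * V'"
proof -
  have X: "X \<in> carrier P" "vec_space.rank m X = s"
    using assms(3) green_R_rank[OF assms(3)] factors_in_P(2)[OF assms(1,2)] by (simp_all add: green_R_iff_mem)
  obtain U' V' where f: "U' \<in> lefts s" "V' \<in> rights s" "X = U' * V'" by (rule obtain_factors[OF X])
  thus ?thesis using assms green_R_iff[OF assms(1,2) f(1,2)] that by blast
qed

lemma green_L_related_factors:
  assumes "U \<in> lefts s" "V \<in> rights s" "(U * V, X) \<in> green_L P"
  obtains g U' where "g \<in> GL s" "U' \<in> lefts s" "X = U' * (g * V)"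
proof -
  have X: "X \<in> carrier P" "vec_space.rank m X = s"
    using assms(3) green_L_rank[OF assms(3)] factors_in_P(2)[OF assms(1,2)] by (simp_all add: green_L_iff_mem)
  obtain U' V' where f: "U' \<in> lefts s" "V' \<in> rights s" "X = U' * V'" by (rule obtain_factors[OF X])
  thus ?thesis using assms green_L_iff[OF assms(1,2) f(1,2)] that by blast
qed

lemma green_H_related_factors:
  assumes "U \<in> lefts s" "V \<in> rights s" "(U * V, X) \<in> green_H P"
  obtains g where "g \<in> GL s" "X = U * g * V"
  using green_H_class[OF assms(1,2)] assms(3) that by blast

text \<open>The R-class of \<open>U * V\<close> ignores \<open>V\<close>, so one fixed
  \<open>V0\<close> is paired with all factors over \<open>Z\<close>. Taking \<open>Z\<close> to be
  one block gives a hat class; a transversal of all blocks gives a D-class.\<close>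

lemma green_R_count:
  assumes fin: "finite (UNIV :: 'a set)" and tv: "GL_transversal r s Z Y" and V0: "V0 \<in> rights s"
  shows "is_union_of_classes (products s Y (all_blocks s)) (card (UNIV :: 'a set) ^ (s * (m - r)) * card Z)
    (carrier P // green_R P)"
proof (rule is_union_of_classesI[where I = "lefts_over s Z" and f = "\<lambda>u. u * V0"])
  note sub = GL_transversalD[OF tv]
  show "equiv (carrier P) (green_R P)" by (rule equiv_green)
  show "products s Y (all_blocks s) \<subseteq> carrier P" by (rule products_subset[OF sub(2) order_refl])
  show "finite (lefts_over s Z)" "card (lefts_over s Z) = card (UNIV :: 'a set) ^ (s * (m - r)) * card Z"
    by (rule card_lefts_over[OF fin sub(3)])+
  show "u * V0 \<in> products s Y (all_blocks s)" if "u \<in> lefts_over s Z" for u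
    using that lefts_over_mono[OF sub(1)] V0 unfolding rights_over_eq by (blast intro: productsI)
  show "x' \<in> products s Y (all_blocks s)" if x: "x \<in> products s Y (all_blocks s)" and R: "(x, x') \<in> green_R P" for x x'
  proof -
    obtain U V where f: "U \<in> lefts_over s Y" "V \<in> rights_over s (all_blocks s)" "x = U * V" using x by (rule productsE)
    obtain g V' where g: "g \<in> GL s" "V' \<in> rights s" "x' = U * g * V'"
      using green_R_related_factors[OF lefts_over_D[OF sub(2) f(1)] rights_over_D[OF order_refl f(2)]] R f(3) by blast
    show ?thesis unfolding g(3) using lefts_over_GL[OF tv f(1) g(1)] g(2) unfolding rights_over_eq by (rule productsI)
  qed
  show "u = u'" if u: "u \<in> lefts_over s Z" "u' \<in> lefts_over s Z" and R: "(u * V0, u' * V0) \<in> green_R P" for u u'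
  proof -
    obtain g where g: "g \<in> GL s" "u' = u * g"
      using green_R_iff[OF lefts_over_D[OF sub(3) u(1)] V0 lefts_over_D[OF sub(3) u(2)] V0] R by blast
    have "g = 1\<^sub>m s" by (rule lefts_over_transversal(1)[OF tv u(1) g(1)]) (use u(2) g(2) in simp)
    thus ?thesis using g(2) leftsD[OF lefts_over_D[OF sub(3) u(1)]] by simp
  qed
  show "\<exists>u \<in> lefts_over s Z. (u * V0, x) \<in> green_R P" if x: "x \<in> products s Y (all_blocks s)" for x
  proof -
    obtain U V where f: "U \<in> lefts_over s Y" "V \<in> rights_over s (all_blocks s)" "x = U * V" using x by (rule productsE)
    obtain u g where u: "u \<in> lefts_over s Z" "g \<in> GL s" "U = u * g" using lefts_over_transversal(2)[OF tv f(1)] by blast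
    have "(u * V0, U * V) \<in> green_R P"
      using green_R_iff[OF lefts_over_D[OF sub(3) u(1)] V0 lefts_over_D[OF sub(2) f(1)] rights_over_D[OF order_refl f(2)]] u(2,3)
      by blast
    thus ?thesis using u(1) f(3) by blast
  qed
qed

lemma green_L_count:
  assumes fin: "finite (UNIV :: 'a set)" and tv: "GL_transversal r s Z Y" and U0: "U0 \<in> lefts s"
  shows "is_union_of_classes (products s (all_blocks s) Y) (card (UNIV :: 'a set) ^ (s * (n - r)) * card Z)
    (carrier P // green_L P)"
proof (rule is_union_of_classesI[where I = "rights_over s Z" and f = "\<lambda>v. U0 * v"])
  note sub = GL_transversalD[OF tv]
  show "equiv (carrier P) (green_L P)" by (rule equiv_green)
  show "products s (all_blocks s) Y \<subseteq> carrier P" by (rule products_subset[OF order_refl sub(2)])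
  show "finite (rights_over s Z)" "card (rights_over s Z) = card (UNIV :: 'a set) ^ (s * (n - r)) * card Z"
    by (rule card_rights_over[OF fin sub(3)])+
  show "U0 * v \<in> products s (all_blocks s) Y" if "v \<in> rights_over s Z" for v
    using that rights_over_mono[OF sub(1)] U0 unfolding lefts_over_eq by (blast intro: productsI)
  show "x' \<in> products s (all_blocks s) Y" if x: "x \<in> products s (all_blocks s) Y" and R: "(x, x') \<in> green_L P" for x x'
  proof -
    obtain U V where f: "U \<in> lefts_over s (all_blocks s)" "V \<in> rights_over s Y" "x = U * V" using x by (rule productsE)
    obtain g U' where g: "g \<in> GL s" "U' \<in> lefts s" "x' = U' * (g * V)"
      using green_L_related_factors[OF lefts_over_D[OF order_refl f(1)] rights_over_D[OF sub(2) f(2)]] R f(3) by blast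
    show ?thesis unfolding g(3) using g(2) rights_over_GL[OF tv f(2) g(1)] unfolding lefts_over_eq by (rule productsI)
  qed
  show "v = v'" if v: "v \<in> rights_over s Z" "v' \<in> rights_over s Z" and R: "(U0 * v, U0 * v') \<in> green_L P" for v v'
  proof -
    obtain g where g: "g \<in> GL s" "v' = g * v"
      using green_L_iff[OF U0 rights_over_D[OF sub(3) v(1)] U0 rights_over_D[OF sub(3) v(2)]] R by blast
    have "g = 1\<^sub>m s" by (rule rights_over_transversal(1)[OF tv v(1) g(1)]) (use v(2) g(2) in simp)
    thus ?thesis using g(2) rightsD[OF rights_over_D[OF sub(3) v(1)]] by simp
  qed
  show "\<exists>v \<in> rights_over s Z. (U0 * v, x) \<in> green_L P" if x: "x \<in> products s (all_blocks s) Y" for x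
  proof -
    obtain U V where f: "U \<in> lefts_over s (all_blocks s)" "V \<in> rights_over s Y" "x = U * V" using x by (rule productsE)
    obtain v g where v: "v \<in> rights_over s Z" "g \<in> GL s" "V = g * v" using rights_over_transversal(2)[OF tv f(2)] by blast
    have "(U0 * v, U * V) \<in> green_L P"
      using green_L_iff[OF U0 rights_over_D[OF sub(3) v(1)] lefts_over_D[OF order_refl f(1)] rights_over_D[OF sub(2) f(2)]] v(2,3)
      by blast
    thus ?thesis using v(1) f(3) by blast
  qed
qed

text \<open>The orbit of the left factor and that of the right factor vary independently, so pairs
  of representatives represent the H-classes and the two counts multiply.\<close>

lemma green_H_count:
  assumes fin: "finite (UNIV :: 'a set)" and tv: "GL_transversal r s Z Y" and tv': "GL_transversal r s Z' Y'"
  shows "is_union_of_classes (products s Y Y')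
    (card (UNIV :: 'a set) ^ (s * (m - r)) * card Z * (card (UNIV :: 'a set) ^ (s * (n - r)) * card Z'))
    (carrier P // green_H P)"
proof (rule is_union_of_classesI[where I = "lefts_over s Z \<times> rights_over s Z'" and f = "\<lambda>(u, v). u * v"])
  note sub = GL_transversalD[OF tv]
  note sub' = GL_transversalD[OF tv']
  show "equiv (carrier P) (green_H P)" by (rule equiv_green)
  show "products s Y Y' \<subseteq> carrier P" by (rule products_subset[OF sub(2) sub'(2)])
  show "finite (lefts_over s Z \<times> rights_over s Z')"
    by (intro finite_cartesian_product card_lefts_over[OF fin sub(3)] card_rights_over[OF fin sub'(3)])
  show "card (lefts_over s Z \<times> rights_over s Z') =
    card (UNIV :: 'a set) ^ (s * (m - r)) * card Z * (card (UNIV :: 'a set) ^ (s * (n - r)) * card Z')"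
    by (simp only: card_cartesian_product card_lefts_over[OF fin sub(3)] card_rights_over[OF fin sub'(3)])
  show "(case uv of (u, v) \<Rightarrow> u * v) \<in> products s Y Y'" if "uv \<in> lefts_over s Z \<times> rights_over s Z'" for uv
    using that productsI[OF subsetD[OF lefts_over_mono[OF sub(1)]] subsetD[OF rights_over_mono[OF sub'(1)]]]
    by (cases uv) simp
  show "x' \<in> products s Y Y'" if x: "x \<in> products s Y Y'" and H: "(x, x') \<in> green_H P" for x x'
  proof -
    obtain U V where f: "U \<in> lefts_over s Y" "V \<in> rights_over s Y'" "x = U * V" using x by (rule productsE)
    obtain g where g: "g \<in> GL s" "x' = U * g * V"
      using green_H_related_factors[OF lefts_over_D[OF sub(2) f(1)] rights_over_D[OF sub'(2) f(2)]] H f(3) by blast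
    show ?thesis unfolding g(2) using lefts_over_GL[OF tv f(1) g(1)] f(2) by (rule productsI)
  qed
  show "uv = uv'" if uv: "uv \<in> lefts_over s Z \<times> rights_over s Z'" "uv' \<in> lefts_over s Z \<times> rights_over s Z'"
    and H: "((case uv of (u, v) \<Rightarrow> u * v), (case uv' of (u, v) \<Rightarrow> u * v)) \<in> green_H P" for uv uv'
  proof -
    obtain u v u' v' where p: "uv = (u, v)" "uv' = (u', v')" by (cases uv, cases uv')
    have u: "u \<in> lefts_over s Z" "u' \<in> lefts_over s Z" and v: "v \<in> rights_over s Z'" "v' \<in> rights_over s Z'"
      using uv unfolding p by blast+
    note L = lefts_over_D[OF sub(3)] and R = rights_over_D[OF sub'(3)]
    have RL: "(u * v, u' * v') \<in> green_R P" "(u * v, u' * v') \<in> green_L P"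
      using H unfolding p green_H_def by simp_all
    obtain g where g: "g \<in> GL s" "u' = u * g"
      using green_R_iff[OF L[OF u(1)] R[OF v(1)] L[OF u(2)] R[OF v(2)]] RL(1) by blast
    have "g = 1\<^sub>m s" by (rule lefts_over_transversal(1)[OF tv u(1) g(1)]) (use u(2) g(2) in simp)
    moreover obtain h where h: "h \<in> GL s" "v' = h * v"
      using green_L_iff[OF L[OF u(1)] R[OF v(1)] L[OF u(2)] R[OF v(2)]] RL(2) by blast
    have "h = 1\<^sub>m s" by (rule rights_over_transversal(1)[OF tv' v(1) h(1)]) (use v(2) h(2) in simp)
    ultimately show ?thesis using p g(2) h(2) leftsD[OF L[OF u(1)]] rightsD[OF R[OF v(1)]] by simp
  qed
  show "\<exists>uv \<in> lefts_over s Z \<times> rights_over s Z'. ((case uv of (u, v) \<Rightarrow> u * v), x) \<in> green_H P"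
    if x: "x \<in> products s Y Y'" for x
  proof -
    obtain U V where f: "U \<in> lefts_over s Y" "V \<in> rights_over s Y'" "x = U * V" using x by (rule productsE)
    obtain u g where u: "u \<in> lefts_over s Z" "g \<in> GL s" "U = u * g" using lefts_over_transversal(2)[OF tv f(1)] by blast
    obtain v h where v: "v \<in> rights_over s Z'" "h \<in> GL s" "V = h * v" using rights_over_transversal(2)[OF tv' f(2)] by blast
    note uv = lefts_over_D[OF sub(3) u(1)] rights_over_D[OF sub'(3) v(1)]
      lefts_over_D[OF sub(2) f(1)] rights_over_D[OF sub'(2) f(2)]
    have "(u * v, U * V) \<in> green_H P"
      unfolding green_H_def using green_R_iff[OF uv] green_L_iff[OF uv] u(2,3) v(2,3) by blast
    thus ?thesis using u(1) v(1) f(3) by (intro bexI[of _ "(u, v)"]) simp_all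
  qed
qed

section \<open>Group structure of H-classes\<close>

lemma green_H_classE:
  assumes "K \<in> carrier P // green_H P"
  obtains U V s where "U \<in> lefts s" "V \<in> rights s" "U * V \<in> K" "K = (\<lambda>g. U * g * V) ` GL s"
proof -
  obtain Y where Y: "Y \<in> carrier P" "K = green_H P `` {Y}" using assms by (rule quotientE)
  obtain U V where f: "U \<in> lefts (vec_space.rank m Y)" "V \<in> rights (vec_space.rank m Y)" "Y = U * V"
    by (rule factorize[OF Y(1)])
  have "Y \<in> K" unfolding Y(2) by (rule equiv_class_self[OF equiv_green(3) Y(1)])
  thus ?thesis using that[OF f(1,2)] green_H_class[OF f(1,2)] Y(2) f(3) by simp
qed

lemma inj_on_between:
  assumes "U \<in> lefts s" "V \<in> rights s"
  shows "inj_on (\<lambda>g. U * g * V) (GL s)"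
  by (rule inj_onI) (erule (2) GL_between[OF assms left_invertible_matsD left_invertible_matsD])

lemma between_mult:
  assumes f: "U \<in> lefts s" "V \<in> rights s" and f': "U' \<in> lefts s" "V' \<in> rights s"
    and g: "g \<in> carrier_mat s s" "h \<in> carrier_mat s s"
  shows "(U * g * V) \<otimes>\<^bsub>P\<^esub> (U' * h * V') = U * (g * (V * b * (a * U')) * h) * V'"
  using leftsD[OF f(1)] rightsD[OF f(2)] leftsD[OF f'(1)] rightsD[OF f'(2)] g
  by (simp add: mult_P mat_assoc)

text \<open>By \<open>between_mult\<close> the class is a copy of \<open>GL s\<close> with
  multiplication twisted by \<open>V * b * (a * U)\<close>. Placing the inverse \<open>w\<close> of
  that matrix in front of \<open>g\<close> cancels the twist between two adjacent elements.\<close>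

lemma H_class_iso:
  assumes f: "U \<in> lefts s" "V \<in> rights s" and W: "V * b * (a * U) \<in> GL s"
  shows "\<exists>f. f \<in> iso (general_linear_group TYPE('a) s) (P\<lparr>carrier := (\<lambda>g. U * g * V) ` GL s\<rparr>)"
proof -
  obtain w where w: "w \<in> GL s" "w \<in> carrier_mat s s" "V * b * (a * U) * w = 1\<^sub>m s" "w * (V * b * (a * U)) = 1\<^sub>m s"
    using GL_inverse[OF W] by metis
  let ?f = "\<lambda>g. U * (w * g) * V"
  note Wc = left_invertible_matsD[OF W]
  have inv: "w * (V * b * (a * U) * g) = g" "V * b * (a * U) * (w * g) = g" if "g \<in> GL s" for g
  proof -
    note g = left_invertible_matsD[OF that]
    have "w * (V * b * (a * U) * g) = w * (V * b * (a * U)) * g" using w(2) Wc g by (intro assoc_mult_mat[symmetric])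
    thus "w * (V * b * (a * U) * g) = g" unfolding w(4) using g by simp
    have "V * b * (a * U) * (w * g) = V * b * (a * U) * w * g" using w(2) Wc g by (intro assoc_mult_mat[symmetric])
    thus "V * b * (a * U) * (w * g) = g" unfolding w(3) using g by simp
  qed
  have bij_w: "bij_betw (\<lambda>g. w * g) (GL s) (GL s)"
    by (rule bij_betw_byWitness[where f' = "\<lambda>g. V * b * (a * U) * g"])
      (use inv left_invertible_mats_mult[OF w(1)] left_invertible_mats_mult[OF W] in blast)+
  have "bij_betw (\<lambda>g. U * g * V) (GL s) ((\<lambda>g. U * g * V) ` GL s)"
    by (rule inj_on_imp_bij_betw[OF inj_on_between[OF f]])
  from bij_betw_trans[OF bij_w this] have "bij_betw ?f (GL s) ((\<lambda>g. U * g * V) ` GL s)" by (simp add: comp_def)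
  moreover have "?f (g * h) = ?f g \<otimes>\<^bsub>P\<^esub> ?f h" if "g \<in> GL s" "h \<in> GL s" for g h
  proof -
    note gh = left_invertible_matsD[OF that(1)] left_invertible_matsD[OF that(2)]
    have "?f g \<otimes>\<^bsub>P\<^esub> ?f h = U * (w * g * (V * b * (a * U)) * (w * h)) * V"
      by (rule between_mult[OF f f]) (use gh w(2) in simp_all)
    also have "w * g * (V * b * (a * U)) * (w * h) = w * g * ((V * b * (a * U) * w) * h)"
    proof -
      have "V * b * (a * U) * (w * h) = V * b * (a * U) * w * h" by (rule assoc_mult_mat[OF Wc w(2) gh(2), symmetric])
      moreover have "w * g * (V * b * (a * U)) * (w * h) = w * g * (V * b * (a * U) * (w * h))"
        by (rule assoc_mult_mat[OF mult_carrier_mat[OF w(2) gh(1)] Wc mult_carrier_mat[OF w(2) gh(2)]])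
      ultimately show ?thesis by simp
    qed
    also have "\<dots> = w * (g * h)" unfolding w(3) using gh w(2) by (simp add: mat_assoc)
    finally show ?thesis by simp
  qed
  ultimately have "?f \<in> iso (general_linear_group TYPE('a) s) (P\<lparr>carrier := (\<lambda>g. U * g * V) ` GL s\<rparr>)"
    unfolding iso_def hom_def
    by (auto simp: carrier_general_linear_group mult_general_linear_group bij_betw_def)
  thus ?thesis by blast
qed

text \<open>For necessity closure suffices: the square of \<open>U * V\<close> is
  \<open>U * W * V\<close> with \<open>W = V * b * (a * U)\<close>, and lying in the class it must
  have an invertible middle factor.\<close>

lemma subgroup_H_class_iff:
  assumes f: "U \<in> lefts s" "V \<in> rights s"
  shows "is_subgroup_of_semigroup P ((\<lambda>g. U * g * V) ` GL s) \<longleftrightarrow> V * b * (a * U) \<in> GL s"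
proof
  assume "V * b * (a * U) \<in> GL s"
  from H_class_iso[OF f this] group_general_linear_group
  show "is_subgroup_of_semigroup P ((\<lambda>g. U * g * V) ` GL s)"
    using iso_imp_is_subgroup_of_semigroup by blast
next
  let ?K = "(\<lambda>g. U * g * V) ` GL s"
  assume "is_subgroup_of_semigroup P ?K"
  then obtain e where "Group.group (P\<lparr>carrier := ?K, one := e\<rparr>)" by (auto simp: is_subgroup_of_semigroup_def)
  then interpret group "P\<lparr>carrier := ?K, one := e\<rparr>" .
  have Wc: "V * b * (a * U) \<in> carrier_mat s s"
    by (rule carrier_matI) (use leftsD[OF f(1)] rightsD[OF f(2)] in simp_all)
  have "U * 1\<^sub>m s * V \<in> ?K" using one_in_GL by blast
  hence "(U * 1\<^sub>m s * V) \<otimes>\<^bsub>P\<^esub> (U * 1\<^sub>m s * V) \<in> ?K" using m_closed by simp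
  hence "U * (1\<^sub>m s * (V * b * (a * U)) * 1\<^sub>m s) * V \<in> ?K"
    using between_mult[OF f f, of "1\<^sub>m s" "1\<^sub>m s"] by simp
  hence "U * (V * b * (a * U)) * V \<in> ?K"
    unfolding left_mult_one_mat[OF Wc] right_mult_one_mat[OF Wc] .
  then obtain g where g: "g \<in> GL s" "U * (V * b * (a * U)) * V = U * g * V" by blast
  have "V * b * (a * U) = g" by (rule GL_between[OF f Wc left_invertible_matsD[OF g(1)] g(2)])
  thus "V * b * (a * U) \<in> GL s" using g(1) by simp
qed

text \<open>Every element is uniquely \<open>u * (w * g) * v\<close> with \<open>u\<close> over the
  block of \<open>U0\<close> and \<open>v\<close> over the block of \<open>V0\<close>. The middle
  matrix of a product sees only the blocks, so it is the same \<open>?W\<close> for all pairs. Hence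
  a product keeps the outer left and the outer right factor, as in a rectangular band, and
  multiplies the group parts.\<close>

lemma rectangular_group_products:
  assumes fin: "finite (UNIV :: 'a set)" and f: "U0 \<in> lefts s" "V0 \<in> rights s"
    and W: "V0 * b * (a * U0) \<in> GL s"
  shows "is_rectangular_group (card (UNIV :: 'a set) ^ (s * (m - r))) (card (UNIV :: 'a set) ^ (s * (n - r)))
    (general_linear_group TYPE('a) s)
    (P\<lparr>carrier := products s ((\<lambda>g. a * U0 * g) ` GL s) ((\<lambda>g. transpose_mat (V0 * b) * g) ` GL s)\<rparr>)"
proof -
  let ?q = "card (UNIV :: 'a set)" and ?W = "V0 * b * (a * U0)"
  let ?Y = "(\<lambda>g. a * U0 * g) ` GL s" and ?Y' = "(\<lambda>g. transpose_mat (V0 * b) * g) ` GL s"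
  let ?L = "lefts_over s {a * U0}" and ?R = "rights_over s {transpose_mat (V0 * b)}"
  have tv: "GL_transversal r s {a * U0} ?Y"
    by (rule GL_transversal_single) (use f(1) in \<open>simp add: lefts_def\<close>)
  have tv': "GL_transversal r s {transpose_mat (V0 * b)} ?Y'"
    by (rule GL_transversal_single) (use f(2) in \<open>simp add: rights_def\<close>)
  note sub = GL_transversalD[OF tv] and sub' = GL_transversalD[OF tv']
  note L = lefts_over_D[OF sub(3)] and R = rights_over_D[OF sub'(3)]
  have VU: "v * b * (a * u) = ?W" if "u \<in> ?L" "v \<in> ?R" for u v
  proof -
    have "transpose_mat (v * b) = transpose_mat (V0 * b)" "a * u = a * U0"
      using that by (simp_all add: lefts_over_def rights_over_def)
    thus ?thesis by (metis transpose_transpose)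
  qed
  obtain w where w: "w \<in> GL s" "w \<in> carrier_mat s s" "?W * w = 1\<^sub>m s" "w * ?W = 1\<^sub>m s"
    using GL_inverse[OF W] by metis
  note Wc = left_invertible_matsD[OF W]
  obtain \<sigma> where \<sigma>: "bij_betw \<sigma> {0..<?q ^ (s * (m - r))} ?L"
    using ex_bij_betw_nat_finite[OF card_lefts_over(1)[OF fin sub(3)]]
    unfolding card_lefts_over(2)[OF fin sub(3)] by auto
  obtain \<tau> where \<tau>: "bij_betw \<tau> {0..<?q ^ (s * (n - r))} ?R"
    using ex_bij_betw_nat_finite[OF card_rights_over(1)[OF fin sub'(3)]]
    unfolding card_rights_over(2)[OF fin sub'(3)] by auto
  let ?S = "{0..<?q ^ (s * (m - r))}" and ?T = "{0..<?q ^ (s * (n - r))}"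
  have S: "\<sigma> i \<in> ?L" if "i \<in> ?S" for i using bij_betwE[OF \<sigma>] that by blast
  have T: "\<tau> i \<in> ?R" if "i \<in> ?T" for i using bij_betwE[OF \<tau>] that by blast
  define F where "F x = (case x of ((i, j), g) \<Rightarrow> \<sigma> i * (w * g) * \<tau> j)" for x
  have F: "F ((i, j), g) = \<sigma> i * (w * g) * \<tau> j" for i j g by (simp add: F_def)
  have wg: "w * g \<in> GL s" "w * g \<in> carrier_mat s s" if "g \<in> GL s" for g
    using left_invertible_mats_mult[OF w(1) that] left_invertible_matsD by blast+
  have bij: "bij_betw F ((?S \<times> ?T) \<times> GL s) (products s ?Y ?Y')"
  proof (rule bij_betwI')
    fix x y :: "(nat \<times> nat) \<times> 'a mat" assume xy: "x \<in> (?S \<times> ?T) \<times> GL s" "y \<in> (?S \<times> ?T) \<times> GL s"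
    obtain i j g where x: "x = ((i, j), g)" "i \<in> ?S" "j \<in> ?T" "g \<in> GL s" using xy(1) by blast
    obtain i' j' g' where y: "y = ((i', j'), g')" "i' \<in> ?S" "j' \<in> ?T" "g' \<in> GL s" using xy(2) by blast
    note u = S[OF x(2)] S[OF y(2)] and v = T[OF x(3)] T[OF y(3)]
    have "x = y" if eq: "F x = F y"
    proof -
      \<comment> \<open>The middle factor is bracketed to the right in order to compare the left
        factors up to \<open>GL s\<close>, and to the left in order to compare the right
        factors.\<close>
      have *: "(\<sigma> i * ((w * g) * \<tau> j), \<sigma> i' * ((w * g') * \<tau> j')) \<in> green_R P"
        "(\<sigma> i * (w * g) * \<tau> j, \<sigma> i' * (w * g') * \<tau> j') \<in> green_L P"
      proof -
        have e: "\<sigma> i * ((w * g) * \<tau> j) = F x" "\<sigma> i' * ((w * g') * \<tau> j') = F y"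
          unfolding x(1) y(1) F
          by (rule assoc_mult_mat[symmetric, OF leftsD[OF L[OF u(1)]] wg(2)[OF x(4)] rightsD[OF R[OF v(1)]]]
              assoc_mult_mat[symmetric, OF leftsD[OF L[OF u(2)]] wg(2)[OF y(4)] rightsD[OF R[OF v(2)]]])+
        have "F x \<in> carrier P"
          unfolding e(1)[symmetric] by (rule factors_in_P(1)[OF L[OF u(1)] GL_mult_rights[OF wg(1)[OF x(4)] R[OF v(1)]]])
        hence "(F x, F y) \<in> green_R P" "(F x, F y) \<in> green_L P"
          using eq equiv_green(1,2)[of P] by (auto simp: equiv_def refl_on_def)
        thus "(\<sigma> i * ((w * g) * \<tau> j), \<sigma> i' * ((w * g') * \<tau> j')) \<in> green_R P"
          "(\<sigma> i * (w * g) * \<tau> j, \<sigma> i' * (w * g') * \<tau> j') \<in> green_L P"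
          unfolding e by (simp_all add: x(1) y(1) F)
      qed
      obtain h where h: "h \<in> GL s" "\<sigma> i' = \<sigma> i * h"
        using *(1) green_R_iff[OF L[OF u(1)] GL_mult_rights[OF wg(1)[OF x(4)] R[OF v(1)]]
            L[OF u(2)] GL_mult_rights[OF wg(1)[OF y(4)] R[OF v(2)]]] by blast
      have "h = 1\<^sub>m s" by (rule lefts_over_transversal(1)[OF tv u(1) h(1)]) (use u(2) h(2) in simp)
      hence \<sigma>i: "\<sigma> i' = \<sigma> i" using h(2) leftsD[OF L[OF u(1)]] by simp
      hence i: "i' = i" using bij_betw_imp_inj_on[OF \<sigma>] x(2) y(2) by (simp add: inj_on_def)
      obtain k where k: "k \<in> GL s" "\<tau> j' = k * \<tau> j"
        using *(2) green_L_iff[OF lefts_mult_left_invertible[OF L[OF u(1)] wg(1)[OF x(4)]] R[OF v(1)]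
            lefts_mult_left_invertible[OF L[OF u(2)] wg(1)[OF y(4)]] R[OF v(2)]] by blast
      have "k = 1\<^sub>m s" by (rule rights_over_transversal(1)[OF tv' v(1) k(1)]) (use v(2) k(2) in simp)
      hence \<tau>j: "\<tau> j' = \<tau> j" using k(2) rightsD[OF R[OF v(1)]] by simp
      hence j: "j' = j" using bij_betw_imp_inj_on[OF \<tau>] x(3) y(3) by (simp add: inj_on_def)
      have "\<sigma> i * (w * g) * \<tau> j = \<sigma> i * (w * g') * \<tau> j" using eq unfolding x(1) y(1) F \<sigma>i \<tau>j .
      hence "w * g = w * g'" by (rule GL_between[OF L[OF u(1)] R[OF v(1)] wg(2)[OF x(4)] wg(2)[OF y(4)]])
      hence "g = g'"
        by (rule left_cancel_mat[OF w(3) Wc w(2) left_invertible_matsD[OF x(4)] left_invertible_matsD[OF y(4)]])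
      thus ?thesis using x(1) y(1) i j by simp
    qed
    thus "(F x = F y) = (x = y)" by blast
  next
    fix x :: "(nat \<times> nat) \<times> 'a mat" assume "x \<in> (?S \<times> ?T) \<times> GL s"
    then obtain i j g where x: "x = ((i, j), g)" "i \<in> ?S" "j \<in> ?T" "g \<in> GL s" by blast
    show "F x \<in> products s ?Y ?Y'"
      unfolding x(1) F
      by (rule productsI[OF lefts_over_GL[OF tv subsetD[OF lefts_over_mono[OF sub(1)] S[OF x(2)]] wg(1)[OF x(4)]]
          subsetD[OF rights_over_mono[OF sub'(1)] T[OF x(3)]]])
  next
    fix X assume "X \<in> products s ?Y ?Y'"
    then obtain U V where UV: "U \<in> lefts_over s ?Y" "V \<in> rights_over s ?Y'" "X = U * V" by (rule productsE)
    obtain u g where u: "u \<in> ?L" "g \<in> GL s" "U = u * g" using lefts_over_transversal(2)[OF tv UV(1)] by blast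
    obtain v h where v: "v \<in> ?R" "h \<in> GL s" "V = h * v" using rights_over_transversal(2)[OF tv' UV(2)] by blast
    obtain i where i: "i \<in> ?S" "u = \<sigma> i" using u(1) bij_betw_imp_surj_on[OF \<sigma>] by blast
    obtain j where j: "j \<in> ?T" "v = \<tau> j" using v(1) bij_betw_imp_surj_on[OF \<tau>] by blast
    note c = left_invertible_matsD[OF u(2)] left_invertible_matsD[OF v(2)] leftsD[OF L[OF u(1)]] rightsD[OF R[OF v(1)]]
    have gh: "g * h \<in> carrier_mat s s" by (rule mult_carrier_mat[OF c(1,2)])
    have "w * (?W * (g * h)) = w * ?W * (g * h)" by (rule assoc_mult_mat[OF w(2) Wc gh, symmetric])
    hence "w * (?W * (g * h)) = g * h" unfolding w(4) left_mult_one_mat[OF gh] .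
    \<comment> \<open>The factor \<open>?W\<close> compensates the \<open>w\<close> built into
      \<open>F\<close>.\<close>
    hence "F ((i, j), ?W * (g * h)) = u * (g * h) * v" unfolding F i(2) j(2) by simp
    also have "\<dots> = X" unfolding UV(3) u(3) v(3) using c by (simp add: mat_assoc)
    finally have "X = F ((i, j), ?W * (g * h))" ..
    moreover have "?W * (g * h) \<in> GL s"
      by (rule left_invertible_mats_mult[OF W left_invertible_mats_mult[OF u(2) v(2)]])
    ultimately show "\<exists>x \<in> (?S \<times> ?T) \<times> GL s. X = F x" using i(1) j(1) by blast
  qed
  have hom: "F ((i, j'), g * h) = F ((i, j), g) \<otimes>\<^bsub>P\<^esub> F ((i', j'), h)"
    if ij: "i \<in> ?S" "j \<in> ?T" "i' \<in> ?S" "j' \<in> ?T" and g: "g \<in> GL s" and h: "h \<in> GL s" for i j i' j' g h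
  proof -
    note gh = left_invertible_matsD[OF g] left_invertible_matsD[OF h]
    have "F ((i, j), g) \<otimes>\<^bsub>P\<^esub> F ((i', j'), h) = \<sigma> i * (w * g * (\<tau> j * b * (a * \<sigma> i')) * (w * h)) * \<tau> j'"
      unfolding F by (rule between_mult[OF L[OF S[OF ij(1)]] R[OF T[OF ij(2)]] L[OF S[OF ij(3)]] R[OF T[OF ij(4)]] wg(2)[OF g] wg(2)[OF h]])
    also have "\<dots> = \<sigma> i * (w * g * ?W * (w * h)) * \<tau> j'" unfolding VU[OF S[OF ij(3)] T[OF ij(2)]] ..
    also have "w * g * ?W * (w * h) = w * g * ((?W * w) * h)"
    proof -
      have "?W * (w * h) = ?W * w * h" by (rule assoc_mult_mat[OF Wc w(2) gh(2), symmetric])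
      moreover have "w * g * ?W * (w * h) = w * g * (?W * (w * h))"
        by (rule assoc_mult_mat[OF wg(2)[OF g] Wc wg(2)[OF h]])
      ultimately show ?thesis by simp
    qed
    also have "\<dots> = w * (g * h)" unfolding w(3) using gh w(2) by (simp add: mat_assoc)
    finally show ?thesis unfolding F ..
  qed
  have "F \<in> iso (rectangular_band ?S ?T \<times>\<times> general_linear_group TYPE('a) s) (P\<lparr>carrier := products s ?Y ?Y'\<rparr>)"
    unfolding iso_def hom_def mem_Collect_eq
  proof (intro conjI ballI)
    show "bij_betw F (carrier (rectangular_band ?S ?T \<times>\<times> general_linear_group TYPE('a) s))
        (carrier (P\<lparr>carrier := products s ?Y ?Y'\<rparr>))"
      using bij by (simp add: DirProd_def rectangular_band_def carrier_general_linear_group)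
    thus "F \<in> carrier (rectangular_band ?S ?T \<times>\<times> general_linear_group TYPE('a) s) \<rightarrow>
        carrier (P\<lparr>carrier := products s ?Y ?Y'\<rparr>)"
      by (auto dest: bij_betwE)
    fix x y assume "x \<in> carrier (rectangular_band ?S ?T \<times>\<times> general_linear_group TYPE('a) s)"
      "y \<in> carrier (rectangular_band ?S ?T \<times>\<times> general_linear_group TYPE('a) s)"
    then obtain i j g i' j' h where x: "x = ((i, j), g)" "i \<in> ?S" "j \<in> ?T" "g \<in> GL s"
      and y: "y = ((i', j'), h)" "i' \<in> ?S" "j' \<in> ?T" "h \<in> GL s"
      by (cases x, cases y)
        (auto simp: DirProd_def rectangular_band_def carrier_general_linear_group simp del: atLeastLessThan_iff)
    show "F (x \<otimes>\<^bsub>rectangular_band ?S ?T \<times>\<times> general_linear_group TYPE('a) s\<^esub> y)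
        = F x \<otimes>\<^bsub>P\<lparr>carrier := products s ?Y ?Y'\<rparr>\<^esub> F y"
      using hom[OF x(2,3) y(2,3) x(4) y(4)]
      by (simp add: x(1) y(1) DirProd_def rectangular_band_def mult_general_linear_group)
  qed
  thus ?thesis
    unfolding is_rectangular_group_def is_iso_def
    by (intro exI[of _ ?S] exI[of _ ?T]) auto
qed

end

section \<open>The pulled-back relations\<close>

text \<open>For \<open>m = n = r\<close> both \<open>a\<close> and \<open>b\<close> are identity
  matrices, so the sandwich product is ordinary multiplication and the factors of any rank
  factorization are admissible; in particular every square matrix is regular.\<close>

lemma ring_mat_eq_reg_sandwich:
  shows "carrier (full_mat_monoid TYPE('a :: field) r) = carrier (reg_sandwich r r r)"
    and "(X :: 'a mat) \<in> carrier_mat r r \<Longrightarrow> Y \<in> carrier_mat r r \<Longrightarrow>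
      X \<otimes>\<^bsub>full_mat_monoid TYPE('a) r\<^esub> Y = X \<otimes>\<^bsub>reg_sandwich r r r\<^esub> Y"
proof -
  interpret sandwich r r r "reg_sandwich r r r :: 'a mat monoid" by unfold_locales simp_all
  have ab: "a = 1\<^sub>m r" "b = 1\<^sub>m r" by (simp_all add: a_def b_def)
  have "A \<in> carrier (reg_sandwich r r r)" if A: "A \<in> carrier_mat r r" for A :: "'a mat"
  proof -
    define s where "s = vec_space.rank r A"
    obtain U V K L where f: "U \<in> carrier_mat r s" "V \<in> carrier_mat s r" "A = U * V"
      "K \<in> carrier_mat s r" "K * U = 1\<^sub>m s" "L \<in> carrier_mat r s" "V * L = 1\<^sub>m s"
      by (rule rank_factorization[OF A s_def])
    have "U \<in> lefts s" by (rule leftsI[OF f(1,4)]) (use f(1,5) in \<open>simp add: ab\<close>)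
    moreover have "V \<in> rights s" by (rule rightsI[OF f(2,6)]) (use f(2,7) in \<open>simp add: ab\<close>)
    ultimately show ?thesis unfolding f(3) by (rule factors_in_P)
  qed
  thus "carrier (full_mat_monoid TYPE('a) r) = carrier (reg_sandwich r r r)"
    using carrier_P_D by (auto simp: ring_mat_simps)
  show "X \<otimes>\<^bsub>full_mat_monoid TYPE('a) r\<^esub> Y = X \<otimes>\<^bsub>reg_sandwich r r r\<^esub> Y"
    if "X \<in> carrier_mat r r" "Y \<in> carrier_mat r r" for X Y :: "'a mat"
    using that by (simp add: ring_mat_simps mult_P ab)
qed

lemma green_full_mat_monoid:
  "green_R (full_mat_monoid TYPE('a :: field) r) = green_R (reg_sandwich r r r)"
  "green_L (full_mat_monoid TYPE('a :: field) r) = green_L (reg_sandwich r r r)"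
  "green_H (full_mat_monoid TYPE('a :: field) r) = green_H (reg_sandwich r r r)"
  "green_D (full_mat_monoid TYPE('a :: field) r) = green_D (reg_sandwich r r r)"
  by (rule green_cong[OF ring_mat_eq_reg_sandwich]; simp add: ring_mat_simps)+

context sandwich
begin

text \<open>A second copy of the theory, describing the target of the block map. The blocks of
  factors for \<open>P\<close> are themselves factors for this copy.\<close>

sublocale M: sandwich r r r "reg_sandwich r r r"
  by unfold_locales simp_all

section \<open>The block map and the hat classes\<close>

abbreviation \<phi> :: "'a mat \<Rightarrow> 'a mat" where "\<phi> \<equiv> top_left_block r"

lemma M_ab: "M.a = 1\<^sub>m r" "M.b = 1\<^sub>m r"
  by (simp_all add: M.a_def M.b_def)

lemma phi_factors:
  assumes "U \<in> carrier_mat m s" "V \<in> carrier_mat s n"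
  shows "\<phi> (U * V) = a * U * (V * b)"
proof -
  have "\<phi> (U * V) = a * (U * V) * b"
    unfolding a_def b_def by (rule top_left_block_eq[OF _ r_le]) (use assms in simp)
  thus ?thesis using assms by (simp add: mat_assoc)
qed

lemma lefts_top: assumes "U \<in> lefts s" shows "a * U \<in> M.lefts s"
  using assms by (simp add: lefts_def M.lefts_def M_ab left_invertible_matsD)

lemma rights_left: assumes "V \<in> rights s" shows "V * b \<in> M.rights s"
proof -
  have "V * b \<in> carrier_mat s r" by (rule mult_carrier_mat[OF rightsD[OF assms] b_carrier])
  thus ?thesis using assms by (simp add: rights_def M.rights_def M_ab)
qed

text \<open>The block map sends \<open>U * V\<close> to \<open>(a * U) * (V * b)\<close>, again a
  product of admissible factors of the same inner size, and that size is the rank.\<close>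

lemma rank_phi: assumes "X \<in> carrier P" shows "vec_space.rank r (\<phi> X) = vec_space.rank m X"
proof -
  obtain U V where f: "U \<in> lefts (vec_space.rank m X)" "V \<in> rights (vec_space.rank m X)" "X = U * V"
    by (rule factorize[OF assms])
  show ?thesis
    unfolding f(3) phi_factors[OF leftsD[OF f(1)] rightsD[OF f(2)]]
    using M.factors_in_P(2)[OF lefts_top[OF f(1)] rights_left[OF f(2)]] factors_in_P(2)[OF f(1,2)] by simp
qed

lemma phi_in_M: "X \<in> carrier P \<Longrightarrow> \<phi> X \<in> carrier (reg_sandwich r r r)"
  unfolding ring_mat_eq_reg_sandwich(1)[symmetric] by (simp add: top_left_block_def ring_mat_simps)

text \<open>Based on the second copy of the locale instead of the matrix ring;
  \<open>green_full_mat_monoid\<close> identifies the Green's relations of the two.\<close>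

definition Rhat :: "'a mat rel" where
  "Rhat = hat_rel (carrier P) \<phi> (green_R (reg_sandwich r r r))"
definition Lhat :: "'a mat rel" where
  "Lhat = hat_rel (carrier P) \<phi> (green_L (reg_sandwich r r r))"
definition Hhat :: "'a mat rel" where
  "Hhat = hat_rel (carrier P) \<phi> (green_H (reg_sandwich r r r))"

lemma equiv_hat: "equiv (carrier P) Rhat" "equiv (carrier P) Lhat" "equiv (carrier P) Hhat"
  unfolding Rhat_def Lhat_def Hhat_def using phi_in_M
  by (auto intro!: hat_rel_equiv[OF equiv_green(1)] hat_rel_equiv[OF equiv_green(2)] hat_rel_equiv[OF equiv_green(3)])

lemma Hhat_eq: "Hhat = Rhat \<inter> Lhat"
  by (auto simp: Rhat_def Lhat_def Hhat_def hat_rel_def green_H_def)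

text \<open>Both D-relations are equality of rank, and the block map preserves rank.\<close>

lemma Dhat_eq: "hat_rel (carrier P) \<phi> (green_D (reg_sandwich r r r)) = green_D P"
  using phi_in_M rank_phi by (auto simp: hat_rel_def green_D_eq M.green_D_eq)

lemma hat_rank:
  assumes "(X, Y) \<in> Rhat \<or> (X, Y) \<in> Lhat"
  shows "X \<in> carrier P" "Y \<in> carrier P" "vec_space.rank m X = vec_space.rank m Y"
proof -
  show c: "X \<in> carrier P" "Y \<in> carrier P" using assms by (auto simp: Rhat_def Lhat_def hat_rel_def)
  show "vec_space.rank m X = vec_space.rank m Y"
    using assms M.green_R_rank[of "\<phi> X" "\<phi> Y"] M.green_L_rank[of "\<phi> X" "\<phi> Y"]
    unfolding rank_phi[OF c(1)] rank_phi[OF c(2)] by (auto simp: Rhat_def Lhat_def hat_rel_def)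
qed

text \<open>Compared with \<open>green_R_iff\<close>, only the first \<open>r\<close> rows of the
  left factors have to agree up to \<open>GL s\<close>; the freedom in the remaining rows is what
  splits a hat class into several R-classes.\<close>

lemma Rhat_iff:
  assumes "U \<in> lefts s" "V \<in> rights s" "U' \<in> lefts s" "V' \<in> rights s"
  shows "(U * V, U' * V') \<in> Rhat \<longleftrightarrow> (\<exists>g \<in> GL s. a * U' = a * U * g)"
  using M.green_R_iff[OF lefts_top[OF assms(1)] rights_left[OF assms(2)] lefts_top[OF assms(3)] rights_left[OF assms(4)]]
    factors_in_P(1)[OF assms(1,2)] factors_in_P(1)[OF assms(3,4)]
  by (simp add: Rhat_def hat_rel_def phi_factors[OF leftsD[OF assms(1)] rightsD[OF assms(2)]]
      phi_factors[OF leftsD[OF assms(3)] rightsD[OF assms(4)]])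

lemma Lhat_iff:
  assumes "U \<in> lefts s" "V \<in> rights s" "U' \<in> lefts s" "V' \<in> rights s"
  shows "(U * V, U' * V') \<in> Lhat \<longleftrightarrow> (\<exists>g \<in> GL s. transpose_mat (V' * b) = transpose_mat (V * b) * g)"
proof -
  have "(U * V, U' * V') \<in> Lhat \<longleftrightarrow> (\<exists>g \<in> GL s. V' * b = g * (V * b))"
    using M.green_L_iff[OF lefts_top[OF assms(1)] rights_left[OF assms(2)] lefts_top[OF assms(3)] rights_left[OF assms(4)]]
      factors_in_P(1)[OF assms(1,2)] factors_in_P(1)[OF assms(3,4)]
    by (simp add: Lhat_def hat_rel_def phi_factors[OF leftsD[OF assms(1)] rightsD[OF assms(2)]]
        phi_factors[OF leftsD[OF assms(3)] rightsD[OF assms(4)]])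
  also have "\<dots> \<longleftrightarrow> (\<exists>g \<in> GL s. transpose_mat (V' * b) = transpose_mat (V * b) * transpose_mat g)"
  proof (rule bex_cong[OF refl])
    fix g :: "'a mat" assume g: "g \<in> GL s"
    have "transpose_mat (g * (V * b)) = transpose_mat (V * b) * transpose_mat g"
      by (rule transpose_mult[OF left_invertible_matsD[OF g] mult_carrier_mat[OF rightsD[OF assms(2)] b_carrier]])
    thus "V' * b = g * (V * b) \<longleftrightarrow> transpose_mat (V' * b) = transpose_mat (V * b) * transpose_mat g"
      by (metis transpose_transpose)
  qed
  \<comment> \<open>Transposition permutes \<open>GL s\<close>, so the quantified matrix may be
    replaced by its transpose.\<close>
  also have "\<dots> \<longleftrightarrow> (\<exists>g \<in> GL s. transpose_mat (V' * b) = transpose_mat (V * b) * g)"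
    by (metis GL_transpose transpose_transpose)
  finally show ?thesis .
qed

lemma Rhat_class:
  assumes f: "U \<in> lefts s" "V \<in> rights s"
  shows "Rhat `` {U * V} = products s ((\<lambda>g. a * U * g) ` GL s) (all_blocks s)"
proof (intro equalityI subsetI)
  fix Y assume "Y \<in> Rhat `` {U * V}"
  hence R: "(U * V, Y) \<in> Rhat" by simp
  have Y: "Y \<in> carrier P" "vec_space.rank m Y = s"
    using hat_rank[OF disjI1[OF R]] factors_in_P(2)[OF f] by simp_all
  obtain U' V' where f': "U' \<in> lefts s" "V' \<in> rights s" "Y = U' * V'" by (rule obtain_factors[OF Y])
  obtain g where "g \<in> GL s" "a * U' = a * U * g" using R Rhat_iff[OF f f'(1,2)] f'(3) by blast
  hence "U' \<in> lefts_over s ((\<lambda>g. a * U * g) ` GL s)" using leftsD[OF f'(1)] by (simp add: lefts_over_def)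
  thus "Y \<in> products s ((\<lambda>g. a * U * g) ` GL s) (all_blocks s)"
    using f'(2) unfolding f'(3) rights_over_eq by (rule productsI)
next
  fix Y assume "Y \<in> products s ((\<lambda>g. a * U * g) ` GL s) (all_blocks s)"
  then obtain U' V' where f': "U' \<in> lefts_over s ((\<lambda>g. a * U * g) ` GL s)" "V' \<in> rights_over s (all_blocks s)" "Y = U' * V'"
    by (rule productsE)
  have tv: "GL_transversal r s {a * U} ((\<lambda>g. a * U * g) ` GL s)"
    by (rule GL_transversal_single) (use f(1) in \<open>simp add: lefts_def\<close>)
  have "U' \<in> lefts s" by (rule lefts_over_D[OF GL_transversalD(2)[OF tv] f'(1)])
  thus "Y \<in> Rhat `` {U * V}"
    using Rhat_iff[OF f, of U' V'] f' by (auto simp: lefts_over_def rights_over_eq)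
qed

lemma Lhat_class:
  assumes f: "U \<in> lefts s" "V \<in> rights s"
  shows "Lhat `` {U * V} = products s (all_blocks s) ((\<lambda>g. transpose_mat (V * b) * g) ` GL s)"
proof (intro equalityI subsetI)
  fix Y assume "Y \<in> Lhat `` {U * V}"
  hence R: "(U * V, Y) \<in> Lhat" by simp
  have Y: "Y \<in> carrier P" "vec_space.rank m Y = s"
    using hat_rank[OF disjI2[OF R]] factors_in_P(2)[OF f] by simp_all
  obtain U' V' where f': "U' \<in> lefts s" "V' \<in> rights s" "Y = U' * V'" by (rule obtain_factors[OF Y])
  obtain g where "g \<in> GL s" "transpose_mat (V' * b) = transpose_mat (V * b) * g"
    using R Lhat_iff[OF f f'(1,2)] f'(3) by blast
  hence "V' \<in> rights_over s ((\<lambda>g. transpose_mat (V * b) * g) ` GL s)"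
    using rightsD[OF f'(2)] by (simp add: rights_over_def)
  with f'(1) show "Y \<in> products s (all_blocks s) ((\<lambda>g. transpose_mat (V * b) * g) ` GL s)"
    unfolding f'(3) lefts_over_eq by (rule productsI)
next
  fix Y assume "Y \<in> products s (all_blocks s) ((\<lambda>g. transpose_mat (V * b) * g) ` GL s)"
  then obtain U' V' where f': "U' \<in> lefts_over s (all_blocks s)"
    "V' \<in> rights_over s ((\<lambda>g. transpose_mat (V * b) * g) ` GL s)" "Y = U' * V'"
    by (rule productsE)
  have tv: "GL_transversal r s {transpose_mat (V * b)} ((\<lambda>g. transpose_mat (V * b) * g) ` GL s)"
    by (rule GL_transversal_single) (use f(2) in \<open>simp add: rights_def\<close>)
  have "V' \<in> rights s" by (rule rights_over_D[OF GL_transversalD(2)[OF tv] f'(2)])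
  thus "Y \<in> Lhat `` {U * V}"
    using Lhat_iff[OF f, of U' V'] f' by (auto simp: rights_over_def lefts_over_eq)
qed

text \<open>The two block conditions are imposed on one and the same factorization, so the
  intersection of the R- and L-hat classes is again a set of products.\<close>

lemma Hhat_class:
  assumes f: "U \<in> lefts s" "V \<in> rights s"
  shows "Hhat `` {U * V} =
    products s ((\<lambda>g. a * U * g) ` GL s) ((\<lambda>g. transpose_mat (V * b) * g) ` GL s)"
proof (intro equalityI subsetI)
  fix Y assume "Y \<in> Hhat `` {U * V}"
  hence R: "(U * V, Y) \<in> Rhat" and L: "(U * V, Y) \<in> Lhat" by (simp_all add: Hhat_eq)
  have Y: "Y \<in> carrier P" "vec_space.rank m Y = s"
    using hat_rank[OF disjI1[OF R]] factors_in_P(2)[OF f] by simp_all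
  obtain U' V' where f': "U' \<in> lefts s" "V' \<in> rights s" "Y = U' * V'" by (rule obtain_factors[OF Y])
  have "U' \<in> lefts_over s ((\<lambda>g. a * U * g) ` GL s)"
    using R Rhat_iff[OF f f'(1,2)] f'(3) leftsD[OF f'(1)] by (auto simp: lefts_over_def)
  moreover have "V' \<in> rights_over s ((\<lambda>g. transpose_mat (V * b) * g) ` GL s)"
    using L Lhat_iff[OF f f'(1,2)] f'(3) rightsD[OF f'(2)] by (auto simp: rights_over_def)
  ultimately show "Y \<in> products s ((\<lambda>g. a * U * g) ` GL s) ((\<lambda>g. transpose_mat (V * b) * g) ` GL s)"
    unfolding f'(3) by (rule productsI)
next
  fix Y assume "Y \<in> products s ((\<lambda>g. a * U * g) ` GL s) ((\<lambda>g. transpose_mat (V * b) * g) ` GL s)"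
  then obtain U' V' where f': "U' \<in> lefts_over s ((\<lambda>g. a * U * g) ` GL s)"
    "V' \<in> rights_over s ((\<lambda>g. transpose_mat (V * b) * g) ` GL s)" "Y = U' * V'"
    by (rule productsE)
  have tv: "GL_transversal r s {a * U} ((\<lambda>g. a * U * g) ` GL s)"
    by (rule GL_transversal_single) (use f(1) in \<open>simp add: lefts_def\<close>)
  have tv': "GL_transversal r s {transpose_mat (V * b)} ((\<lambda>g. transpose_mat (V * b) * g) ` GL s)"
    by (rule GL_transversal_single) (use f(2) in \<open>simp add: rights_def\<close>)
  have "V' \<in> rights_over s (all_blocks s)" "U' \<in> lefts_over s (all_blocks s)"
    using f' rights_over_mono[OF GL_transversalD(2)[OF tv']] lefts_over_mono[OF GL_transversalD(2)[OF tv]] by blast+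
  hence "Y \<in> Rhat `` {U * V}" "Y \<in> Lhat `` {U * V}"
    unfolding Rhat_class[OF f] Lhat_class[OF f] f'(3) using f'(1,2) by (blast intro: productsI)+
  thus "Y \<in> Hhat `` {U * V}" by (simp add: Hhat_eq)
qed

section \<open>Counting hat classes\<close>

lemma right_lift:
  assumes z: "z \<in> all_blocks s"
  shows "transpose_mat z * transpose_mat b \<in> rights s"
    and "transpose_mat (transpose_mat z * transpose_mat b * b) = z"
proof -
  note zc = left_invertible_matsD[OF z]
  have "transpose_mat z * transpose_mat b * b = transpose_mat z * (transpose_mat b * b)"
    using zc by (simp add: mat_assoc)
  thus eq: "transpose_mat (transpose_mat z * transpose_mat b * b) = z"
    unfolding b_left_inverse using zc by simp
  have "transpose_mat z * transpose_mat b \<in> carrier_mat s n" by (rule carrier_matI) (use zc in simp_all)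
  thus "transpose_mat z * transpose_mat b \<in> rights s"
    unfolding rights_def mem_Collect_eq eq using z by blast
qed

lemma left_lift:
  assumes z: "z \<in> all_blocks s"
  shows "transpose_mat a * z \<in> lefts s" and "a * (transpose_mat a * z) = z"
proof -
  note zc = left_invertible_matsD[OF z]
  have "a * (transpose_mat a * z) = a * transpose_mat a * z" using zc by (simp add: mat_assoc)
  thus eq: "a * (transpose_mat a * z) = z" unfolding a_right_inverse using zc by simp
  have "transpose_mat a * z \<in> carrier_mat m s" by (rule carrier_matI) (use zc in simp_all)
  thus "transpose_mat a * z \<in> lefts s" unfolding lefts_def mem_Collect_eq eq using z by blast
qed

text \<open>A hat class depends only on the orbit of the block, so each chosen block is completed in
  one way, by zero rows, and no power of \<open>q\<close> enters the count.\<close>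

lemma Rhat_count:
  assumes fin: "finite (UNIV :: 'a set)" and tv: "GL_transversal r s Z (all_blocks s)" and V0: "V0 \<in> rights s"
  shows "is_union_of_classes (products s (all_blocks s) (all_blocks s)) (card Z) (carrier P // Rhat)"
proof (rule is_union_of_classesI[where I = Z and f = "\<lambda>z. transpose_mat a * z * V0"])
  note sub = GL_transversalD[OF tv]
  note lift = left_lift[OF subsetD[OF sub(1)]]
  show "equiv (carrier P) Rhat" by (rule equiv_hat)
  show "products s (all_blocks s) (all_blocks s) \<subseteq> carrier P" by (rule products_subset) simp_all
  show "y \<in> products s (all_blocks s) (all_blocks s)"
    if "x \<in> products s (all_blocks s) (all_blocks s)" "(x, y) \<in> Rhat" for x y
    using that hat_rank[of x y] unfolding rank_eq_products[symmetric] by simp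
  show "finite Z" using finite_left_invertible_mats[OF fin] sub(1) by (rule finite_subset[rotated])
  show "card Z = card Z" ..
  show "transpose_mat a * z * V0 \<in> products s (all_blocks s) (all_blocks s)" if "z \<in> Z" for z
    using lift(1)[OF that] V0 unfolding lefts_over_eq rights_over_eq by (rule productsI)
  show "z = z'" if z: "z \<in> Z" "z' \<in> Z" "(transpose_mat a * z * V0, transpose_mat a * z' * V0) \<in> Rhat" for z z'
  proof -
    obtain g where g: "g \<in> GL s" "z' = z * g"
      using z(3) unfolding Rhat_iff[OF lift(1)[OF z(1)] V0 lift(1)[OF z(2)] V0] lift(2)[OF z(1)] lift(2)[OF z(2)] by blast
    have "g = 1\<^sub>m s" by (rule sub(5)[OF z(1) g(1)]) (use z(2) g(2) in simp)
    moreover have "z \<in> carrier_mat r s" using z(1) sub(1) left_invertible_matsD by blast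
    ultimately show ?thesis using g(2) by simp
  qed
  show "\<exists>z \<in> Z. (transpose_mat a * z * V0, x) \<in> Rhat" if "x \<in> products s (all_blocks s) (all_blocks s)" for x
  proof -
    obtain U V where f: "U \<in> lefts s" "V \<in> rights s" "x = U * V"
      using \<open>x \<in> products s (all_blocks s) (all_blocks s)\<close> unfolding lefts_over_eq rights_over_eq by (rule productsE)
    have "a * U \<in> all_blocks s" using f(1) by (simp add: lefts_def)
    then obtain z g where z: "z \<in> Z" "g \<in> GL s" "a * U = z * g" using tv unfolding GL_transversal_def by blast
    have "(transpose_mat a * z * V0, x) \<in> Rhat"
      unfolding f(3) Rhat_iff[OF lift(1)[OF z(1)] V0 f(1,2)] lift(2)[OF z(1)] using z(2,3) by blast
    thus ?thesis using z(1) by blast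
  qed
qed

lemma Lhat_count:
  assumes fin: "finite (UNIV :: 'a set)" and tv: "GL_transversal r s Z (all_blocks s)" and U0: "U0 \<in> lefts s"
  shows "is_union_of_classes (products s (all_blocks s) (all_blocks s)) (card Z) (carrier P // Lhat)"
proof (rule is_union_of_classesI[where I = Z and f = "\<lambda>z. U0 * (transpose_mat z * transpose_mat b)"])
  note sub = GL_transversalD[OF tv]
  note lift = right_lift[OF subsetD[OF sub(1)]]
  show "equiv (carrier P) Lhat" by (rule equiv_hat)
  show "products s (all_blocks s) (all_blocks s) \<subseteq> carrier P" by (rule products_subset) simp_all
  show "y \<in> products s (all_blocks s) (all_blocks s)"
    if "x \<in> products s (all_blocks s) (all_blocks s)" "(x, y) \<in> Lhat" for x y
    using that hat_rank[of x y] unfolding rank_eq_products[symmetric] by simp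
  show "finite Z" using finite_left_invertible_mats[OF fin] sub(1) by (rule finite_subset[rotated])
  show "card Z = card Z" ..
  show "U0 * (transpose_mat z * transpose_mat b) \<in> products s (all_blocks s) (all_blocks s)" if "z \<in> Z" for z
    using U0 lift(1)[OF that] unfolding lefts_over_eq rights_over_eq by (rule productsI)
  show "z = z'" if z: "z \<in> Z" "z' \<in> Z"
    "(U0 * (transpose_mat z * transpose_mat b), U0 * (transpose_mat z' * transpose_mat b)) \<in> Lhat" for z z'
  proof -
    obtain g where g: "g \<in> GL s" "z' = z * g"
      using z(3) unfolding Lhat_iff[OF U0 lift(1)[OF z(1)] U0 lift(1)[OF z(2)]] lift(2)[OF z(1)] lift(2)[OF z(2)] by blast
    have "g = 1\<^sub>m s" by (rule sub(5)[OF z(1) g(1)]) (use z(2) g(2) in simp)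
    moreover have "z \<in> carrier_mat r s" using z(1) sub(1) left_invertible_matsD by blast
    ultimately show ?thesis using g(2) by simp
  qed
  show "\<exists>z \<in> Z. (U0 * (transpose_mat z * transpose_mat b), x) \<in> Lhat" if "x \<in> products s (all_blocks s) (all_blocks s)" for x
  proof -
    obtain U V where f: "U \<in> lefts s" "V \<in> rights s" "x = U * V"
      using \<open>x \<in> products s (all_blocks s) (all_blocks s)\<close> unfolding lefts_over_eq rights_over_eq by (rule productsE)
    have "transpose_mat (V * b) \<in> all_blocks s" using f(2) by (simp add: rights_def)
    then obtain z g where z: "z \<in> Z" "g \<in> GL s" "transpose_mat (V * b) = z * g"
      using tv unfolding GL_transversal_def by blast
    have "(U0 * (transpose_mat z * transpose_mat b), x) \<in> Lhat"
      unfolding f(3) Lhat_iff[OF U0 lift(1)[OF z(1)] f(1,2)] lift(2)[OF z(1)] using z(2,3) by blast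
    thus ?thesis using z(1) by blast
  qed
qed

text \<open>The same transversal serves the left blocks and the transposed right blocks, and the two
  choices are independent; this is the origin of the square.\<close>

lemma Hhat_count:
  assumes fin: "finite (UNIV :: 'a set)" and tv: "GL_transversal r s Z (all_blocks s)"
  shows "is_union_of_classes (products s (all_blocks s) (all_blocks s)) ((card Z)\<^sup>2) (carrier P // Hhat)"
proof (rule is_union_of_classesI[where I = "Z \<times> Z"
      and f = "\<lambda>(z, w). transpose_mat a * z * (transpose_mat w * transpose_mat b)"])
  note sub = GL_transversalD[OF tv]
  note L = left_lift[OF subsetD[OF sub(1)]]
  note R = right_lift[OF subsetD[OF sub(1)]]
  show "equiv (carrier P) Hhat" by (rule equiv_hat)
  show "products s (all_blocks s) (all_blocks s) \<subseteq> carrier P" by (rule products_subset) simp_all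
  show "y \<in> products s (all_blocks s) (all_blocks s)"
    if "x \<in> products s (all_blocks s) (all_blocks s)" "(x, y) \<in> Hhat" for x y
    using that hat_rank[of x y] unfolding rank_eq_products[symmetric] Hhat_eq by simp
  have "finite Z" using finite_left_invertible_mats[OF fin] sub(1) by (rule finite_subset[rotated])
  thus "finite (Z \<times> Z)" by simp
  show "card (Z \<times> Z) = (card Z)\<^sup>2" by (simp add: card_cartesian_product power2_eq_square)
  show "(case zw of (z, w) \<Rightarrow> transpose_mat a * z * (transpose_mat w * transpose_mat b))
      \<in> products s (all_blocks s) (all_blocks s)" if "zw \<in> Z \<times> Z" for zw
  proof -
    obtain z w where zw: "zw = (z, w)" "z \<in> Z" "w \<in> Z" using \<open>zw \<in> Z \<times> Z\<close> by blast
    show ?thesis unfolding zw(1) case_prod_conv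
      using L(1)[OF zw(2)] R(1)[OF zw(3)] unfolding lefts_over_eq rights_over_eq by (rule productsI)
  qed
  show "p = p'" if p: "p \<in> Z \<times> Z" "p' \<in> Z \<times> Z" and H:
    "((case p of (z, w) \<Rightarrow> transpose_mat a * z * (transpose_mat w * transpose_mat b)),
      (case p' of (z, w) \<Rightarrow> transpose_mat a * z * (transpose_mat w * transpose_mat b))) \<in> Hhat" for p p'
  proof -
    obtain z w where zw: "p = (z, w)" "z \<in> Z" "w \<in> Z" using p(1) by blast
    obtain z' w' where zw': "p' = (z', w')" "z' \<in> Z" "w' \<in> Z" using p(2) by blast
    note LR = L(1)[OF zw(2)] R(1)[OF zw(3)] L(1)[OF zw'(2)] R(1)[OF zw'(3)]
    obtain g where g: "g \<in> GL s" "z' = z * g"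
      using H unfolding zw(1) zw'(1) case_prod_conv Hhat_eq Int_iff Rhat_iff[OF LR] L(2)[OF zw(2)] L(2)[OF zw'(2)]
      by blast
    obtain h where h: "h \<in> GL s" "w' = w * h"
      using H unfolding zw(1) zw'(1) case_prod_conv Hhat_eq Int_iff Lhat_iff[OF LR] R(2)[OF zw(3)] R(2)[OF zw'(3)]
      by blast
    have "g = 1\<^sub>m s" by (rule sub(5)[OF zw(2) g(1)]) (use zw'(2) g(2) in simp)
    moreover have "h = 1\<^sub>m s" by (rule sub(5)[OF zw(3) h(1)]) (use zw'(3) h(2) in simp)
    moreover have "z \<in> carrier_mat r s" "w \<in> carrier_mat r s" using zw sub(1) left_invertible_matsD by blast+
    ultimately show ?thesis using g(2) h(2) zw(1) zw'(1) by simp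
  qed
  show "\<exists>p \<in> Z \<times> Z. ((case p of (z, w) \<Rightarrow> transpose_mat a * z * (transpose_mat w * transpose_mat b)), x) \<in> Hhat"
    if "x \<in> products s (all_blocks s) (all_blocks s)" for x
  proof -
    obtain U V where f: "U \<in> lefts s" "V \<in> rights s" "x = U * V"
      using \<open>x \<in> products s (all_blocks s) (all_blocks s)\<close> unfolding lefts_over_eq rights_over_eq by (rule productsE)
    have "a * U \<in> all_blocks s" using f(1) by (simp add: lefts_def)
    then obtain z g where z: "z \<in> Z" "g \<in> GL s" "a * U = z * g" using tv unfolding GL_transversal_def by blast
    have "transpose_mat (V * b) \<in> all_blocks s" using f(2) by (simp add: rights_def)
    then obtain w h where w: "w \<in> Z" "h \<in> GL s" "transpose_mat (V * b) = w * h"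
      using tv unfolding GL_transversal_def by blast
    note LR = L(1)[OF z(1)] R(1)[OF w(1)] f(1,2)
    have "(transpose_mat a * z * (transpose_mat w * transpose_mat b), x) \<in> Hhat"
      unfolding Hhat_eq Int_iff f(3) Rhat_iff[OF LR] Lhat_iff[OF LR] L(2)[OF z(1)] R(2)[OF w(1)]
      using z(2,3) w(2,3) by blast
    thus ?thesis using z(1) w(1) by (intro bexI[of _ "(z, w)"]) simp_all
  qed
qed

text \<open>The image of \<open>U * g * V\<close> is \<open>a * U * g * (V * b)\<close>, an instance
  of the same parametrization in the second copy, where it is injective in \<open>g\<close>.\<close>

lemma phi_inj_on_H_class:
  assumes f: "U \<in> lefts s" "V \<in> rights s"
  shows "inj_on \<phi> ((\<lambda>g. U * g * V) ` GL s)"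
proof -
  have "\<phi> (U * g * V) = a * U * g * (V * b)" if g: "g \<in> GL s" for g
  proof -
    have "\<phi> (U * g * V) = a * (U * g) * (V * b)"
      by (rule phi_factors[OF mult_carrier_mat[OF leftsD[OF f(1)] left_invertible_matsD[OF g]] rightsD[OF f(2)]])
    thus ?thesis using leftsD[OF f(1)] left_invertible_matsD[OF g] by (simp add: mat_assoc)
  qed
  hence "inj_on (\<phi> \<circ> (\<lambda>g. U * g * V)) (GL s)"
    using M.inj_on_between[OF lefts_top[OF f(1)] rights_left[OF f(2)]] by (simp add: inj_on_def)
  thus ?thesis by (rule inj_on_imageI)
qed

section \<open>The group criterion along a hat class\<close>

lemma GL_mult_mult_iff:
  assumes g: "g \<in> GL s" and h: "h \<in> GL s" and W: "W \<in> carrier_mat s s"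
  shows "h * W * g \<in> GL s \<longleftrightarrow> W \<in> GL s"
proof
  assume "W \<in> GL s"
  thus "h * W * g \<in> GL s" by (intro left_invertible_mats_mult[of _ s s _ s] g h)
next
  assume hWg: "h * W * g \<in> GL s"
  obtain g' where g': "g' \<in> GL s" "g' \<in> carrier_mat s s" "g * g' = 1\<^sub>m s" using GL_inverse[OF g] by metis
  obtain h' where h': "h' \<in> GL s" "h' \<in> carrier_mat s s" "h' * h = 1\<^sub>m s" using GL_inverse[OF h] by metis
  note c = left_invertible_matsD[OF g] left_invertible_matsD[OF h] W g'(2) h'(2)
  have "h' * (h * W * g) * g' = (h' * h) * W * (g * g')" using c by (simp add: mat_assoc)
  hence "h' * (h * W * g) * g' = W" unfolding g'(3) h'(3) using W by simp
  moreover have "h' * (h * W * g) * g' \<in> GL s" by (intro left_invertible_mats_mult[of _ s s _ s] g'(1) h'(1) hWg)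
  ultimately show "W \<in> GL s" by simp
qed

text \<open>Moving within the hat class multiplies the blocks by elements of \<open>GL s\<close>,
  hence the middle matrix \<open>V0 * b * (a * U0)\<close> by invertible matrices on both sides. Its
  invertibility, which is the group criterion, is therefore common to all H-classes of the hat
  class.\<close>

lemma H_class_in_HhatE:
  assumes f: "U0 \<in> lefts s" "V0 \<in> rights s"
    and K: "K \<in> carrier P // green_H P" "K \<subseteq> Hhat `` {U0 * V0}"
  obtains U V where "U \<in> lefts s" "V \<in> rights s" "K = (\<lambda>g. U * g * V) ` GL s"
    "V * b * (a * U) \<in> GL s \<longleftrightarrow> V0 * b * (a * U0) \<in> GL s"
proof -
  obtain U V t where UV: "U \<in> lefts t" "V \<in> rights t" "U * V \<in> K" "K = (\<lambda>g. U * g * V) ` GL t"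
    by (rule green_H_classE[OF K(1)])
  have RL: "(U0 * V0, U * V) \<in> Rhat" "(U0 * V0, U * V) \<in> Lhat"
    using UV(3) K(2) unfolding Hhat_eq by blast+
  have t: "t = s"
    using hat_rank(3)[OF disjI1[OF RL(1)]] factors_in_P(2)[OF f] factors_in_P(2)[OF UV(1,2)] by simp
  note UV = UV[unfolded t]
  obtain g where g: "g \<in> GL s" "a * U = a * U0 * g" using RL(1) Rhat_iff[OF f UV(1,2)] by blast
  obtain h where h: "h \<in> GL s" "transpose_mat (V * b) = transpose_mat (V0 * b) * h"
    using RL(2) Lhat_iff[OF f UV(1,2)] by blast
  note c = leftsD[OF f(1)] rightsD[OF f(2)] left_invertible_matsD[OF g(1)] left_invertible_matsD[OF h(1)]
  have "V * b = transpose_mat (transpose_mat (V0 * b) * h)" using h(2) by (metis transpose_transpose)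
  also have "\<dots> = transpose_mat h * (V0 * b)"
    by (subst transpose_mult[of _ r s _ s]) (use c in \<open>auto intro: mult_carrier_mat[OF _ b_carrier]\<close>)
  finally have Vb: "V * b = transpose_mat h * (V0 * b)" .
  have "V * b * (a * U) = transpose_mat h * (V0 * b * (a * U0)) * g"
    unfolding Vb g(2) using c by (simp add: mat_assoc)
  moreover have "V0 * b * (a * U0) \<in> carrier_mat s s" by (rule carrier_matI) (use c in simp_all)
  ultimately have "V * b * (a * U) \<in> GL s \<longleftrightarrow> V0 * b * (a * U0) \<in> GL s"
    using GL_mult_mult_iff[OF g(1) GL_transpose[OF h(1)]] by simp
  thus ?thesis by (rule that[OF UV(1,2,4)])
qed

text \<open>In the second copy the middle matrix of the factors \<open>a * U\<close> and
  \<open>V * b\<close> is again \<open>V * b * (a * U)\<close>, so one matrix decides the group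
  question above and below.\<close>

lemma subgroup_phi_H_class_iff:
  assumes f: "U \<in> lefts s" "V \<in> rights s"
  shows "is_subgroup_of_semigroup (full_mat_monoid TYPE('a) r)
      (green_H (full_mat_monoid TYPE('a) r) `` {\<phi> (U * V)}) \<longleftrightarrow> V * b * (a * U) \<in> GL s"
proof -
  let ?K = "(\<lambda>g. a * U * g * (V * b)) ` GL s"
  note f' = lefts_top[OF f(1)] rights_left[OF f(2)]
  have K: "green_H (full_mat_monoid TYPE('a) r) `` {\<phi> (U * V)} = ?K"
    unfolding green_full_mat_monoid phi_factors[OF leftsD[OF f(1)] rightsD[OF f(2)]] by (rule M.green_H_class[OF f'])
  have "?K \<subseteq> carrier_mat r r"
  proof (rule image_subsetI)
    fix g :: "'a mat" assume "g \<in> GL s"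
    thus "a * U * g * (V * b) \<in> carrier_mat r r"
      by (rule mult_carrier_mat[OF mult_carrier_mat[OF M.leftsD[OF f'(1)] left_invertible_matsD] M.rightsD[OF f'(2)]])
  qed
  hence "is_subgroup_of_semigroup (full_mat_monoid TYPE('a) r) ?K \<longleftrightarrow>
      is_subgroup_of_semigroup (reg_sandwich r r r) ?K"
    by (intro is_subgroup_of_semigroup_cong ring_mat_eq_reg_sandwich(2)) blast+
  also have "\<dots> \<longleftrightarrow> V * b * M.b * (M.a * (a * U)) \<in> GL s" by (rule M.subgroup_H_class_iff[OF f'])
  finally show ?thesis unfolding K using M.leftsD[OF f'(1)] M.rightsD[OF f'(2)] by (simp add: M_ab)
qed

end

section \<open>Specialization to the class of one element\<close>

theorem theorem6p4:
  fixes X :: "'a :: field mat" and m n r q s :: nat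
    and P :: "'a mat monoid" and M :: "'a mat ring" and \<phi> :: "'a mat \<Rightarrow> 'a mat"
    and Rhat Lhat Hhat Dhat :: "'a mat rel" and G\<^sub>s :: "'a mat monoid"
  assumes "m \<ge> 1" and "n \<ge> 1" and "r \<le> min m n"
    and "finite (UNIV :: 'a set)" and "q = card (UNIV :: 'a set)"
    and "P = reg_sandwich m n r"
    and "M = full_mat_monoid TYPE('a) r"
    and "\<phi> = top_left_block r"
    and "Rhat = hat_rel (carrier P) \<phi> (green_R M)"
    and "Lhat = hat_rel (carrier P) \<phi> (green_L M)"
    and "Hhat = hat_rel (carrier P) \<phi> (green_H M)"
    and "Dhat = hat_rel (carrier P) \<phi> (green_D M)"
    and "X \<in> carrier P"
    and "s = vec_space.rank m X"
    and "G\<^sub>s = general_linear_group TYPE('a) s"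
  shows
    \<comment> \<open>(i)\<close>
    "is_union_of_classes (Rhat `` {X}) (q ^ (s * (m - r))) (carrier P // green_R P)
    \<comment> \<open>(ii)\<close>
     \<and> is_union_of_classes (Lhat `` {X}) (q ^ (s * (n - r))) (carrier P // green_L P)
    \<comment> \<open>(iii)\<close>
     \<and> (is_union_of_classes (Hhat `` {X}) (q ^ (s * (m + n - 2 * r))) (carrier P // green_H P)
        \<and> (\<forall>K \<in> carrier P // green_H P. K \<subseteq> Hhat `` {X} \<longrightarrow> card K = card (carrier G\<^sub>s))
        \<and> card (carrier G\<^sub>s) = q ^ (s choose 2) * (q - 1) ^ s * q_factorial q s
        \<and> (\<forall>K \<in> carrier P // green_H P. inj_on \<phi> K))
    \<comment> \<open>(iv)\<close>
     \<and> (\<not> is_subgroup_of_semigroup M (green_H M `` {\<phi> X}) \<longrightarrow>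
        (\<forall>K \<in> carrier P // green_H P. K \<subseteq> Hhat `` {X} \<longrightarrow> \<not> is_subgroup_of_semigroup P K))
    \<comment> \<open>(v)\<close>
     \<and> (is_subgroup_of_semigroup M (green_H M `` {\<phi> X}) \<longrightarrow>
        (\<forall>K \<in> carrier P // green_H P. K \<subseteq> Hhat `` {X} \<longrightarrow>
           is_subgroup_of_semigroup P K \<and> P\<lparr>carrier := K\<rparr> \<cong> G\<^sub>s)
        \<and> is_rectangular_group (q ^ (s * (m - r))) (q ^ (s * (n - r))) G\<^sub>s
            (P\<lparr>carrier := Hhat `` {X}\<rparr>))
    \<comment> \<open>(vi)\<close>
     \<and> (Dhat = green_D P
        \<and> Dhat `` {X} = green_D P `` {X}
        \<and> green_D P `` {X} = {Y \<in> carrier P. vec_space.rank m Y = s}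
        \<and> is_union_of_classes (Dhat `` {X}) (q_binomial q r s) (carrier P // Rhat)
        \<and> is_union_of_classes (Dhat `` {X}) (q_binomial q r s) (carrier P // Lhat)
        \<and> is_union_of_classes (Dhat `` {X}) (q ^ (s * (m - r)) * q_binomial q r s)
            (carrier P // green_R P)
        \<and> is_union_of_classes (Dhat `` {X}) (q ^ (s * (n - r)) * q_binomial q r s)
            (carrier P // green_L P)
        \<and> is_union_of_classes (Dhat `` {X}) ((q_binomial q r s)\<^sup>2) (carrier P // Hhat)
        \<and> is_union_of_classes (Dhat `` {X}) (q ^ (s * (m + n - 2 * r)) * (q_binomial q r s)\<^sup>2)
            (carrier P // green_H P))"
proof -
  note assms_r = \<open>r \<le> min m n\<close> and fin = \<open>finite (UNIV :: 'a set)\<close> and q = \<open>q = card (UNIV :: 'a set)\<close>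
    and P = \<open>P = reg_sandwich m n r\<close> and M = \<open>M = full_mat_monoid TYPE('a) r\<close>
    and phi = \<open>\<phi> = top_left_block r\<close> and X = \<open>X \<in> carrier P\<close> and s = \<open>s = vec_space.rank m X\<close>
    and G = \<open>G\<^sub>s = general_linear_group TYPE('a) s\<close>
  interpret S: sandwich m n r P by unfold_locales (use assms_r P in simp_all)
  have hats: "Rhat = S.Rhat" "Lhat = S.Lhat" "Hhat = S.Hhat" "Dhat = green_D P"
    unfolding \<open>Rhat = _\<close> \<open>Lhat = _\<close> \<open>Hhat = _\<close> \<open>Dhat = _\<close> M phi green_full_mat_monoid S.Dhat_eq
    by (simp_all add: S.Rhat_def S.Lhat_def S.Hhat_def)
  obtain U V where f: "U \<in> S.lefts s" "V \<in> S.rights s" "X = U * V"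
    by (rule S.obtain_factors[OF X s[symmetric]])
  have aU: "S.a * U \<in> left_invertible_mats r s" using f(1) by (simp add: S.lefts_def)
  have Vb: "transpose_mat (V * S.b) \<in> left_invertible_mats r s" using f(2) by (simp add: S.rights_def)
  note tvU = GL_transversal_single[OF aU] and tvV = GL_transversal_single[OF Vb]
  \<comment> \<open>The block of \<open>U\<close> is left invertible with \<open>r\<close> rows and
    \<open>s\<close> columns.\<close>
  have sr: "s \<le> r"
    using aU left_inverse_mat_le by (metis left_invertible_matsD left_invertible_matsE)
  obtain Z :: "'a mat set" where Z: "GL_transversal r s Z (left_invertible_mats r s)" "card Z = q_binomial q r s"
    unfolding q by (rule obtain_GL_transversal[OF fin sr])
  have carrier_G: "carrier G\<^sub>s = GL s" unfolding G by (rule carrier_general_linear_group)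
  \<comment> \<open>The bound on \<open>r\<close> makes all three truncated subtractions exact,
    which splits the exponent for H-classes into those for R- and L-classes.\<close>
  have "(m - r) + (n - r) = m + n - 2 * r" using assms_r by simp
  hence exponent: "q ^ (s * (m + n - 2 * r)) = q ^ (s * (m - r)) * q ^ (s * (n - r))"
    by (metis distrib_left power_add)
  have D: "green_D P `` {X} = S.products s (left_invertible_mats r s) (left_invertible_mats r s)"
    unfolding S.rank_eq_products[symmetric] S.green_D_eq using X s by auto
  have class_in_Hhat: "\<exists>U' V'. U' \<in> S.lefts s \<and> V' \<in> S.rights s \<and> K = (\<lambda>g. U' * g * V') ` GL s \<and>
      (V' * S.b * (S.a * U') \<in> GL s \<longleftrightarrow> V * S.b * (S.a * U) \<in> GL s)"
    if "K \<in> carrier P // green_H P" "K \<subseteq> Hhat `` {X}" for K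
    using S.H_class_in_HhatE[OF f(1,2) that(1) that(2)[unfolded hats f(3)]] by blast
  have subgroup: "is_subgroup_of_semigroup M (green_H M `` {\<phi> X}) \<longleftrightarrow> V * S.b * (S.a * U) \<in> GL s"
    unfolding M phi f(3) by (rule S.subgroup_phi_H_class_iff[OF f(1,2)])
  \<comment> \<open>The transversal is the single block of \<open>U\<close>, so its size contributes
    the factor 1.\<close>
  have i: "is_union_of_classes (Rhat `` {X}) (q ^ (s * (m - r))) (carrier P // green_R P)"
    using S.green_R_count[OF fin tvU f(2)] unfolding hats f(3) S.Rhat_class[OF f(1,2)] q by simp
  have ii: "is_union_of_classes (Lhat `` {X}) (q ^ (s * (n - r))) (carrier P // green_L P)"
    using S.green_L_count[OF fin tvV f(1)] unfolding hats f(3) S.Lhat_class[OF f(1,2)] q by simp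
  have iiia: "is_union_of_classes (Hhat `` {X}) (q ^ (s * (m + n - 2 * r))) (carrier P // green_H P)"
    using S.green_H_count[OF fin tvU tvV] unfolding hats f(3) S.Hhat_class[OF f(1,2)] q[symmetric] exponent by simp
  have iiib: "card K = card (carrier G\<^sub>s)" if K: "K \<in> carrier P // green_H P" "K \<subseteq> Hhat `` {X}" for K
  proof -
    obtain U' V' where "U' \<in> S.lefts s" "V' \<in> S.rights s" "K = (\<lambda>g. U' * g * V') ` GL s"
      using class_in_Hhat[OF K] by blast
    thus ?thesis using S.inj_on_between[of U' s V'] by (simp add: carrier_G card_image)
  qed
  \<comment> \<open>The square case of the column count, where the complementary q-factorial is that
    of 0 and equals 1.\<close>
  have iiic: "card (carrier G\<^sub>s) = q ^ (s choose 2) * (q - 1) ^ s * q_factorial q s"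
    using prod_q_power_diff[of s s q] card_left_invertible_mats[OF fin, of s s]
    by (simp add: carrier_G q q_factorial_def[of _ 0])
  have iiid: "inj_on \<phi> K" if K: "K \<in> carrier P // green_H P" for K
    using S.green_H_classE[OF K] S.phi_inj_on_H_class unfolding phi by metis
  have v_group: "is_subgroup_of_semigroup P K \<longleftrightarrow> is_subgroup_of_semigroup M (green_H M `` {\<phi> X})"
    if K: "K \<in> carrier P // green_H P" "K \<subseteq> Hhat `` {X}" for K
    using class_in_Hhat[OF K] S.subgroup_H_class_iff subgroup by metis
  have v_iso: "P\<lparr>carrier := K\<rparr> \<cong> G\<^sub>s"
    if K: "K \<in> carrier P // green_H P" "K \<subseteq> Hhat `` {X}"
      and g: "is_subgroup_of_semigroup M (green_H M `` {\<phi> X})" for K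
  proof -
    obtain U' V' where UV: "U' \<in> S.lefts s" "V' \<in> S.rights s" "K = (\<lambda>g. U' * g * V') ` GL s"
      "V' * S.b * (S.a * U') \<in> GL s"
      using class_in_Hhat[OF K] g subgroup by blast
    have "G\<^sub>s \<cong> P\<lparr>carrier := K\<rparr>"
      using S.H_class_iso[OF UV(1,2,4)] unfolding G UV(3) is_iso_def by blast
    thus ?thesis unfolding G by (rule group.iso_sym[OF group_general_linear_group])
  qed
  have v_rect: "is_rectangular_group (q ^ (s * (m - r))) (q ^ (s * (n - r))) G\<^sub>s (P\<lparr>carrier := Hhat `` {X}\<rparr>)"
    if "is_subgroup_of_semigroup M (green_H M `` {\<phi> X})"
    unfolding hats f(3) S.Hhat_class[OF f(1,2)] q G
    by (rule S.rectangular_group_products[OF fin f(1,2)]) (use that subgroup in blast)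
  have vi: "Dhat = green_D P" "Dhat `` {X} = green_D P `` {X}"
    "green_D P `` {X} = {Y \<in> carrier P. vec_space.rank m Y = s}"
    unfolding S.green_D_eq hats using X s by auto
  have via: "is_union_of_classes (Dhat `` {X}) (q_binomial q r s) (carrier P // Rhat)"
    "is_union_of_classes (Dhat `` {X}) (q_binomial q r s) (carrier P // Lhat)"
    using S.Rhat_count[OF fin Z(1) f(2)] S.Lhat_count[OF fin Z(1) f(1)] unfolding hats D Z(2) by blast+
  have vib: "is_union_of_classes (Dhat `` {X}) (q ^ (s * (m - r)) * q_binomial q r s) (carrier P // green_R P)"
    using S.green_R_count[OF fin Z(1) f(2)] unfolding hats D Z(2) q .
  have vic: "is_union_of_classes (Dhat `` {X}) (q ^ (s * (n - r)) * q_binomial q r s) (carrier P // green_L P)"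
    using S.green_L_count[OF fin Z(1) f(1)] unfolding hats D Z(2) q .
  have vid: "is_union_of_classes (Dhat `` {X}) ((q_binomial q r s)\<^sup>2) (carrier P // Hhat)"
    using S.Hhat_count[OF fin Z(1)] unfolding hats D Z(2) .
  have "q ^ (s * (m + n - 2 * r)) * (q_binomial q r s)\<^sup>2
      = q ^ (s * (m - r)) * q_binomial q r s * (q ^ (s * (n - r)) * q_binomial q r s)"
    unfolding exponent by (simp add: power2_eq_square mult_ac)
  hence vie: "is_union_of_classes (Dhat `` {X}) (q ^ (s * (m + n - 2 * r)) * (q_binomial q r s)\<^sup>2)
      (carrier P // green_H P)"
    using S.green_H_count[OF fin Z(1) Z(1)] unfolding hats D Z(2) q[symmetric] by simp
  show ?thesis
    using i ii iiia iiib iiic iiid v_group v_iso v_rect vi via vib vic vid vie by blast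
qed

end
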